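(* Let $r\in[1,+\infty]$ (an integer $\geq 1$ or $+\infty$). Let $\pi:\Omega\to M$ be a $\mathcal{C}^r$ affine $d$-dimensional tori bundle over a manifold $M$. Then, for a Baire generic subset of compatible flows $(g_t)_{t\in\mathbb{R}}$ in $\mathcal{F}^r(M,\mathbb{R}^d)$, the dynamical system $(\Omega,\mu,(g_t)_{t\in\mathbb{R}})$ exhibits Keplerian shear for all absolutely continuous compatible probability measures $\mu$ on $\Omega$.
   Context: $\mathcal{C}^r$ affine tori bundle: a $\mathcal{C}^r$ manifold $\Omega$ together with integers $n,d\ge 1$, an $n$-dimensional $\mathcal{C}^r$ real manifold $M$, a $\mathcal{C}^r$ projection $\pi:\Omega\to M$, and a maximal atlas $\mathcal{A}$ on $M$ (maximal among atlases trivializing the bundle in the following sense) such that for every $U\in\mathcal{A}$ there is a $\mathcal{C}^r$ diffeomorphism $\psi_U:\pi^{-1}(U)\to U\times\mathbb{T}^d$ with $\pi_1\circ\psi_U=\pi$ ($\pi_1$ the first projection), the changes of charts being of the form $\psi_V\circ\psi_U^{-1}(x,y)=(x,\alpha_{U,V}(x)+A_{U,V}(y))$ on $(U\cap V)\times\mathbb{T}^d$, with $\alpha_{U,V}$ a $\mathcal{C}^r$ map $U\cap V\to\mathbb{T}^d$ and $A_{U,V}\in\mathrm{GL}_d(\mathbb{Z})$. $\mathcal{C}^r$ compatible flow: a flow $(g_t)$ on $\Omega$ such that for every chart $\psi_U$ there is $v_{\psi_U}\in\mathcal{C}^r(U,\mathbb{R}^d)$ with $\psi_U\circ g_t\circ\psi_U^{-1}(x,y)=(x,y+tv_{\psi_U}(x))$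 for all $t\in\mathbb{R}$. $\mathcal{F}^r(M,\mathbb{R}^d)$ denotes the set of all $\mathcal{C}^r$ compatible flows on $\Omega$. Topology on $\mathcal{F}^r(M,\mathbb{R}^d)$: take a locally finite open cover $(U_i)_{i\in I}$ of $M$ with trivializing charts $\varphi_i:U_i\to W_i\subset\mathbb{R}^n$, and a cover $(K_i)_{i\in I}$ of $M$ by compact sets with $K_i\subset U_i$. Each flow $v\in\mathcal{F}^r(M,\mathbb{R}^d)$ corresponds to a unique family $(v_i)_{i\in I}$ of generating functions $v_i\in\mathcal{C}^r(U_i,\mathbb{R}^d)$. A sequence $(v_m)$ converges to $v$ if for all $i\in I$ all derivatives (up to order $r$, in the chart $\varphi_i$) of $v_{m,i}$ converge to those of $v_i$ uniformly on $K_i$. This topology does not depend on the choices and makes $\mathcal{F}^r(M,\mathbb{R}^d)$ a Baire space. A subset is Baire generic if it contains a countable intersection of dense open sets. Compatible measure: a $\sigma$-finite measure $\mu$ on $\Omega$ such that for every chart $\psi_U$, $(\psi_U)_*\mu_{|\pi^{-1}(U)}=(\pi_*\mu)_{|U}\otimes\mathrm{Leb}_{\mathbb{T}^d}$; such measures are invariant under compatible flows. Absolutely continuous means absolutely continuous with respect to Lebesgue measure in charts. Keplerian shear: a flow $(\Omega,\mu,(g_t)_{t\in\mathbb{R}})$ preserving a probability measure $\mu$ exhibits Keplerian shear if for all $f\in\mathbb{L}^2(\Omega,\mu)$, $f\circ g_t\to\mathbb{E}_\mu(f\mid\mathcal{I})$ as $t\to+\infty$, weakly in $\mathbb{L}^2(\Omega,\mu)$,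 where $\mathcal{I}$ is the $\sigma$-algebra of $(g_t)$-invariant measurable sets (up to $\mu$-null sets). *)

theory Defs
  imports "HOL-Probability.Probability" "HOL-Library.Extended_Nat"
begin

section \<open>Maps of class \<open>C^r\<close> between manifolds\<close>

text \<open>The regularity \<open>r\<close> is an extended natural number, \<open>\<infinity>\<close> standing for smoothness.
  \<open>pderivs [b1, ..., bk] f\<close> is the iterated derivative of \<open>f\<close> in the directions
  \<open>b1, ..., bk\<close>; for basis vectors these are the partial derivatives of order \<open>k\<close>.\<close>

primrec pderivs ::
  "'a list \<Rightarrow> ('a::real_normed_vector \<Rightarrow> 'b::real_normed_vector) \<Rightarrow> 'a \<Rightarrow> 'b" where
  "pderivs [] f = f"
| "pderivs (b # bs) f = (\<lambda>x. frechet_derivative (pderivs bs f) (at x) b)"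

text \<open>Only used for open \<open>W\<close>.\<close>

definition Cr_on ::
  "enat \<Rightarrow> 'a::euclidean_space set \<Rightarrow> ('a \<Rightarrow> 'b::euclidean_space) \<Rightarrow> bool" where
  "Cr_on r W f \<longleftrightarrow> (\<forall>bs \<in> lists Basis. enat (length bs) \<le> r \<longrightarrow>
      continuous_on W (pderivs bs f) \<and>
      (enat (length bs) < r \<longrightarrow> (\<forall>x\<in>W. pderivs bs f differentiable (at x))))"

text \<open>A chart is a pair \<open>(U, \<phi>)\<close>; the values of \<open>\<phi>\<close> outside its domain \<open>U\<close> are irrelevant.
  An atlas covers the whole carrier type; Hausdorffness and second countability of
  manifolds are imposed through type classes.\<close>

type_synonym ('a, 'e) chart = "'a set \<times> ('a \<Rightarrow> 'e)"

definition is_chart :: "('a::topological_space, 'e::euclidean_space) chart \<Rightarrow> bool" where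
  "is_chart = (\<lambda>(U, \<phi>). open U \<and> open (\<phi> ` U) \<and> homeomorphism U (\<phi> ` U) \<phi> (inv_into U \<phi>))"

definition Cr_related ::
  "enat \<Rightarrow> ('a::topological_space, 'e::euclidean_space) chart \<Rightarrow> ('a, 'e) chart \<Rightarrow> bool" where
  "Cr_related r = (\<lambda>(U, \<phi>) (V, \<xi>).
      Cr_on r (\<phi> ` (U \<inter> V)) (\<xi> \<circ> inv_into U \<phi>) \<and>
      Cr_on r (\<xi> ` (U \<inter> V)) (\<phi> \<circ> inv_into V \<xi>))"

definition Cr_atlas ::
  "enat \<Rightarrow> ('a::topological_space, 'e::euclidean_space) chart set \<Rightarrow> bool" where
  "Cr_atlas r A \<longleftrightarrow> (\<forall>c\<in>A. is_chart c) \<and> (\<Union>c\<in>A. fst c) = UNIV \<and>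
      (\<forall>c\<in>A. \<forall>c'\<in>A. Cr_related r c c')"

text \<open>All charts of the \<open>C^r\<close> structure given by the atlas \<open>A\<close>, that is, the maximal
  \<open>C^r\<close> atlas containing \<open>A\<close>.\<close>

definition Cr_charts ::
  "enat \<Rightarrow> ('a::topological_space, 'e::euclidean_space) chart set \<Rightarrow> ('a, 'e) chart set" where
  "Cr_charts r A = {c. is_chart c \<and> (\<forall>c'\<in>A. Cr_related r c c')}"

text \<open>\<open>Cr_map r A S B f\<close>: \<open>f\<close> is of class \<open>C^r\<close> on the open set \<open>S\<close>, with respect to the
  atlases \<open>A\<close> of the source and \<open>B\<close> of the target.\<close>

definition Cr_map ::
  "enat \<Rightarrow> ('a::topological_space, 'e::euclidean_space) chart set \<Rightarrow> 'a set \<Rightarrow>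
    ('b::topological_space, 'f::euclidean_space) chart set \<Rightarrow> ('a \<Rightarrow> 'b) \<Rightarrow> bool" where
  "Cr_map r A S B f \<longleftrightarrow> continuous_on S f \<and>
      (\<forall>(U, \<phi>)\<in>A. \<forall>(V, \<xi>)\<in>B. Cr_on r (\<phi> ` (S \<inter> U \<inter> f -` V)) (\<xi> \<circ> f \<circ> inv_into U \<phi>))"

definition Cr_diffeo ::
  "enat \<Rightarrow> ('a::topological_space, 'e::euclidean_space) chart set \<Rightarrow> 'a set \<Rightarrow>
    ('b::topological_space, 'f::euclidean_space) chart set \<Rightarrow> 'b set \<Rightarrow> ('a \<Rightarrow> 'b) \<Rightarrow> bool" where
  "Cr_diffeo r A S B T f \<longleftrightarrow>
      bij_betw f S T \<and> Cr_map r A S B f \<and> Cr_map r B T A (inv_into S f)"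

definition euclidean_atlas :: "('e, 'e::euclidean_space) chart set" where
  "euclidean_atlas = {(UNIV, id)}"

definition prod_atlas ::
  "('a, 'e::euclidean_space) chart set \<Rightarrow> ('b, 'f::euclidean_space) chart set \<Rightarrow>
    ('a \<times> 'b, 'e \<times> 'f) chart set" where
  "prod_atlas A B = {(U \<times> V, map_prod \<phi> \<xi>) | U \<phi> V \<xi>. (U, \<phi>) \<in> A \<and> (V, \<xi>) \<in> B}"


section \<open>The torus \<open>T^d = R^d / Z^d\<close>\<close>

definition int_vec :: "(real^'d) set" where
  "int_vec = {z. \<forall>i. z $ i \<in> \<int>}"

lemma int_vec_0: "0 \<in> int_vec"
  by (simp add: int_vec_def)

lemma int_vec_add: "x \<in> int_vec \<Longrightarrow> y \<in> int_vec \<Longrightarrow> x + y \<in> int_vec"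
  by (simp add: int_vec_def)

lemma int_vec_uminus: "x \<in> int_vec \<Longrightarrow> - x \<in> int_vec"
  by (simp add: int_vec_def)

lemma int_vec_matrix:
  fixes A :: "int^'d^'d"
  assumes "x \<in> int_vec"
  shows "map_matrix real_of_int A *v x \<in> int_vec"
  using assms by (auto simp: int_vec_def matrix_vector_mult_def intro!: Ints_sum Ints_mult)

quotient_type 'd torus = "real^'d" / "\<lambda>x y. x - y \<in> (int_vec :: (real^'d) set)"
  morphisms rep_torus torus_of
proof (rule equivpI)
  show "reflp (\<lambda>x y. x - y \<in> (int_vec :: (real^'d) set))"
    by (auto simp: reflp_def int_vec_0)
  show "symp (\<lambda>x y. x - y \<in> (int_vec :: (real^'d) set))"
    by (rule sympI) (metis int_vec_uminus minus_diff_eq)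
  show "transp (\<lambda>x y. x - y \<in> (int_vec :: (real^'d) set))"
    by (rule transpI) (metis int_vec_add diff_add_cancel add_diff_eq)
qed

instantiation torus :: (finite) ab_group_add
begin

lift_definition zero_torus :: "'a torus" is "0" .

lift_definition plus_torus :: "'a torus \<Rightarrow> 'a torus \<Rightarrow> 'a torus" is "\<lambda>x y. x + y"
  by (metis int_vec_add add_diff_add)

lift_definition uminus_torus :: "'a torus \<Rightarrow> 'a torus" is "\<lambda>x. - x"
  by (metis int_vec_uminus minus_diff_eq minus_diff_minus)

lift_definition minus_torus :: "'a torus \<Rightarrow> 'a torus \<Rightarrow> 'a torus" is "\<lambda>x y. x - y"
proof -
  fix x y x' y' :: "real^'a"
  assume "x - y \<in> int_vec" "x' - y' \<in> int_vec"
  then have "(x - y) + - (x' - y') \<in> int_vec"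
    by (intro int_vec_add int_vec_uminus)
  then show "x - x' - (y - y') \<in> int_vec"
    by (simp add: algebra_simps)
qed

instance
  by standard (transfer, simp add: int_vec_0 algebra_simps)+

end

text \<open>The action of an integer matrix on the torus. \<open>GL_d(Z)\<close> is the set of all
  \<open>A :: int^'d^'d\<close> with \<open>invertible A\<close>, the inverse being an integer matrix as well.\<close>

lift_definition torus_mat :: "int^'d^'d \<Rightarrow> 'd torus \<Rightarrow> 'd torus"
  is "\<lambda>A x. map_matrix real_of_int A *v x"
  by (metis int_vec_matrix matrix_vector_mult_diff_distrib)

instantiation torus :: (finite) topological_space
begin

definition open_torus :: "'a torus set \<Rightarrow> bool" where
  "open_torus S \<longleftrightarrow> open (torus_of -` S)"

instance
  by standard (auto simp: open_torus_def vimage_Union)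

end

lemma continuous_torus_of: "continuous_on UNIV torus_of"
  by (simp add: continuous_on_open_vimage open_torus_def)

text \<open>The charts are the local inverses of the covering map.\<close>

definition torus_atlas :: "('d torus, real^'d) chart set" where
  "torus_atlas = {(torus_of ` B, inv_into B torus_of) | B. open B \<and> inj_on torus_of B}"

definition torus_lebesgue :: "('d::finite) torus measure" where
  "torus_lebesgue = distr (restrict_space lborel {x. \<forall>i. 0 \<le> x $ i \<and> x $ i < 1}) borel torus_of"


section \<open>Affine tori bundles and compatible flows\<close>

text \<open>In the following \<open>A\<^sub>M\<close> and \<open>A\<^sub>\<Omega>\<close> are atlases of \<open>M\<close> and \<open>\<Omega>\<close>, and \<open>\<T>\<close> is a set of
  trivializing charts \<open>(U, \<psi>)\<close>, with \<open>\<psi>\<close> standing for \<open>\<psi>\<^sub>U\<close>. As members of an atlas on \<open>M\<close>,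
  the sets \<open>U\<close> are domains of charts of \<open>M\<close>. The matrix in a change of charts is constant
  on the whole of \<open>U \<inter> V\<close>.\<close>

definition trivialization ::
  "enat \<Rightarrow> ('m::topological_space, real^'n) chart set \<Rightarrow>
    ('w::topological_space, (real^'n) \<times> (real^'d)) chart set \<Rightarrow> ('w \<Rightarrow> 'm) \<Rightarrow>
    'm set \<times> ('w \<Rightarrow> 'm \<times> 'd torus) \<Rightarrow> bool" where
  "trivialization r A\<^sub>M A\<^sub>\<Omega> \<pi> = (\<lambda>(U, \<psi>).
      (\<exists>\<phi>. (U, \<phi>) \<in> Cr_charts r A\<^sub>M) \<and>
      Cr_diffeo r A\<^sub>\<Omega> (\<pi> -` U) (prod_atlas A\<^sub>M torus_atlas) (U \<times> UNIV) \<psi> \<and>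
      (\<forall>p\<in>\<pi> -` U. fst (\<psi> p) = \<pi> p))"

definition affine_change ::
  "enat \<Rightarrow> ('m::topological_space, real^'n) chart set \<Rightarrow> ('w \<Rightarrow> 'm) \<Rightarrow>
    'm set \<times> ('w \<Rightarrow> 'm \<times> 'd::finite torus) \<Rightarrow> 'm set \<times> ('w \<Rightarrow> 'm \<times> 'd torus) \<Rightarrow> bool" where
  "affine_change r A\<^sub>M \<pi> = (\<lambda>(U, \<psi>\<^sub>U) (V, \<psi>\<^sub>V).
      \<exists>(\<alpha> :: 'm \<Rightarrow> 'd torus) (A :: int^'d^'d).
        Cr_map r A\<^sub>M (U \<inter> V) torus_atlas \<alpha> \<and> invertible A \<and>
        (\<forall>x\<in>U \<inter> V. \<forall>y. \<psi>\<^sub>V (inv_into (\<pi> -` U) \<psi>\<^sub>U (x, y)) = (x, \<alpha> x + torus_mat A y)))"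

definition trivializing_atlas ::
  "enat \<Rightarrow> ('m::topological_space, real^'n) chart set \<Rightarrow>
    ('w::topological_space, (real^'n) \<times> (real^'d)) chart set \<Rightarrow> ('w \<Rightarrow> 'm) \<Rightarrow>
    ('m set \<times> ('w \<Rightarrow> 'm \<times> 'd torus)) set \<Rightarrow> bool" where
  "trivializing_atlas r A\<^sub>M A\<^sub>\<Omega> \<pi> \<T> \<longleftrightarrow>
      (\<Union>c\<in>\<T>. fst c) = UNIV \<and>
      (\<forall>c\<in>\<T>. trivialization r A\<^sub>M A\<^sub>\<Omega> \<pi> c) \<and>
      (\<forall>c\<in>\<T>. \<forall>c'\<in>\<T>. affine_change r A\<^sub>M \<pi> c c')"

definition affine_tori_bundle ::
  "enat \<Rightarrow> ('m::{t2_space, second_countable_topology}, real^'n) chart set \<Rightarrow>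
    ('w::{t2_space, second_countable_topology}, (real^'n) \<times> (real^'d)) chart set \<Rightarrow> ('w \<Rightarrow> 'm) \<Rightarrow>
    ('m set \<times> ('w \<Rightarrow> 'm \<times> 'd torus)) set \<Rightarrow> bool" where
  "affine_tori_bundle r A\<^sub>M A\<^sub>\<Omega> \<pi> \<T> \<longleftrightarrow>
      Cr_atlas r A\<^sub>M \<and> Cr_atlas r A\<^sub>\<Omega> \<and>
      Cr_map r A\<^sub>\<Omega> UNIV A\<^sub>M \<pi> \<and> surj \<pi> \<and>
      trivializing_atlas r A\<^sub>M A\<^sub>\<Omega> \<pi> \<T> \<and>
      (\<forall>\<T>'. \<T> \<subseteq> \<T>' \<and> trivializing_atlas r A\<^sub>M A\<^sub>\<Omega> \<pi> \<T>' \<longrightarrow> \<T>' = \<T>)"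

definition is_flow :: "(real \<Rightarrow> 'w \<Rightarrow> 'w) \<Rightarrow> bool" where
  "is_flow g \<longleftrightarrow> g 0 = id \<and> (\<forall>s t. g (s + t) = g s \<circ> g t)"

text \<open>\<open>generates r A\<^sub>M \<pi> g (U, \<psi>) v\<close>: in the trivializing chart \<open>\<psi>\<close>, \<open>g\<close> is the translation
  flow with velocity \<open>v\<close>. The invariance of \<open>\<pi> -` U\<close> is what makes
  \<open>\<psi> \<circ> g t \<circ> \<psi>\<inverse>\<close> well defined on \<open>U \<times> UNIV\<close>.\<close>

definition generates ::
  "enat \<Rightarrow> ('m::topological_space, real^'n) chart set \<Rightarrow> ('w \<Rightarrow> 'm) \<Rightarrow> (real \<Rightarrow> 'w \<Rightarrow> 'w) \<Rightarrow>
    'm set \<times> ('w \<Rightarrow> 'm \<times> 'd torus) \<Rightarrow> ('m \<Rightarrow> real^'d) \<Rightarrow> bool" where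
  "generates r A\<^sub>M \<pi> g = (\<lambda>(U, \<psi>) v.
      Cr_map r A\<^sub>M U euclidean_atlas v \<and>
      (\<forall>t. g t ` (\<pi> -` U) \<subseteq> \<pi> -` U \<and>
        (\<forall>x\<in>U. \<forall>y. \<psi> (g t (inv_into (\<pi> -` U) \<psi> (x, y))) = (x, y + torus_of (t *\<^sub>R v x)))))"

definition compatible_flows ::
  "enat \<Rightarrow> ('m::topological_space, real^'n) chart set \<Rightarrow> ('w \<Rightarrow> 'm) \<Rightarrow>
    ('m set \<times> ('w \<Rightarrow> 'm \<times> 'd::finite torus)) set \<Rightarrow> (real \<Rightarrow> 'w \<Rightarrow> 'w) set" where
  "compatible_flows r A\<^sub>M \<pi> \<T> = {g. is_flow g \<and> (\<forall>c\<in>\<T>. \<exists>v. generates r A\<^sub>M \<pi> g c v)}"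

text \<open>The generating function of a compatible flow in a trivializing chart \<open>(U, \<psi>)\<close>, made
  unique by fixing it to be \<open>undefined\<close> outside \<open>U\<close>.\<close>

definition gen_fun ::
  "enat \<Rightarrow> ('m::topological_space, real^'n) chart set \<Rightarrow> ('w \<Rightarrow> 'm) \<Rightarrow> (real \<Rightarrow> 'w \<Rightarrow> 'w) \<Rightarrow>
    'm set \<times> ('w \<Rightarrow> 'm \<times> 'd torus) \<Rightarrow> 'm \<Rightarrow> real^'d" where
  "gen_fun r A\<^sub>M \<pi> g c = (THE v. v \<in> extensional (fst c) \<and> generates r A\<^sub>M \<pi> g c v)"

lemma generates_unique:
  fixes v v' :: "'m::topological_space \<Rightarrow> real^'d"
  assumes "generates r A\<^sub>M \<pi> g (U, \<psi>) v" "generates r A\<^sub>M \<pi> g (U, \<psi>) v'" "x \<in> U"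
  shows "v x = v' x"
proof (rule ccontr)
  assume "v x \<noteq> v' x"
  then obtain i where i: "v x $ i - v' x $ i \<noteq> 0"
    by (auto simp: vec_eq_iff)
  define t where "t = 1 / (2 * (v x $ i - v' x $ i))"
  have "\<psi> (g t (inv_into (\<pi> -` U) \<psi> (x, 0))) = (x, 0 + torus_of (t *\<^sub>R v x))"
    "\<psi> (g t (inv_into (\<pi> -` U) \<psi> (x, 0))) = (x, 0 + torus_of (t *\<^sub>R v' x))"
    using assms by (simp_all add: generates_def)
  then have "torus_of (t *\<^sub>R v x) = torus_of (t *\<^sub>R v' x)"
    by simp
  then have "t *\<^sub>R v x - t *\<^sub>R v' x \<in> int_vec"
    by (simp add: torus.abs_eq_iff)
  then have "t * (v x $ i - v' x $ i) \<in> \<int>"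
    by (simp add: int_vec_def algebra_simps)
  also have "t * (v x $ i - v' x $ i) = 1 / 2"
    using i by (simp add: t_def field_simps)
  finally obtain k :: int where "1 / 2 = real_of_int k"
    by (auto elim: Ints_cases)
  then have "real_of_int (2 * k) = real_of_int 1"
    by simp
  then have "2 * k = 1"
    by (simp only: of_int_eq_iff)
  then show False
    by presburger
qed


section \<open>The topology on the space of compatible flows\<close>

text \<open>The data defining the topology: a locally finite open cover \<open>(U i)\<close> with trivializing
  charts \<open>\<psi> i\<close> of the bundle and charts \<open>\<phi> i\<close> of \<open>M\<close>, and a cover by compact sets
  \<open>K i \<subseteq> U i\<close>.\<close>

definition compact_chart_cover ::
  "enat \<Rightarrow> ('m::topological_space, real^'n) chart set \<Rightarrow>
    ('m set \<times> ('w \<Rightarrow> 'm \<times> 'd::finite torus)) set \<Rightarrow> 'i set \<Rightarrow> ('i \<Rightarrow> 'm set) \<Rightarrow>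
    ('i \<Rightarrow> 'w \<Rightarrow> 'm \<times> 'd torus) \<Rightarrow> ('i \<Rightarrow> 'm \<Rightarrow> real^'n) \<Rightarrow> ('i \<Rightarrow> 'm set) \<Rightarrow> bool" where
  "compact_chart_cover r A\<^sub>M \<T> I U \<psi> \<phi> K \<longleftrightarrow>
      (\<forall>i\<in>I. (U i, \<psi> i) \<in> \<T> \<and> (U i, \<phi> i) \<in> Cr_charts r A\<^sub>M \<and> compact (K i) \<and> K i \<subseteq> U i) \<and>
      (\<forall>x. \<exists>N. open N \<and> x \<in> N \<and> finite {i\<in>I. U i \<inter> N \<noteq> {}}) \<and>
      (\<Union>i\<in>I. U i) = UNIV \<and> (\<Union>i\<in>I. K i) = UNIV"

definition flows_converge ::
  "enat \<Rightarrow> ('m::topological_space, real^'n) chart set \<Rightarrow> ('w \<Rightarrow> 'm) \<Rightarrow> 'i set \<Rightarrow> ('i \<Rightarrow> 'm set) \<Rightarrow>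
    ('i \<Rightarrow> 'w \<Rightarrow> 'm \<times> 'd::finite torus) \<Rightarrow> ('i \<Rightarrow> 'm \<Rightarrow> real^'n) \<Rightarrow> ('i \<Rightarrow> 'm set) \<Rightarrow>
    (nat \<Rightarrow> real \<Rightarrow> 'w \<Rightarrow> 'w) \<Rightarrow> (real \<Rightarrow> 'w \<Rightarrow> 'w) \<Rightarrow> bool" where
  "flows_converge r A\<^sub>M \<pi> I U \<psi> \<phi> K G g \<longleftrightarrow>
      (\<forall>i\<in>I. \<forall>bs \<in> lists Basis. enat (length bs) \<le> r \<longrightarrow>
        uniform_limit (\<phi> i ` K i)
          (\<lambda>m. pderivs bs (gen_fun r A\<^sub>M \<pi> (G m) (U i, \<psi> i) \<circ> inv_into (U i) (\<phi> i)))
          (pderivs bs (gen_fun r A\<^sub>M \<pi> g (U i, \<psi> i) \<circ> inv_into (U i) (\<phi> i)))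
          sequentially)"

text \<open>The topology on the compatible flows determined by this notion of convergence: a set of
  flows is open iff it is sequentially open. On a second countable \<open>M\<close> only countably many of
  the \<open>U i\<close> are nonempty, so the convergence comes from a countable family of pseudometrics and
  this is the corresponding metrizable topology; see also \<open>limitin_flow_topology\<close> below.\<close>

definition flow_topology ::
  "enat \<Rightarrow> ('m::topological_space, real^'n) chart set \<Rightarrow> ('w \<Rightarrow> 'm) \<Rightarrow>
    ('m set \<times> ('w \<Rightarrow> 'm \<times> 'd::finite torus)) set \<Rightarrow> 'i set \<Rightarrow> ('i \<Rightarrow> 'm set) \<Rightarrow>
    ('i \<Rightarrow> 'w \<Rightarrow> 'm \<times> 'd torus) \<Rightarrow> ('i \<Rightarrow> 'm \<Rightarrow> real^'n) \<Rightarrow> ('i \<Rightarrow> 'm set) \<Rightarrow>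
    (real \<Rightarrow> 'w \<Rightarrow> 'w) topology" where
  "flow_topology r A\<^sub>M \<pi> \<T> I U \<psi> \<phi> K = topology (\<lambda>S. S \<subseteq> compatible_flows r A\<^sub>M \<pi> \<T> \<and>
      (\<forall>g\<in>S. \<forall>G. range G \<subseteq> compatible_flows r A\<^sub>M \<pi> \<T> \<and> flows_converge r A\<^sub>M \<pi> I U \<psi> \<phi> K G g \<longrightarrow>
        eventually (\<lambda>m. G m \<in> S) sequentially))"

lemma openin_flow_topology:
  "openin (flow_topology r A\<^sub>M \<pi> \<T> I U \<psi> \<phi> K) S \<longleftrightarrow> S \<subseteq> compatible_flows r A\<^sub>M \<pi> \<T> \<and>
      (\<forall>g\<in>S. \<forall>G. range G \<subseteq> compatible_flows r A\<^sub>M \<pi> \<T> \<and> flows_converge r A\<^sub>M \<pi> I U \<psi> \<phi> K G g \<longrightarrow>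
        eventually (\<lambda>m. G m \<in> S) sequentially)"
proof -
  have "istopology (\<lambda>S. S \<subseteq> compatible_flows r A\<^sub>M \<pi> \<T> \<and>
      (\<forall>g\<in>S. \<forall>G. range G \<subseteq> compatible_flows r A\<^sub>M \<pi> \<T> \<and> flows_converge r A\<^sub>M \<pi> I U \<psi> \<phi> K G g \<longrightarrow>
        eventually (\<lambda>m. G m \<in> S) sequentially))"
    unfolding istopology_def
  proof (intro conjI allI impI, goal_cases)
    case (1 S T)
    then show ?case by blast
  next
    case (2 S T)
    then show ?case by (auto intro: eventually_conj)
  next
    case (3 \<K>)
    then show ?case by blast
  next
    case (4 \<K>)
    show ?case
    proof (intro ballI allI impI)
      fix g G
      assume "g \<in> \<Union>\<K>" and
        G: "range G \<subseteq> compatible_flows r A\<^sub>M \<pi> \<T> \<and> flows_converge r A\<^sub>M \<pi> I U \<psi> \<phi> K G g"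
      then obtain S where "S \<in> \<K>" "g \<in> S" by blast
      with 4 G have "eventually (\<lambda>m. G m \<in> S) sequentially" by blast
      then show "eventually (\<lambda>m. G m \<in> \<Union>\<K>) sequentially"
        by (rule eventually_mono) (use \<open>S \<in> \<K>\<close> in blast)
    qed
  qed
  then show ?thesis
    by (simp add: flow_topology_def)
qed

lemma topspace_flow_topology:
  "topspace (flow_topology r A\<^sub>M \<pi> \<T> I U \<psi> \<phi> K) = compatible_flows r A\<^sub>M \<pi> \<T>"
proof
  show "topspace (flow_topology r A\<^sub>M \<pi> \<T> I U \<psi> \<phi> K) \<subseteq> compatible_flows r A\<^sub>M \<pi> \<T>"
    using openin_topspace[of "flow_topology r A\<^sub>M \<pi> \<T> I U \<psi> \<phi> K"]
    unfolding openin_flow_topology by blast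
  have "openin (flow_topology r A\<^sub>M \<pi> \<T> I U \<psi> \<phi> K) (compatible_flows r A\<^sub>M \<pi> \<T>)"
    unfolding openin_flow_topology by (auto intro!: always_eventually)
  then show "compatible_flows r A\<^sub>M \<pi> \<T> \<subseteq> topspace (flow_topology r A\<^sub>M \<pi> \<T> I U \<psi> \<phi> K)"
    by (rule openin_subset)
qed

text \<open>The convergent sequences of the topology are exactly the prescribed ones.\<close>

lemma limitin_flow_topology:
  fixes A\<^sub>M :: "('m::topological_space, real^'n) chart set"
  assumes G: "range G \<subseteq> compatible_flows r A\<^sub>M \<pi> \<T>" and g: "g \<in> compatible_flows r A\<^sub>M \<pi> \<T>"
  shows "limitin (flow_topology r A\<^sub>M \<pi> \<T> I U \<psi> \<phi> K) G g sequentially \<longleftrightarrow>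
      flows_converge r A\<^sub>M \<pi> I U \<psi> \<phi> K G g"
proof
  assume "flows_converge r A\<^sub>M \<pi> I U \<psi> \<phi> K G g"
  then show "limitin (flow_topology r A\<^sub>M \<pi> \<T> I U \<psi> \<phi> K) G g sequentially"
    using G g by (auto simp: limitin_def topspace_flow_topology openin_flow_topology)
next
  assume lim: "limitin (flow_topology r A\<^sub>M \<pi> \<T> I U \<psi> \<phi> K) G g sequentially"
  show "flows_converge r A\<^sub>M \<pi> I U \<psi> \<phi> K G g"
    unfolding flows_converge_def
  proof (intro ballI impI)
    fix i and bs :: "(real^'n) list"
    assume ib: "i \<in> I" "bs \<in> lists Basis" "enat (length bs) \<le> r"
    define D where "D h = pderivs bs (gen_fun r A\<^sub>M \<pi> h (U i, \<psi> i) \<circ> inv_into (U i) (\<phi> i))" for h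
    have "uniform_limit (\<phi> i ` K i) (\<lambda>m. D (G m)) (D g) sequentially"
    proof (rule uniform_limitI)
      fix e :: real assume "e > 0"
      define S where "S = {h \<in> compatible_flows r A\<^sub>M \<pi> \<T>.
        \<exists>\<delta><e. \<forall>x\<in>\<phi> i ` K i. dist (D h x) (D g x) \<le> \<delta>}"
      have "openin (flow_topology r A\<^sub>M \<pi> \<T> I U \<psi> \<phi> K) S"
        unfolding openin_flow_topology
      proof (intro conjI ballI allI impI)
        show "S \<subseteq> compatible_flows r A\<^sub>M \<pi> \<T>" by (auto simp: S_def)
      next
        fix h H
        assume "h \<in> S" and
          H: "range H \<subseteq> compatible_flows r A\<^sub>M \<pi> \<T> \<and> flows_converge r A\<^sub>M \<pi> I U \<psi> \<phi> K H h"
        then obtain \<delta> where \<delta>: "\<delta> < e" "\<forall>x\<in>\<phi> i ` K i. dist (D h x) (D g x) \<le> \<delta>"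
          by (auto simp: S_def)
        have "uniform_limit (\<phi> i ` K i) (\<lambda>m. D (H m)) (D h) sequentially"
          using H ib unfolding flows_converge_def D_def by blast
        then have "\<forall>\<^sub>F m in sequentially. \<forall>x\<in>\<phi> i ` K i. dist (D (H m) x) (D h x) < (e - \<delta>) / 2"
          by (rule uniform_limitD) (use \<delta> in simp)
        then show "\<forall>\<^sub>F m in sequentially. H m \<in> S"
        proof (rule eventually_mono)
          fix m
          assume m: "\<forall>x\<in>\<phi> i ` K i. dist (D (H m) x) (D h x) < (e - \<delta>) / 2"
          have "dist (D (H m) x) (D g x) \<le> (e + \<delta>) / 2" if "x \<in> \<phi> i ` K i" for x
          proof -
            have "dist (D (H m) x) (D g x) \<le> dist (D (H m) x) (D h x) + dist (D h x) (D g x)"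
              by (rule dist_triangle)
            also have "\<dots> \<le> (e - \<delta>) / 2 + \<delta>"
              using m \<delta> that by (intro add_mono) auto
            finally show ?thesis by (simp add: field_simps)
          qed
          moreover have "(e + \<delta>) / 2 < e" using \<delta> by simp
          ultimately show "H m \<in> S"
            using H unfolding S_def by blast
        qed
      qed
      moreover have "g \<in> S"
        using g \<open>e > 0\<close> by (auto simp: S_def intro!: exI[of _ 0])
      ultimately have "\<forall>\<^sub>F m in sequentially. G m \<in> S"
        using lim by (auto simp: limitin_def)
      then show "\<forall>\<^sub>F m in sequentially. \<forall>x\<in>\<phi> i ` K i. dist (D (G m) x) (D g x) < e"
      proof (rule eventually_mono)
        fix m assume "G m \<in> S"
        then obtain \<delta> where "\<delta> < e" "\<forall>x\<in>\<phi> i ` K i. dist (D (G m) x) (D g x) \<le> \<delta>"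
          by (auto simp: S_def)
        then show "\<forall>x\<in>\<phi> i ` K i. dist (D (G m) x) (D g x) < e"
          by (meson le_less_trans)
      qed
    qed
    then show "uniform_limit (\<phi> i ` K i)
          (\<lambda>m. pderivs bs (gen_fun r A\<^sub>M \<pi> (G m) (U i, \<psi> i) \<circ> inv_into (U i) (\<phi> i)))
          (pderivs bs (gen_fun r A\<^sub>M \<pi> g (U i, \<psi> i) \<circ> inv_into (U i) (\<phi> i))) sequentially"
      by (simp add: D_def)
  qed
qed

definition baire_generic :: "'a topology \<Rightarrow> 'a set \<Rightarrow> bool" where
  "baire_generic X S \<longleftrightarrow> S \<subseteq> topspace X \<and>
      (\<exists>\<O>. countable \<O> \<and> (\<forall>V\<in>\<O>. openin X V \<and> X closure_of V = topspace X) \<and>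
        topspace X \<inter> \<Inter>\<O> \<subseteq> S)"


section \<open>Compatible measures and Keplerian shear\<close>

text \<open>Measures on \<open>\<Omega>\<close> are Borel measures.\<close>

definition compatible_measure ::
  "('w::topological_space \<Rightarrow> 'm::topological_space) \<Rightarrow>
    ('m set \<times> ('w \<Rightarrow> 'm \<times> 'd::finite torus)) set \<Rightarrow> 'w measure \<Rightarrow> bool" where
  "compatible_measure \<pi> \<T> \<mu> \<longleftrightarrow> sets \<mu> = sets borel \<and> sigma_finite_measure \<mu> \<and>
      (\<forall>(U, \<psi>)\<in>\<T>.
        distr (restrict_space \<mu> (\<pi> -` U)) (restrict_space borel U \<Otimes>\<^sub>M borel) \<psi> =
        restrict_space (distr \<mu> borel \<pi>) U \<Otimes>\<^sub>M torus_lebesgue)"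

definition abs_cont_in_charts ::
  "enat \<Rightarrow> ('w::topological_space, 'e::euclidean_space) chart set \<Rightarrow> 'w measure \<Rightarrow> bool" where
  "abs_cont_in_charts r A \<mu> \<longleftrightarrow>
      (\<forall>(V, \<xi>)\<in>Cr_charts r A. absolutely_continuous lborel (distr (restrict_space \<mu> V) borel \<xi>))"

text \<open>Sets that are invariant up to null sets, for each time separately.\<close>

definition invariant_algebra :: "'w measure \<Rightarrow> (real \<Rightarrow> 'w \<Rightarrow> 'w) \<Rightarrow> 'w measure" where
  "invariant_algebra \<mu> g = sigma (space \<mu>)
      {B \<in> sets \<mu>. \<forall>t. sym_diff (g t -` B \<inter> space \<mu>) B \<in> null_sets \<mu>}"

definition square_integrable :: "'w measure \<Rightarrow> ('w \<Rightarrow> real) \<Rightarrow> bool" where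
  "square_integrable \<mu> f \<longleftrightarrow> f \<in> borel_measurable \<mu> \<and> integrable \<mu> (\<lambda>x. (f x)\<^sup>2)"

text \<open>Weak convergence in \<open>L\<^sup>2\<close> is tested against all square integrable \<open>h\<close>.\<close>

definition keplerian_shear :: "'w measure \<Rightarrow> (real \<Rightarrow> 'w \<Rightarrow> 'w) \<Rightarrow> bool" where
  "keplerian_shear \<mu> g \<longleftrightarrow>
      prob_space \<mu> \<and> is_flow g \<and> (\<forall>t. g t \<in> measurable \<mu> \<mu> \<and> distr \<mu> \<mu> (g t) = \<mu>) \<and>
      (\<forall>f h. square_integrable \<mu> f \<longrightarrow> square_integrable \<mu> h \<longrightarrow>
        ((\<lambda>t. \<integral>x. f (g t x) * h x \<partial>\<mu>) \<longlongrightarrow>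
          (\<integral>x. real_cond_exp \<mu> (invariant_algebra \<mu> g) f x * h x \<partial>\<mu>)) at_top)"

end

theory Submission
  imports Defs "HOL-Computational_Algebra.Polynomial"
begin

text \<open>Over a point \<open>x\<close> of the base a compatible flow is the linear flow \<open>y \<mapsto> y + t v(x)\<close> on a torus, and
shear comes from the dependence of the velocity \<open>v\<close> on \<open>x\<close>. For an integer vector \<open>\<xi> \<noteq> 0\<close> the
character \<open>cos (2\<pi> \<xi>\<bullet>y + c)\<close> is carried by the flow to \<open>cos (2\<pi> \<xi>\<bullet>y + c + 2\<pi> t \<xi>\<bullet>v(x))\<close>, so its
correlation with an observable \<open>h\<close> is an oscillatory integral with phase \<open>2\<pi> t \<xi>\<bullet>v\<close>. If the
distribution of \<open>\<xi>\<bullet>v\<close> is absolutely continuous on the line, the Riemann--Lebesgue lemma makes the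
correlation tend to \<open>0\<close>. For \<open>\<xi> = 0\<close> the observable is invariant. Functions of the base point times
characters span a dense subspace of \<open>L\<^sup>1\<close> (Stone--Weierstrass on the torus, embedded in \<open>\<complex>\<^sup>d\<close>), and
the observables with the right limit form a closed subspace; so all \<open>L\<^sup>1\<close> observables decorrelate
from bounded ones, and all \<open>L\<^sup>2\<close> observables from each other. This is
\<open>keplerian_shear_if_nonresonant\<close>. The conditional expectation never has to be computed: if
the correlations of \<open>f\<close> with all bounded functions vanish in the limit, then testing against the
indicators of invariant sets already shows that \<open>f\<close> has conditional expectation \<open>0\<close>.

In a chart, \<open>\<xi>\<bullet>v\<close> has an absolutely continuous distribution as soon as one partial derivative,
\<open>\<xi>\<bullet>\<partial>v\<close>, vanishes only on a null set: away from that set \<open>\<xi>\<bullet>v\<close> can be used as one of the coordinates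
of a local diffeomorphism (\<open>negligible_vimage_noncritical\<close>). An absolutely continuous measure
on the total space does not charge the fibres over a null set of the base
(\<open>negligible_chart_imp_null\<close>), so a condition on Lebesgue measure in the charts of the base
serves all measures \<open>\<mu>\<close> at once.

It remains to see that generically \<open>\<xi>\<bullet>\<partial>v\<close> vanishes almost nowhere on each compact piece of the
cover. Asking that the zero set of \<open>\<xi>\<bullet>\<partial>v\<close> in a small ball has measure less than \<open>1/k\<close> is an open
condition, because the zeros of a function uniformly close to \<open>\<xi>\<bullet>\<partial>v\<close> lie where \<open>\<xi>\<bullet>\<partial>v\<close> is small
(\<open>openin_noncritical\<close>). It is also dense: add \<open>s \<beta> \<xi>\<close> to \<open>v\<close>, with \<open>\<beta>\<close> a smooth bump
function supported in the ball and with \<open>\<partial>\<beta> \<noteq> 0\<close> almost everywhere there. The zero sets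
of \<open>\<xi>\<bullet>\<partial>v + s |\<xi>|\<^sup>2 \<partial>\<beta>\<close> inside \<open>{\<partial>\<beta> \<noteq> 0}\<close> are disjoint for distinct \<open>s\<close>, so all but countably many of
them are null, and \<open>s\<close> may be taken arbitrarily small (\<open>dense_noncritical\<close>). Countably many such
conditions, for all \<open>\<xi>\<close>, all \<open>k\<close> and countably many balls covering each chart, imply Keplerian shear.\<close>

section \<open>Functions approximable in mean\<close>

lemma tendsto_zero_approx:
  fixes f :: "'a \<Rightarrow> real"
  assumes "\<And>e. e > 0 \<Longrightarrow> \<exists>g. (g \<longlongrightarrow> 0) F \<and> (\<forall>x. \<bar>f x - g x\<bar> \<le> e)"
  shows "(f \<longlongrightarrow> 0) F"
proof (rule tendstoI)
  fix e :: real assume "e > 0"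
  then obtain g where g: "(g \<longlongrightarrow> 0) F" "\<And>x. \<bar>f x - g x\<bar> \<le> e / 2"
    using assms[of "e / 2"] by auto
  have "eventually (\<lambda>x. dist (g x) 0 < e / 2) F"
    using g(1) \<open>e > 0\<close> by (intro tendstoD) auto
  then show "eventually (\<lambda>x. dist (f x) 0 < e) F"
  proof eventually_elim
    case (elim x)
    then show ?case using g(2)[of x] by (simp add: dist_real_def abs_if split: if_splits)
  qed
qed

lemma tendsto_integral_abs_diff_zero:
  fixes s :: "nat \<Rightarrow> 'a \<Rightarrow> real"
  assumes "integrable M f" "\<And>i. s i \<in> borel_measurable M" "integrable M w"
    and "\<And>x. x \<in> space M \<Longrightarrow> (\<lambda>i. s i x) \<longlonglongrightarrow> f x"
    and "\<And>i x. x \<in> space M \<Longrightarrow> \<bar>s i x\<bar> \<le> w x"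
  shows "(\<lambda>i. \<integral>x. \<bar>f x - s i x\<bar> \<partial>M) \<longlonglongrightarrow> 0"
proof -
  have [measurable]: "f \<in> borel_measurable M" "\<And>i. s i \<in> borel_measurable M" using assms by auto
  have "(\<lambda>i. \<integral>x. \<bar>f x - s i x\<bar> \<partial>M) \<longlonglongrightarrow> (\<integral>x. 0 \<partial>M)"
  proof (rule integral_dominated_convergence[where w = "\<lambda>x. \<bar>f x\<bar> + w x"])
    show "AE x in M. (\<lambda>i. \<bar>f x - s i x\<bar>) \<longlonglongrightarrow> 0"
    proof (rule AE_I2)
      fix x assume "x \<in> space M"
      then have "(\<lambda>i. \<bar>f x - s i x\<bar>) \<longlonglongrightarrow> \<bar>f x - f x\<bar>"
        using assms(4) by (intro tendsto_intros) auto
      then show "(\<lambda>i. \<bar>f x - s i x\<bar>) \<longlonglongrightarrow> 0" by simp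
    qed
    show "AE x in M. norm \<bar>f x - s i x\<bar> \<le> \<bar>f x\<bar> + w x" for i
    proof (rule AE_I2)
      fix x assume "x \<in> space M"
      then show "norm \<bar>f x - s i x\<bar> \<le> \<bar>f x\<bar> + w x"
        using assms(5)[of x i] by simp
    qed
  qed (use assms in auto)
  then show ?thesis by simp
qed

text \<open>The functional form of the \<open>\<pi>\<close>-\<open>\<lambda>\<close> theorem: the indicators in a linear class closed in \<open>L\<^sup>1\<close> form a
Dynkin system, and step functions are dense. It serves both for the densities that obey
the Riemann--Lebesgue lemma and for the observables that decorrelate over a bundle chart.\<close>

lemma (in finite_measure) integrable_closed_class:
  fixes P :: "('a \<Rightarrow> real) \<Rightarrow> bool"
  assumes f: "integrable M f"
    and sets: "sets M = sigma_sets (space M) G" and Int: "Int_stable G" and GP: "G \<subseteq> Pow (space M)"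
    and space: "P (indicator (space M))"
    and basic: "\<And>A. A \<in> G \<Longrightarrow> P (indicator A)"
    and scale: "\<And>f c. integrable M f \<Longrightarrow> P f \<Longrightarrow> P (\<lambda>x. c * f x)"
    and add: "\<And>f g. integrable M f \<Longrightarrow> integrable M g \<Longrightarrow> P f \<Longrightarrow> P g \<Longrightarrow> P (\<lambda>x. f x + g x)"
    and closed: "\<And>f. integrable M f \<Longrightarrow>
      (\<And>e. e > 0 \<Longrightarrow> \<exists>f'. P f' \<and> integrable M f' \<and> (\<integral>x. \<bar>f x - f' x\<bar> \<partial>M) \<le> e) \<Longrightarrow> P f"
  shows "P f"
proof -
  have limit: "P f" if "integrable M f" "\<And>i. integrable M (s i)" "\<And>i. P (s i)" "integrable M w"
    "\<And>x. x \<in> space M \<Longrightarrow> (\<lambda>i. s i x) \<longlonglongrightarrow> f x"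
    "\<And>i x. x \<in> space M \<Longrightarrow> \<bar>s i x\<bar> \<le> w x" for f w and s :: "nat \<Rightarrow> 'a \<Rightarrow> real"
  proof (rule closed[OF that(1)])
    fix e :: real assume "e > 0"
    have "(\<lambda>i. \<integral>x. \<bar>f x - s i x\<bar> \<partial>M) \<longlonglongrightarrow> 0"
      by (rule tendsto_integral_abs_diff_zero[OF that(1) _ that(4)]) (use that in auto)
    then have "eventually (\<lambda>i. (\<integral>x. \<bar>f x - s i x\<bar> \<partial>M) < e) sequentially"
      using \<open>e > 0\<close> by (rule order_tendstoD)
    then obtain i where "(\<integral>x. \<bar>f x - s i x\<bar> \<partial>M) < e"
      by (auto simp: eventually_sequentially)
    then show "\<exists>f'. P f' \<and> integrable M f' \<and> (\<integral>x. \<bar>f x - f' x\<bar> \<partial>M) \<le> e"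
      using that by (intro exI[of _ "s i"]) auto
  qed
  have int: "integrable M (indicator A :: 'a \<Rightarrow> real)" if "A \<in> sets M" for A
    using that by (simp add: integrable_indicator_iff emeasure_eq_measure)
  have ind: "P (indicator A)" if "A \<in> sets M" for A
  proof -
    from that have "A \<in> sigma_sets (space M) G" by (simp add: sets)
    then show ?thesis
    proof (induction rule: sigma_sets_induct_disjoint[OF Int GP, consumes 1, case_names basic empty compl union])
      case (basic A)
      then show ?case by (rule assms(6))
    next
      case empty
      have "P (\<lambda>x. 0 * indicator (space M) x)"
        by (intro scale int space) auto
      then show ?case by (simp add: indicator_def[abs_def])
    next
      case (compl A)
      then have A: "A \<in> sets M" by (simp add: sets)
      have "P (\<lambda>x. indicator (space M) x + (-1) * indicator A x)"
        using A compl by (intro add scale int integrable_mult_right space) auto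
      also have "(\<lambda>x. indicator (space M) x + (-1) * indicator A x :: real) = indicator (space M - A)"
        using sets.sets_into_space[OF A] by (auto simp: indicator_def fun_eq_iff)
      finally show ?case .
    next
      case (union A)
      then have A: "range A \<subseteq> sets M" by (simp add: sets)
      define s where "s = (\<lambda>n x. \<Sum>i<n. indicator (A i) x :: real)"
      have s: "s n x = indicator (\<Union>i<n. A i) x" for n x
        unfolding s_def using union(1)
        by (subst indicator_UN_disjoint) (auto simp: disjoint_family_on_def)
      have ints: "integrable M (s n)" for n
        unfolding s_def using A by (intro Bochner_Integration.integrable_sum int) auto
      have Ps: "P (s n)" for n
      proof (induction n)
        case 0
        have "P (\<lambda>x. 0 * indicator (space M) x)"
          by (intro scale int space) auto
        then show ?case by (simp add: s_def)
      next
        case (Suc n)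
        have "P (\<lambda>x. s n x + indicator (A n) x)"
          using union A Suc by (intro add ints int) auto
        then show ?case by (simp add: s_def)
      qed
      show ?case
      proof (rule limit[where s = s and w = "indicator (space M)"])
        show "integrable M (indicator (\<Union>i. A i) :: 'a \<Rightarrow> real)" using A by (intro int) auto
        show "(\<lambda>i. s i x) \<longlonglongrightarrow> indicator (\<Union>i. A i) x" for x
          unfolding s by (rule LIMSEQ_indicator_UN)
        show "\<bar>s i x\<bar> \<le> indicator (space M) x" if "x \<in> space M" for i x
          using that by (simp add: s)
      qed (use ints Ps in \<open>auto intro: int\<close>)
    qed
  qed
  from f show ?thesis
  proof (induction rule: integrable_induct)
    case (base A c)
    have "P (\<lambda>x. c * indicator A x)" by (intro scale int ind base)
    then show ?case by (simp add: mult.commute)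
  next
    case (add f g)
    then show ?case by (intro assms(8))
  next
    case (lim f s)
    show ?case
      by (rule limit[where s = s and w = "\<lambda>x. 2 * \<bar>f x\<bar>"]) (use lim in auto)
  qed
qed

section \<open>The Riemann--Lebesgue lemma\<close>

lemma tendsto_integral_cos_Icc:
  "((\<lambda>t. \<integral>x. indicator {a..b} x * cos (t * x + c) \<partial>lborel) \<longlongrightarrow> 0) (at_top :: real filter)"
proof (cases "a \<le> b")
  case True
  have eq: "(\<integral>x. indicator {a..b} x * cos (t * x + c) \<partial>lborel) = (sin (t * b + c) - sin (t * a + c)) / t"
    if "t > 0" for t
  proof -
    have "(\<integral>x. cos (t * x + c) * indicator {a..b} x \<partial>lborel) = sin (t * b + c) / t - sin (t * a + c) / t"
      using that True by (intro integral_FTC_Icc_real) (auto intro!: derivative_eq_intros continuous_intros)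
    then show ?thesis by (simp add: diff_divide_distrib mult.commute)
  qed
  have "((\<lambda>t. (sin (t * b + c) - sin (t * a + c)) / t) \<longlongrightarrow> 0) at_top"
  proof (rule Lim_null_comparison)
    show "eventually (\<lambda>t. norm ((sin (t * b + c) - sin (t * a + c)) / t) \<le> 2 / t) at_top"
      using eventually_gt_at_top[of 0]
    proof eventually_elim
      case (elim t)
      have "\<bar>sin (t * b + c) - sin (t * a + c)\<bar> \<le> 2"
        using abs_sin_le_one[of "t * b + c"] abs_sin_le_one[of "t * a + c"] by linarith
      then show ?case using elim by (simp add: divide_right_mono)
    qed
    show "((\<lambda>t::real. 2 / t) \<longlongrightarrow> 0) at_top"
      by (rule tendsto_divide_0[OF tendsto_const filterlim_at_top_imp_at_infinity[OF filterlim_ident]])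
  qed
  then show ?thesis
    by (rule Lim_transform_eventually)
      (use eventually_gt_at_top[of 0] in eventually_elim, simp add: eq)
qed simp

lemma integrable_mult_bounded:
  fixes f h :: "'a \<Rightarrow> real"
  assumes "integrable M f" "h \<in> borel_measurable M" "\<And>x. \<bar>h x\<bar> \<le> C"
  shows "integrable M (\<lambda>x. f x * h x)"
proof (rule Bochner_Integration.integrable_bound[of M "\<lambda>x. C * f x"])
  show "AE x in M. norm (f x * h x) \<le> norm (C * f x)"
  proof (rule AE_I2)
    fix x
    have "\<bar>h x\<bar> \<le> \<bar>C\<bar>" using assms(3)[of x] by linarith
    then show "norm (f x * h x) \<le> norm (C * f x)"
      by (simp add: abs_mult mult.commute[of _ "\<bar>f x\<bar>"] mult_left_mono)
  qed
qed (use assms in auto)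

lemma abs_integral_diff_le:
  fixes f f' u :: "'a \<Rightarrow> real"
  assumes "integrable M f" "integrable M f'" "u \<in> borel_measurable M" "\<And>x. \<bar>u x\<bar> \<le> C"
  shows "\<bar>(\<integral>x. f x * u x \<partial>M) - (\<integral>x. f' x * u x \<partial>M)\<bar> \<le> C * (\<integral>x. \<bar>f x - f' x\<bar> \<partial>M)"
proof -
  have bdd: "integrable M (\<lambda>x. g x * u x)" if "integrable M g" for g
    by (rule integrable_mult_bounded[OF that assms(3,4)])
  have "(\<integral>x. f x * u x \<partial>M) - (\<integral>x. f' x * u x \<partial>M) = (\<integral>x. (f x - f' x) * u x \<partial>M)"
    using bdd assms by (simp add: left_diff_distrib)
  also have "\<bar>\<dots>\<bar> \<le> (\<integral>x. \<bar>(f x - f' x) * u x\<bar> \<partial>M)"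
    by (rule integral_abs_bound)
  also have "\<dots> \<le> (\<integral>x. C * \<bar>f x - f' x\<bar> \<partial>M)"
  proof (rule integral_mono)
    show "integrable M (\<lambda>x. \<bar>(f x - f' x) * u x\<bar>)"
      by (intro integrable_abs bdd Bochner_Integration.integrable_diff assms)
    show "\<bar>(f x - f' x) * u x\<bar> \<le> C * \<bar>f x - f' x\<bar>" for x
      using assms(4)[of x] by (simp add: abs_mult mult.commute mult_right_mono)
  qed (use assms in auto)
  finally show ?thesis by simp
qed

text \<open>For the indicator of an interval the integral is explicit and of order \<open>1/t\<close>. Both truncation to a
bounded interval and the passage from intervals to all integrable functions are \<open>L\<^sup>1\<close>
approximations, uniform in \<open>t\<close>.\<close>

theorem Riemann_Lebesgue_lborel:
  fixes \<rho> :: "real \<Rightarrow> real"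
  assumes "integrable lborel \<rho>"
  shows "((\<lambda>t. \<integral>x. \<rho> x * cos (t * x + c) \<partial>lborel) \<longlongrightarrow> 0) at_top"
proof -
  have bounded: "((\<lambda>t. \<integral>x. (\<rho> x * indicator {-m..m} x) * cos (t * x + c) \<partial>lborel) \<longlongrightarrow> 0) at_top"
    for m :: real
  proof -
    define N where "N = density lborel (\<lambda>x. ennreal (indicator {-m..m} x))"
    interpret N: finite_measure N
      by (rule finite_measureI) (simp add: N_def emeasure_density ennreal_indicator emeasure_lborel_Icc_eq)
    have N: "integral\<^sup>L N h = (\<integral>x. h x * indicator {-m..m} x \<partial>lborel)" if "h \<in> borel_measurable borel"
      for h :: "real \<Rightarrow> real"
      using that unfolding N_def by (subst integral_density) (auto simp: mult.commute)
    have [measurable_cong]: "sets N = sets borel" by (simp add: N_def)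
    have "integrable N \<rho>"
      unfolding N_def using assms
      by (subst integrable_density) (auto simp: mult.commute[of "indicator _ _"] intro!: integrable_real_mult_indicator)
    then have "((\<lambda>t. \<integral>x. \<rho> x * cos (t * x + c) \<partial>N) \<longlongrightarrow> 0) at_top"
    proof (induction rule: N.integrable_closed_class[where G = "range (\<lambda>a. {..a})",
        consumes 1, case_names sets Int GP space basic scale add closed])
      case sets
      have "sets borel = sigma_sets UNIV (range (\<lambda>a::real. {..a}))"
        by (subst borel_eq_atMost) simp
      then show ?case by (simp add: N_def)
    next
      case Int
      show ?case by (auto simp: Int_stable_def)
    next
      case GP
      show ?case by (simp add: N_def)
    next
      case space
      have "(\<integral>x. indicator (space N) x * cos (t * x + c) \<partial>N)
          = (\<integral>x. indicator {-m..m} x * cos (t * x + c) \<partial>lborel)" for t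
        by (subst N) (auto simp: N_def mult.commute)
      then show ?case using tendsto_integral_cos_Icc by simp
    next
      case (basic A)
      then obtain a where A: "A = {..a}" by auto
      have "(\<integral>x. indicator A x * cos (t * x + c) \<partial>N)
          = (\<integral>x. indicator {-m..min m a} x * cos (t * x + c) \<partial>lborel)" for t
        unfolding A by (subst N) (auto simp: indicator_def intro!: Bochner_Integration.integral_cong)
      then show ?case using tendsto_integral_cos_Icc by simp
    next
      case (scale f k)
      then show ?case using tendsto_mult_right_zero[of _ at_top k] by (simp add: mult.assoc)
    next
      case (add f g)
      have "integrable N (\<lambda>x. h x * cos (t * x + c))" if "integrable N h" for h t
        using that by (intro Bochner_Integration.integrable_bound[OF that]) (auto simp: abs_mult mult_left_le)
      then show ?case using tendsto_add[OF add(3,4)] add(1,2) by (simp add: distrib_right)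
    next
      case (closed f)
      show ?case
      proof (rule tendsto_zero_approx)
        fix e :: real assume "e > 0"
        with closed(2) obtain f' where f': "((\<lambda>t. \<integral>x. f' x * cos (t * x + c) \<partial>N) \<longlongrightarrow> 0) at_top"
          "integrable N f'" "(\<integral>x. \<bar>f x - f' x\<bar> \<partial>N) \<le> e" by blast
        have "\<bar>(\<integral>x. f x * cos (t * x + c) \<partial>N) - (\<integral>x. f' x * cos (t * x + c) \<partial>N)\<bar> \<le> 1 * e" for t
          by (rule order_trans[OF abs_integral_diff_le[where C = 1]]) (use closed f' in auto)
        then show "\<exists>g. (g \<longlongrightarrow> 0) at_top \<and> (\<forall>t. \<bar>(\<integral>x. f x * cos (t * x + c) \<partial>N) - g t\<bar> \<le> e)"
          using f'(1) by auto
      qed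
    qed
    moreover have "(\<integral>x. \<rho> x * cos (t * x + c) \<partial>N)
        = (\<integral>x. (\<rho> x * indicator {-m..m} x) * cos (t * x + c) \<partial>lborel)" for t
      using assms by (subst N) (auto simp: mult_ac)
    ultimately show ?thesis by simp
  qed
  show ?thesis
  proof (rule tendsto_zero_approx)
    fix e :: real assume "e > 0"
    have lim: "(\<lambda>i. \<integral>x. \<bar>\<rho> x - \<rho> x * indicator {- real i..real i} x\<bar> \<partial>lborel) \<longlonglongrightarrow> 0"
    proof (rule tendsto_integral_abs_diff_zero[where w = "\<lambda>x. \<bar>\<rho> x\<bar>"])
      fix x
      have "eventually (\<lambda>i. \<rho> x * indicator {- real i..real i} x = \<rho> x) sequentially"
        using eventually_ge_at_top[of "nat \<lceil>\<bar>x\<bar>\<rceil>"]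
      proof eventually_elim
        case (elim i)
        then have "\<bar>x\<bar> \<le> real i" by linarith
        then show ?case by (auto simp: indicator_def)
      qed
      then show "(\<lambda>i. \<rho> x * indicator {- real i..real i} x) \<longlonglongrightarrow> \<rho> x"
        by (rule tendsto_eventually)
    qed (use assms in \<open>auto simp: indicator_def\<close>)
    then have "eventually (\<lambda>i. (\<integral>x. \<bar>\<rho> x - \<rho> x * indicator {- real i..real i} x\<bar> \<partial>lborel) < e) sequentially"
      using \<open>e > 0\<close> by (rule order_tendstoD)
    then obtain i where i: "(\<integral>x. \<bar>\<rho> x - \<rho> x * indicator {- real i..real i} x\<bar> \<partial>lborel) < e"
      by (auto simp: eventually_sequentially)
    have "integrable lborel (\<lambda>x. \<rho> x * indicator {- real i..real i} x)"
      using assms by (intro integrable_real_mult_indicator) auto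
    then have "\<bar>(\<integral>x. \<rho> x * cos (t * x + c) \<partial>lborel)
        - (\<integral>x. \<rho> x * indicator {- real i..real i} x * cos (t * x + c) \<partial>lborel)\<bar> \<le> 1 * e" for t
      by (intro order_trans[OF abs_integral_diff_le[where C = 1]]) (use assms i in auto)
    then show "\<exists>g. (g \<longlongrightarrow> 0) at_top \<and> (\<forall>t. \<bar>(\<integral>x. \<rho> x * cos (t * x + c) \<partial>lborel) - g t\<bar> \<le> e)"
      using bounded[of "real i"] by auto
  qed
qed

text \<open>The hypothesis says that the image under \<open>\<theta>\<close> of the measure with density \<open>\<bar>b\<bar>\<close> is absolutely
continuous. For the positive and the negative part of \<open>b\<close>, the Radon--Nikodym density of the image
reduces the claim to the real line.\<close>

theorem Riemann_Lebesgue_absolutely_continuous: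
  fixes b \<theta> :: "'a \<Rightarrow> real"
  assumes b: "integrable M b" and \<theta>[measurable]: "\<theta> \<in> borel_measurable M"
    and ac: "\<And>N. N \<in> null_sets lborel \<Longrightarrow> AE x in M. \<theta> x \<in> N \<longrightarrow> b x = 0"
  shows "((\<lambda>t. \<integral>x. b x * cos (t * \<theta> x + c) \<partial>M) \<longlongrightarrow> 0) at_top"
proof -
  have nonneg: "((\<lambda>t. \<integral>x. b x * cos (t * \<theta> x + c) \<partial>M) \<longlongrightarrow> 0) at_top"
    if b: "integrable M b" and nn: "\<And>x. 0 \<le> b x"
      and ac: "\<And>N. N \<in> null_sets lborel \<Longrightarrow> AE x in M. \<theta> x \<in> N \<longrightarrow> b x = 0" for b
  proof -
    have [measurable]: "b \<in> borel_measurable M" using b by auto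
    define N where "N = distr (density M (\<lambda>x. ennreal (b x))) borel \<theta>"
    have "absolutely_continuous lborel N"
      unfolding absolutely_continuous_def
    proof
      fix A :: "real set" assume A: "A \<in> null_sets lborel"
      then have [measurable]: "A \<in> sets borel" by auto
      have "emeasure N A = (\<integral>\<^sup>+x. ennreal (b x) * indicator (\<theta> -` A \<inter> space M) x \<partial>M)"
        unfolding N_def by (simp add: emeasure_distr emeasure_density)
      also have "\<dots> = (\<integral>\<^sup>+x. 0 \<partial>M)"
        using ac[OF A] by (intro nn_integral_cong_AE) (auto simp: indicator_def)
      finally show "A \<in> null_sets N" by (auto simp: null_sets_def N_def)
    qed
    then obtain q where q[measurable]: "q \<in> borel_measurable lborel" and qN: "density lborel q = N"
      using sigma_finite_lborel sigma_finite_measure.Radon_Nikodym[of lborel N] by (auto simp: N_def)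
    have fin: "(\<integral>\<^sup>+x. q x \<partial>lborel) < \<infinity>"
    proof -
      have "(\<integral>\<^sup>+x. q x \<partial>lborel) = emeasure N UNIV"
        unfolding qN[symmetric] by (simp add: emeasure_density)
      also have "\<dots> = (\<integral>\<^sup>+x. ennreal (b x) \<partial>M)"
        unfolding N_def by (auto simp: emeasure_distr emeasure_density intro!: nn_integral_cong simp: indicator_def)
      also have "\<dots> < \<infinity>" using b nn by (simp add: nn_integral_eq_integral)
      finally show ?thesis .
    qed
    define \<rho> where "\<rho> x = enn2real (q x)" for x
    have [measurable]: "\<rho> \<in> borel_measurable borel" unfolding \<rho>_def by measurable
    have "AE x in lborel. q x \<noteq> \<infinity>" using fin by (intro nn_integral_PInf_AE) auto
    then have ae: "AE x in lborel. q x = ennreal (\<rho> x)"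
      by eventually_elim (simp add: \<rho>_def less_top)
    have N: "N = density lborel (\<lambda>x. ennreal (\<rho> x))"
      unfolding qN[symmetric] using ae by (intro density_cong) auto
    have "integrable lborel \<rho>"
    proof (rule integrableI_nonneg)
      show "(\<integral>\<^sup>+x. ennreal (\<rho> x) \<partial>lborel) < \<infinity>"
        using fin nn_integral_cong_AE[OF ae] by simp
    qed (auto simp: \<rho>_def)
    from Riemann_Lebesgue_lborel[OF this, of c]
    have "((\<lambda>t. \<integral>x. \<rho> x * cos (t * x + c) \<partial>lborel) \<longlongrightarrow> 0) at_top" .
    moreover have "(\<integral>x. \<rho> x * cos (t * x + c) \<partial>lborel) = (\<integral>x. b x * cos (t * \<theta> x + c) \<partial>M)" for t
    proof -
      have "(\<integral>x. \<rho> x * cos (t * x + c) \<partial>lborel) = (\<integral>x. cos (t * x + c) \<partial>N)"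
        unfolding N by (subst integral_density) (auto simp: \<rho>_def)
      also have "\<dots> = (\<integral>x. b x * cos (t * \<theta> x + c) \<partial>M)"
        unfolding N_def using nn by (simp add: integral_distr integral_density)
      finally show ?thesis .
    qed
    ultimately show ?thesis by simp
  qed
  have "((\<lambda>t. (\<integral>x. max 0 (b x) * cos (t * \<theta> x + c) \<partial>M) - (\<integral>x. max 0 (- b x) * cos (t * \<theta> x + c) \<partial>M))
      \<longlongrightarrow> 0 - 0) at_top"
  proof (intro tendsto_diff nonneg)
    fix N :: "real set" assume "N \<in> null_sets lborel"
    note ac[OF this]
    then show "AE x in M. \<theta> x \<in> N \<longrightarrow> max 0 (b x) = 0" "AE x in M. \<theta> x \<in> N \<longrightarrow> max 0 (- b x) = 0"
      by (eventually_elim, simp)+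
  qed (use b in auto)
  moreover have "(\<integral>x. max 0 (b x) * cos (t * \<theta> x + c) \<partial>M) - (\<integral>x. max 0 (- b x) * cos (t * \<theta> x + c) \<partial>M)
      = (\<integral>x. b x * cos (t * \<theta> x + c) \<partial>M)" for t
  proof -
    have i: "integrable M (\<lambda>x. f x * cos (t * \<theta> x + c))" if "integrable M f" for f
      using that by (intro Bochner_Integration.integrable_bound[OF that]) (auto simp: abs_mult mult_left_le)
    have "(\<integral>x. max 0 (b x) * cos (t * \<theta> x + c) \<partial>M) - (\<integral>x. max 0 (- b x) * cos (t * \<theta> x + c) \<partial>M)
      = (\<integral>x. max 0 (b x) * cos (t * \<theta> x + c) - max 0 (- b x) * cos (t * \<theta> x + c) \<partial>M)"
      using b by (intro Bochner_Integration.integral_diff[symmetric] i) auto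
    also have "\<dots> = (\<integral>x. b x * cos (t * \<theta> x + c) \<partial>M)"
      by (intro Bochner_Integration.integral_cong) (auto simp: max_def)
    finally show ?thesis .
  qed
  ultimately show ?thesis by simp
qed

section \<open>Negligible sets and functions without critical points\<close>

lemma negligible_Borel_cover:
  fixes S :: "'a::euclidean_space set"
  assumes "negligible S"
  obtains N where "N \<in> null_sets lborel" "S \<subseteq> N"
proof -
  have "S \<in> null_sets lebesgue" using assms by (simp add: negligible_iff_null_sets)
  then show ?thesis using that by (auto simp: null_sets_completion_iff2)
qed

lemma null_sets_lborel_imp_negligible:
  "N \<in> null_sets lborel \<Longrightarrow> negligible N"
  by (simp add: negligible_iff_null_sets null_sets_completionI)

lemma negligible_Times_UNIV:
  fixes Z :: "'a::euclidean_space set"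
  assumes "negligible Z"
  shows "negligible (Z \<times> (UNIV :: 'b::euclidean_space set))"
proof -
  obtain N where N: "N \<in> null_sets lborel" "Z \<subseteq> N"
    using negligible_Borel_cover[OF assms] .
  have "emeasure (lborel \<Otimes>\<^sub>M lborel) (N \<times> (UNIV :: 'b set)) = emeasure lborel N * emeasure lborel (UNIV :: 'b set)"
    using N by (intro lborel.emeasure_pair_measure_Times) auto
  then have "emeasure lborel (N \<times> (UNIV :: 'b set)) = 0"
    using N by (simp add: lborel_prod null_setsD1)
  moreover have "N \<times> (UNIV :: 'b set) \<in> sets lborel"
    using N by (auto simp: borel_prod[symmetric] intro!: pair_measureI)
  ultimately have "N \<times> (UNIV :: 'b set) \<in> null_sets lborel" by (simp add: null_sets_def)
  then have "negligible (N \<times> (UNIV :: 'b set))" by (rule null_sets_lborel_imp_negligible)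
  then show ?thesis by (rule negligible_subset) (use N in auto)
qed

lemma negligible_vimage_inner_Basis:
  fixes b :: "'a::euclidean_space"
  assumes b: "b \<in> Basis" and N: "N \<in> null_sets lborel"
  shows "negligible {x. x \<bullet> b \<in> N}"
proof -
  have [measurable]: "N \<in> sets borel" using N by auto
  interpret product_sigma_finite "\<lambda>_::'a. lborel :: real measure" ..
  let ?L = "\<Pi>\<^sub>M b\<in>(Basis :: 'a set). (lborel :: real measure)"
  have "emeasure lborel {x::'a. x \<bullet> b \<in> N} = emeasure ?L
      ((\<lambda>f. \<Sum>b\<in>Basis. f b *\<^sub>R b) -` {x::'a. x \<bullet> b \<in> N} \<inter> space ?L)"
    unfolding lborel_eq[where 'a = 'a] by (subst emeasure_distr) auto
  also have "(\<lambda>f. \<Sum>b\<in>Basis. f b *\<^sub>R b) -` {x::'a. x \<bullet> b \<in> N} \<inter> space ?L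
      = Pi\<^sub>E Basis (\<lambda>c. if c = b then N else UNIV)"
    using b by (auto simp: space_PiM inner_sum_left inner_Basis PiE_iff if_distrib cong: if_cong)
  also have "emeasure ?L \<dots> = (\<Prod>c\<in>Basis. emeasure lborel (if c = b then N else UNIV))"
    by (rule emeasure_PiM) auto
  also have "\<dots> = 0"
    using b N by (intro prod_zero) (auto simp: null_setsD1)
  finally have "{x. x \<bullet> b \<in> N} \<in> null_sets lborel" by (auto simp: null_sets_def)
  then show ?thesis by (rule null_sets_lborel_imp_negligible)
qed

text \<open>Near a point with \<open>\<partial>\<^sub>b f \<noteq> 0\<close>, replacing the coordinate \<open>x \<bullet> b\<close> by \<open>f x\<close> is a local diffeomorphism:
Rolle's theorem on lines parallel to \<open>b\<close> makes it injective. Its inverse maps points whose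
\<open>b\<close>-coordinate lies in \<open>N\<close>, which form a null set, onto the preimage of \<open>N\<close> under \<open>f\<close>.\<close>

lemma negligible_vimage_noncritical:
  fixes f :: "'a::euclidean_space \<Rightarrow> real"
  assumes W: "open W" and b: "b \<in> Basis"
    and f: "\<And>x. x \<in> W \<Longrightarrow> (f has_derivative f' x) (at x)"
    and cont: "continuous_on W (\<lambda>x. f' x b)"
    and L: "L \<subseteq> W" and crit: "negligible {x\<in>L. f' x b = 0}"
    and N: "N \<in> null_sets lborel"
  shows "negligible {x\<in>L. f x \<in> N}"
proof -
  define F where "F x = x + (f x - x \<bullet> b) *\<^sub>R b" for x
  have Fb: "F x \<bullet> b = f x" for x
    using b by (simp add: F_def inner_add_left)
  have "negligible {x\<in>W. f' x b \<noteq> 0 \<and> f x \<in> N}" (is "negligible ?S")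
  proof (subst locally_negligible_alt, rule ballI)
    fix p assume p: "p \<in> ?S"
    have "\<exists>B. open B \<and> p \<in> B \<and> convex B \<and> B \<subseteq> W \<and> (\<forall>x\<in>B. f' x b \<noteq> 0)"
    proof -
      have "open {x\<in>W. f' x b \<noteq> 0}"
        using continuous_open_preimage[OF cont W open_delete[OF open_UNIV, of 0]]
        by (simp add: vimage_def Int_def)
      moreover have "p \<in> {x\<in>W. f' x b \<noteq> 0}" using p by simp
      ultimately obtain e where "e > 0" "ball p e \<subseteq> {x\<in>W. f' x b \<noteq> 0}"
        by (meson openE)
      then show ?thesis by (intro exI[of _ "ball p e"]) auto
    qed
    then obtain B where B: "open B" "p \<in> B" "convex B" "B \<subseteq> W" "\<And>x. x \<in> B \<Longrightarrow> f' x b \<noteq> 0"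
      by auto
    have F': "(F has_derivative (\<lambda>h. h + (f' x h - h \<bullet> b) *\<^sub>R b)) (at x)" if "x \<in> B" for x
      unfolding F_def using f[of x] that B(4) by (auto intro!: derivative_eq_intros)
    have "inj_on F B"
    proof (rule inj_onI, rule ccontr)
      fix x y assume xy: "x \<in> B" "y \<in> B" "F x = F y" "x \<noteq> y"
      have fxy: "f x = f y" using Fb[of x] Fb[of y] xy by simp
      define c where "c = y \<bullet> b - x \<bullet> b"
      have yx: "y - x = c *\<^sub>R b" using xy(3) fxy by (simp add: F_def algebra_simps c_def)
      then have "c \<noteq> 0" using xy by auto
      have seg: "x + s *\<^sub>R (y - x) \<in> B" if "0 \<le> s" "s \<le> 1" for s
        using B(3) xy that by (auto simp: convex_alt algebra_simps)
      define D where "D s h = f' (x + s *\<^sub>R (y - x)) (h *\<^sub>R (y - x))" for s h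
      have "\<exists>s. 0 < s \<and> s < (1::real) \<and> D s = (\<lambda>h. 0)"
      proof (rule Rolle_deriv[where f = "\<lambda>s. f (x + s *\<^sub>R (y - x))"])
        show "continuous_on {0..1} (\<lambda>s. f (x + s *\<^sub>R (y - x)))"
        proof (rule continuous_on_compose2[of B f])
          show "continuous_on B f"
            using B(4) f by (blast intro: continuous_at_imp_continuous_on has_derivative_continuous)
        qed (use seg in \<open>auto intro!: continuous_intros\<close>)
        fix s :: real assume "0 < s" "s < 1"
        then have "x + s *\<^sub>R (y - x) \<in> W" using seg B(4) by (meson less_imp_le subsetD)
        from f[OF this]
        show "((\<lambda>s. f (x + s *\<^sub>R (y - x))) has_derivative D s) (at s)"
          unfolding D_def by (rule has_derivative_compose[rotated]) (auto intro!: derivative_eq_intros)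
      qed (auto simp: fxy)
      then obtain s where s: "0 < s" "s < 1" and "D s = (\<lambda>h. 0)"
        by blast
      then have z: "f' (x + s *\<^sub>R (y - x)) (y - x) = 0"
        by (simp add: D_def fun_eq_iff) (metis scaleR_one)
      have sB: "x + s *\<^sub>R (y - x) \<in> B" using seg s by simp
      then have "linear (f' (x + s *\<^sub>R (y - x)))"
        using f B(4) has_derivative_linear by blast
      then have "c * f' (x + s *\<^sub>R (y - x)) b = 0"
        using z yx by (simp add: linear_cmul)
      then show False using \<open>c \<noteq> 0\<close> B(5)[OF sB] by simp
    qed
    define G where "G = inv_into B F"
    have GF: "G (F x) = x" if "x \<in> B" for x
      unfolding G_def using \<open>inj_on F B\<close> that by simp
    have contF: "continuous_on B F"
      using F' by (blast intro: continuous_at_imp_continuous_on has_derivative_continuous)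
    have G': "G differentiable (at (F x))" if x: "x \<in> B" for x
    proof -
      have lin: "linear (f' x)" using f B(4) x has_derivative_linear by blast
      \<comment> \<open>The inverse of the derivative of \<open>F\<close>: the \<open>b\<close>-coordinate is the one on which \<open>f' x\<close> takes the value \<open>k \<bullet> b\<close>.\<close>
      define q where "q k = k + (((k \<bullet> b) - f' x (k - (k \<bullet> b) *\<^sub>R b)) / f' x b - k \<bullet> b) *\<^sub>R b" for k
      have "(G has_derivative q) (at (F x))"
      proof (rule has_derivative_inverse_strong[OF B(1) x contF GF F'[OF x]])
        show "(\<lambda>h. h + (f' x h - h \<bullet> b) *\<^sub>R b) \<circ> q = id"
        proof
          fix k
          have qb: "q k \<bullet> b = ((k \<bullet> b) - f' x (k - (k \<bullet> b) *\<^sub>R b)) / f' x b"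
            using b by (simp add: q_def inner_add_left)
          have "q k = (k - (k \<bullet> b) *\<^sub>R b) + (((k \<bullet> b) - f' x (k - (k \<bullet> b) *\<^sub>R b)) / f' x b) *\<^sub>R b"
            unfolding q_def by (simp add: scaleR_left_diff_distrib)
          then have "q k = (k - (k \<bullet> b) *\<^sub>R b) + (q k \<bullet> b) *\<^sub>R b"
            by (simp only: qb[symmetric])
          then have "f' x (q k) = f' x ((k - (k \<bullet> b) *\<^sub>R b) + (q k \<bullet> b) *\<^sub>R b)"
            by (rule arg_cong)
          also have "\<dots> = f' x (k - (k \<bullet> b) *\<^sub>R b) + (q k \<bullet> b) * f' x b"
            using lin by (simp only: linear_add linear_cmul real_scaleR_def)
          also have "\<dots> = k \<bullet> b" using B(5)[OF x] by (simp add: qb)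
          finally have "f' x (q k) = k \<bullet> b" .
          moreover have eq_shift: "x + (- c) *\<^sub>R b = k" if "x = k + c *\<^sub>R b" for x c
            using that by simp
          have "q k = k + (q k \<bullet> b - k \<bullet> b) *\<^sub>R b" unfolding qb by (simp add: q_def)
          then have "q k + (k \<bullet> b - q k \<bullet> b) *\<^sub>R b = k"
            by (rule eq_shift[of "q k" "q k \<bullet> b - k \<bullet> b", unfolded minus_diff_eq])
          ultimately show "((\<lambda>h. h + (f' x h - h \<bullet> b) *\<^sub>R b) \<circ> q) k = id k"
            by simp
        qed
      qed
      then show ?thesis by (rule differentiableI)
    qed
    have "negligible (G ` (F ` (B \<inter> ?S)))"
    proof (rule negligible_differentiable_image_negligible[OF order_refl])
      show "negligible (F ` (B \<inter> ?S))"
        by (rule negligible_subset[OF negligible_vimage_inner_Basis[OF b N]]) (auto simp: Fb)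
      show "G differentiable_on F ` (B \<inter> ?S)"
        using G' by (auto simp: differentiable_on_def intro: differentiable_at_withinI)
    qed
    moreover have "G ` (F ` (B \<inter> ?S)) = B \<inter> ?S" using GF by force
    ultimately have "negligible (?S \<inter> B)" by (simp add: Int_commute)
    then show "\<exists>U. openin (top_of_set ?S) U \<and> p \<in> U \<and> negligible U"
      using B p by (intro exI[of _ "?S \<inter> B"]) (auto simp: openin_open_Int)
  qed
  then have "negligible (?S \<union> {x\<in>L. f' x b = 0})" using crit by (rule negligible_Un)
  then show ?thesis by (rule negligible_subset) (use L in auto)
qed

section \<open>Calculus of maps of class \<open>C^r\<close>\<close>

text \<open>\<open>pderivs\<close> differentiates in the last listed direction first. Splitting it off at this end gives
the recursion \<open>Cr_on_Suc\<close> on the order, by which the closure properties are proved.\<close>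

lemma pderivs_snoc:
  "pderivs (bs @ [b]) f = pderivs bs (\<lambda>x. frechet_derivative f (at x) b)"
  by (induction bs) auto

lemma frechet_derivative_cong_open:
  assumes "open W" "x \<in> W" "\<And>y. y \<in> W \<Longrightarrow> f y = g y"
  shows "frechet_derivative f (at x) = frechet_derivative g (at x)"
proof -
  have "(f has_derivative D) (at x) \<longleftrightarrow> (g has_derivative D) (at x)" for D
    using assms has_derivative_transform_within_open[of f D x UNIV W g]
      has_derivative_transform_within_open[of g D x UNIV W f] by auto
  then show ?thesis by (simp add: frechet_derivative_def)
qed

lemma differentiable_cong_open:
  assumes "open W" "x \<in> W" "\<And>y. y \<in> W \<Longrightarrow> f y = g y" "f differentiable (at x)"
  shows "g differentiable (at x)"
  using assms has_derivative_transform_within_open[of f _ x UNIV W g]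
  unfolding differentiable_def by blast

lemma pderivs_cong_open:
  assumes "open W" "\<And>y. y \<in> W \<Longrightarrow> f y = g y" "x \<in> W"
  shows "pderivs bs f x = pderivs bs g x"
  using assms(3)
proof (induction bs arbitrary: x)
  case (Cons b bs)
  have "frechet_derivative (pderivs bs f) (at x) = frechet_derivative (pderivs bs g) (at x)"
    by (rule frechet_derivative_cong_open[OF assms(1) Cons.prems]) (rule Cons.IH)
  then show ?case by simp
qed (use assms in auto)

lemma Cr_on_subset: "Cr_on r W f \<Longrightarrow> V \<subseteq> W \<Longrightarrow> Cr_on r V f"
  unfolding Cr_on_def by (blast intro: continuous_on_subset)

lemma Cr_on_mono: "Cr_on r W f \<Longrightarrow> k \<le> r \<Longrightarrow> Cr_on k W f"
  unfolding Cr_on_def by (meson order_trans less_le_trans)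

lemma Cr_on_cong:
  assumes "open W" "\<And>x. x \<in> W \<Longrightarrow> f x = g x" "Cr_on r W f"
  shows "Cr_on r W g"
  unfolding Cr_on_def
proof (intro ballI impI conjI)
  fix bs :: "'a list" assume bs: "bs \<in> lists Basis" "enat (length bs) \<le> r"
  have eq: "pderivs bs f x = pderivs bs g x" if "x \<in> W" for x
    using assms that by (intro pderivs_cong_open[of W]) auto
  show "continuous_on W (pderivs bs g)"
    using assms bs eq by (subst continuous_on_cong[OF refl eq[symmetric]]) (auto simp: Cr_on_def)
  show "pderivs bs g differentiable at x" if "enat (length bs) < r" "x \<in> W" for x
    by (rule differentiable_cong_open[of W x "pderivs bs f"])
      (use assms bs eq that in \<open>auto simp: Cr_on_def\<close>)
qed

lemma Cr_on_local:
  assumes "\<And>x. x \<in> W \<Longrightarrow> \<exists>V. open V \<and> x \<in> V \<and> Cr_on r V f"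
  shows "Cr_on r W f"
  unfolding Cr_on_def
proof (intro ballI impI conjI)
  fix bs :: "'a list" assume bs: "bs \<in> lists Basis" "enat (length bs) \<le> r"
  show "continuous_on W (pderivs bs f)"
  proof (rule continuous_at_imp_continuous_on, rule ballI)
    fix x assume "x \<in> W"
    then obtain V where "open V" "x \<in> V" "Cr_on r V f" using assms by blast
    then show "isCont (pderivs bs f) x"
      using bs by (auto simp: Cr_on_def continuous_on_eq_continuous_at)
  qed
  show "pderivs bs f differentiable at x" if "enat (length bs) < r" "x \<in> W" for x
    using assms[OF that(2)] bs that by (auto simp: Cr_on_def)
qed

text \<open>This reduces the order \<open>\<infinity>\<close> to induction over finite orders.\<close>

lemma Cr_on_finite_orderI:
  assumes "\<And>k. enat k \<le> r \<Longrightarrow> Cr_on (enat k) W f"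
  shows "Cr_on r W f"
  unfolding Cr_on_def
proof (intro ballI impI conjI)
  fix bs :: "'a list" assume bs: "bs \<in> lists Basis" "enat (length bs) \<le> r"
  show "continuous_on W (pderivs bs f)"
    using assms[OF bs(2)] bs by (auto simp: Cr_on_def)
  show "pderivs bs f differentiable at x" if "enat (length bs) < r" "x \<in> W" for x
  proof -
    have "Cr_on (enat (Suc (length bs))) W f"
      using that by (intro assms) (simp add: Suc_ile_eq)
    then show ?thesis using bs that by (auto simp: Cr_on_def)
  qed
qed

lemma Cr_on_0: "Cr_on (enat 0) W f \<longleftrightarrow> continuous_on W f"
  by (auto simp: Cr_on_def dest: bspec[of _ _ "[]"])

lemma Cr_on_Suc:
  "Cr_on (enat (Suc k)) W f \<longleftrightarrow> continuous_on W f \<and> (\<forall>x\<in>W. f differentiable (at x)) \<and>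
     (\<forall>b\<in>Basis. Cr_on (enat k) W (\<lambda>x. frechet_derivative f (at x) b))"
proof
  assume f: "Cr_on (enat (Suc k)) W f"
  have "Cr_on (enat k) W (\<lambda>x. frechet_derivative f (at x) b)" if "b \<in> Basis" for b
    unfolding Cr_on_def
  proof (intro ballI impI)
    fix bs :: "'a list" assume "bs \<in> lists Basis" "enat (length bs) \<le> enat k"
    with f[unfolded Cr_on_def, rule_format, of "bs @ [b]"] that
    show "continuous_on W (pderivs bs (\<lambda>x. frechet_derivative f (at x) b)) \<and>
      (enat (length bs) < enat k \<longrightarrow>
        (\<forall>x\<in>W. pderivs bs (\<lambda>x. frechet_derivative f (at x) b) differentiable at x))"
      by (simp add: pderivs_snoc)
  qed
  then show "continuous_on W f \<and> (\<forall>x\<in>W. f differentiable (at x)) \<and>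
     (\<forall>b\<in>Basis. Cr_on (enat k) W (\<lambda>x. frechet_derivative f (at x) b))"
    using f[unfolded Cr_on_def, rule_format, of "[]"] by simp
next
  assume f: "continuous_on W f \<and> (\<forall>x\<in>W. f differentiable (at x)) \<and>
     (\<forall>b\<in>Basis. Cr_on (enat k) W (\<lambda>x. frechet_derivative f (at x) b))"
  show "Cr_on (enat (Suc k)) W f"
    unfolding Cr_on_def
  proof (intro ballI impI)
    fix bs :: "'a list" assume bs: "bs \<in> lists Basis" "enat (length bs) \<le> enat (Suc k)"
    show "continuous_on W (pderivs bs f) \<and>
      (enat (length bs) < enat (Suc k) \<longrightarrow> (\<forall>x\<in>W. pderivs bs f differentiable at x))"
    proof (cases bs rule: rev_cases)
      case (snoc bs' b)
      then have "Cr_on (enat k) W (\<lambda>x. frechet_derivative f (at x) b)" "bs' \<in> lists Basis"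
        "length bs' \<le> k" using f bs by auto
      then show ?thesis unfolding snoc by (simp add: Cr_on_def pderivs_snoc)
    qed (use f in simp)
  qed
qed

lemma Cr_on_SucI:
  assumes "open W" "\<And>x. x \<in> W \<Longrightarrow> (f has_derivative f' x) (at x)"
    "\<And>b. b \<in> Basis \<Longrightarrow> Cr_on (enat k) W (\<lambda>x. f' x b)"
  shows "Cr_on (enat (Suc k)) W f"
  unfolding Cr_on_Suc
proof (intro conjI ballI)
  show "continuous_on W f"
    using assms(2) by (blast intro: continuous_at_imp_continuous_on has_derivative_continuous)
  show "f differentiable at x" if "x \<in> W" for x
    using assms(2)[OF that] by (rule differentiableI)
  show "Cr_on (enat k) W (\<lambda>x. frechet_derivative f (at x) b)" if "b \<in> Basis" for b
    by (rule Cr_on_cong[OF assms(1) _ assms(3)[OF that]]) (simp add: frechet_derivative_at[OF assms(2), symmetric])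
qed

lemma Cr_on_SucD:
  assumes "Cr_on (enat (Suc k)) W f"
  shows "\<And>x. x \<in> W \<Longrightarrow> (f has_derivative frechet_derivative f (at x)) (at x)"
    and "\<And>b. b \<in> Basis \<Longrightarrow> Cr_on (enat k) W (\<lambda>x. frechet_derivative f (at x) b)"
    and "Cr_on (enat k) W f"
  using assms Cr_on_mono[OF assms, of "enat k"] unfolding Cr_on_Suc by (auto simp: frechet_derivative_works[symmetric])

lemma Cr_on_continuous: "Cr_on r W f \<Longrightarrow> continuous_on W f"
  using Cr_on_mono[of r W f "enat 0"] unfolding Cr_on_0 by (simp add: enat_0)

lemma Cr_on_differentiable: "Cr_on r W f \<Longrightarrow> 1 \<le> r \<Longrightarrow> x \<in> W \<Longrightarrow> f differentiable (at x)"
  using Cr_on_mono[of r W f "enat (Suc 0)"] by (simp add: Cr_on_Suc one_enat_def)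

lemma Cr_on_const: "open W \<Longrightarrow> Cr_on r W (\<lambda>_. c)"
proof (rule Cr_on_finite_orderI)
  fix k assume "open W"
  show "Cr_on (enat k) W (\<lambda>_. c)"
  proof (induction k arbitrary: c)
    case (Suc k)
    then show ?case using \<open>open W\<close> by (intro Cr_on_SucI[where f' = "\<lambda>_ _. 0"]) auto
  qed (simp add: Cr_on_0)
qed

lemma Cr_on_bounded_linear:
  fixes f :: "'a::euclidean_space \<Rightarrow> 'b::euclidean_space" and L :: "'b \<Rightarrow> 'c::euclidean_space"
  assumes L: "bounded_linear L" and W: "open W" and f: "Cr_on r W f"
  shows "Cr_on r W (\<lambda>x. L (f x))"
proof -
  have *: "Cr_on (enat k) W (\<lambda>x. L (f x))" if "Cr_on (enat k) W f" for k and f :: "'a \<Rightarrow> 'b"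
    using that
  proof (induction k arbitrary: f)
    case 0
    then show ?case using bounded_linear.continuous_on[OF L] by (simp add: Cr_on_0)
  next
    case (Suc k)
    note f = Cr_on_SucD[OF Suc.prems]
    show ?case
    proof (rule Cr_on_SucI[OF W])
      show "((\<lambda>x. L (f x)) has_derivative (\<lambda>h. L (frechet_derivative f (at x) h))) (at x)"
        if "x \<in> W" for x
        by (rule bounded_linear.has_derivative[OF L f(1)[OF that]])
      show "Cr_on (enat k) W (\<lambda>x. L (frechet_derivative f (at x) b))" if "b \<in> Basis" for b
        by (rule Suc.IH[OF f(2)[OF that]])
    qed
  qed
  show ?thesis by (rule Cr_on_finite_orderI, rule *[OF Cr_on_mono[OF f]])
qed

lemma Cr_on_id: "open W \<Longrightarrow> Cr_on r W (\<lambda>x. x)"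
proof (rule Cr_on_finite_orderI)
  fix k assume W: "open W"
  show "Cr_on (enat k) W (\<lambda>x. x)"
    by (cases k) (simp_all add: Cr_on_0 Cr_on_SucI[OF W has_derivative_ident Cr_on_const[OF W]])
qed

lemma Cr_on_add:
  fixes f g :: "'a::euclidean_space \<Rightarrow> 'b::euclidean_space"
  assumes W: "open W" and f: "Cr_on r W f" and g: "Cr_on r W g"
  shows "Cr_on r W (\<lambda>x. f x + g x)"
proof -
  have *: "Cr_on (enat k) W (\<lambda>x. f x + g x)" if "Cr_on (enat k) W f" "Cr_on (enat k) W g"
    for k and f g :: "'a \<Rightarrow> 'b"
    using that
  proof (induction k arbitrary: f g)
    case 0
    then show ?case by (auto simp: Cr_on_0 intro: continuous_on_add)
  next
    case (Suc k)
    note f = Cr_on_SucD[OF Suc.prems(1)] and g = Cr_on_SucD[OF Suc.prems(2)]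
    show ?case
    proof (rule Cr_on_SucI[OF W])
      show "((\<lambda>x. f x + g x) has_derivative
          (\<lambda>h. frechet_derivative f (at x) h + frechet_derivative g (at x) h)) (at x)" if "x \<in> W" for x
        by (rule has_derivative_add[OF f(1)[OF that] g(1)[OF that]])
      show "Cr_on (enat k) W (\<lambda>x. frechet_derivative f (at x) b + frechet_derivative g (at x) b)"
        if "b \<in> Basis" for b
        by (rule Suc.IH[OF f(2)[OF that] g(2)[OF that]])
    qed
  qed
  show ?thesis by (rule Cr_on_finite_orderI, rule *[OF Cr_on_mono[OF f] Cr_on_mono[OF g]])
qed

lemma Cr_on_scaleR:
  fixes f :: "'a::euclidean_space \<Rightarrow> 'b::euclidean_space"
  assumes W: "open W" and u: "Cr_on r W u" and f: "Cr_on r W f"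
  shows "Cr_on r W (\<lambda>x. u x *\<^sub>R f x)"
proof -
  have *: "Cr_on (enat k) W (\<lambda>x. u x *\<^sub>R f x)" if "Cr_on (enat k) W u" "Cr_on (enat k) W f"
    for k u and f :: "'a \<Rightarrow> 'b"
    using that
  proof (induction k arbitrary: u f)
    case 0
    then show ?case by (auto simp: Cr_on_0 intro: continuous_on_scaleR)
  next
    case (Suc k)
    note u = Cr_on_SucD[OF Suc.prems(1)] and f = Cr_on_SucD[OF Suc.prems(2)]
    show ?case
    proof (rule Cr_on_SucI[OF W])
      show "((\<lambda>x. u x *\<^sub>R f x) has_derivative
          (\<lambda>h. u x *\<^sub>R frechet_derivative f (at x) h + frechet_derivative u (at x) h *\<^sub>R f x)) (at x)"
        if "x \<in> W" for x
        by (rule has_derivative_scaleR[OF u(1)[OF that] f(1)[OF that]])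
      show "Cr_on (enat k) W (\<lambda>x. u x *\<^sub>R frechet_derivative f (at x) b + frechet_derivative u (at x) b *\<^sub>R f x)"
        if "b \<in> Basis" for b
        by (rule Cr_on_add[OF W Suc.IH[OF u(3) f(2)[OF that]] Suc.IH[OF u(2)[OF that] f(3)]])
    qed
  qed
  show ?thesis by (rule Cr_on_finite_orderI, rule *[OF Cr_on_mono[OF u] Cr_on_mono[OF f]])
qed

lemma Cr_on_sum:
  assumes W: "open W" and "\<And>i. i \<in> S \<Longrightarrow> Cr_on r W (f i)"
  shows "Cr_on r W (\<lambda>x. \<Sum>i\<in>S. f i x)"
  using assms(2)
proof (induction S rule: infinite_finite_induct)
  case (insert i S)
  then have "Cr_on r W (\<lambda>x. f i x + (\<Sum>i\<in>S. f i x))"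
    by (intro Cr_on_add[OF W]) auto
  then show ?case using insert by simp
qed (simp_all add: Cr_on_const[OF W])

text \<open>The induction works for all outer functions at once: by the chain rule, each partial derivative of
the composite is a sum of products of partial derivatives of \<open>F\<close> with composites of partial
derivatives of \<open>f\<close>, which are of one order less.\<close>

lemma Cr_on_compose:
  fixes f :: "'b::euclidean_space \<Rightarrow> 'c::euclidean_space" and F :: "'a::euclidean_space \<Rightarrow> 'b"
  assumes W: "open W" and V: "open V" and sub: "F ` W \<subseteq> V"
    and F: "Cr_on r W F" and f: "Cr_on r V f"
  shows "Cr_on r W (\<lambda>x. f (F x))"
proof -
  have *: "Cr_on (enat k) W (\<lambda>x. f (F x))" if "Cr_on (enat k) W F" "Cr_on (enat k) V f"
    for k and f :: "'b \<Rightarrow> 'c"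
    using that
  proof (induction k arbitrary: f)
    case 0
    then show ?case using sub by (auto simp: Cr_on_0 intro: continuous_on_compose2)
  next
    case (Suc k)
    note F = Cr_on_SucD[OF Suc.prems(1)] and f = Cr_on_SucD[OF Suc.prems(2)]
    have FV: "F x \<in> V" if "x \<in> W" for x using sub that by auto
    define f' where "f' x h = frechet_derivative f (at (F x)) (frechet_derivative F (at x) h)" for x h
    have "((\<lambda>x. f (F x)) has_derivative f' x) (at x)" if "x \<in> W" for x
      unfolding f'_def using has_derivative_compose[OF F(1)[OF that] f(1)[OF FV[OF that]]] .
    then show ?case
    proof (rule Cr_on_SucI[OF W])
      fix b :: 'a assume b: "b \<in> Basis"
      have "Cr_on (enat k) W (\<lambda>x. (frechet_derivative F (at x) b \<bullet> c) *\<^sub>R frechet_derivative f (at (F x)) c)"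
        if "c \<in> Basis" for c
        by (rule Cr_on_scaleR[OF W Cr_on_bounded_linear[OF bounded_linear_inner_left W F(2)[OF b]]
              Suc.IH[OF F(3) f(2)[OF that]]])
      then have "Cr_on (enat k) W (\<lambda>x. \<Sum>c\<in>Basis. (frechet_derivative F (at x) b \<bullet> c) *\<^sub>R frechet_derivative f (at (F x)) c)"
        by (rule Cr_on_sum[OF W])
      then show "Cr_on (enat k) W (\<lambda>x. f' x b)"
      proof (rule Cr_on_cong[OF W, rotated])
        fix x assume "x \<in> W"
        then have "linear (frechet_derivative f (at (F x)))"
          using f(1) FV has_derivative_linear by blast
        then show "(\<Sum>c\<in>Basis. (frechet_derivative F (at x) b \<bullet> c) *\<^sub>R frechet_derivative f (at (F x)) c) = f' x b"
          unfolding f'_def by (subst (2) euclidean_representation[symmetric]) (simp add: linear_sum linear_cmul)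
      qed
    qed
  qed
  show ?thesis by (rule Cr_on_finite_orderI, rule *[OF Cr_on_mono[OF F] Cr_on_mono[OF f]])
qed

lemma pderivs_add_scaleR:
  fixes f g :: "'a::euclidean_space \<Rightarrow> 'b::euclidean_space"
  assumes W: "open W" and f: "Cr_on r W f" and g: "Cr_on r W g"
    and "bs \<in> lists Basis" "enat (length bs) \<le> r" "x \<in> W"
  shows "pderivs bs (\<lambda>x. f x + s *\<^sub>R g x) x = pderivs bs f x + s *\<^sub>R pderivs bs g x"
  using assms(4-6)
proof (induction bs arbitrary: x)
  case (Cons b bs)
  then have bs: "bs \<in> lists Basis" "enat (length bs) < r" by (auto simp: Suc_ile_eq)
  then have "pderivs bs f differentiable (at x)" "pderivs bs g differentiable (at x)"
    using f g Cons.prems unfolding Cr_on_def by auto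
  then have "((\<lambda>x. pderivs bs f x + s *\<^sub>R pderivs bs g x) has_derivative
     (\<lambda>h. frechet_derivative (pderivs bs f) (at x) h + s *\<^sub>R frechet_derivative (pderivs bs g) (at x) h)) (at x)"
    by (intro has_derivative_add has_derivative_scaleR_right) (simp_all add: frechet_derivative_works)
  moreover have "frechet_derivative (pderivs bs (\<lambda>x. f x + s *\<^sub>R g x)) (at x)
      = frechet_derivative (\<lambda>x. pderivs bs f x + s *\<^sub>R pderivs bs g x) (at x)"
    by (rule frechet_derivative_cong_open[OF W]) (use Cons bs in auto)
  ultimately show ?case by (simp add: frechet_derivative_at[symmetric])
qed simp

lemma Cr_on_differentiable_on:
  assumes "Cr_on r W f" "1 \<le> r" "S \<subseteq> W"
  shows "f differentiable_on S"
  unfolding differentiable_on_def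
  using Cr_on_differentiable[OF assms(1,2)] assms(3) by (meson differentiable_at_withinI subsetD)

subsection \<open>Bump functions\<close>

text \<open>The class of functions \<open>P(1/t) exp(-1/t)\<close>, extended by \<open>0\<close>, is closed under differentiation;
this is what makes all its members smooth.\<close>

definition exp_bump :: "real poly \<Rightarrow> real \<Rightarrow> real" where
  "exp_bump P t = (if t > 0 then poly P (1 / t) * exp (- (1 / t)) else 0)"

lemma poly_times_exp_neg_tendsto_0: "((\<lambda>u. poly P u * exp (- u)) \<longlongrightarrow> (0::real)) at_top"
proof -
  have "((\<lambda>u. \<Sum>i\<le>degree P. coeff P i * (u ^ i / exp u)) \<longlongrightarrow> (\<Sum>i\<le>degree P. coeff P i * 0)) at_top"
    by (intro tendsto_sum tendsto_mult tendsto_const tendsto_power_div_exp_0)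
  then show ?thesis by (simp add: poly_altdef sum_divide_distrib exp_minus divide_inverse sum_distrib_right mult.assoc)
qed

lemma exp_bump_has_derivative:
  "(exp_bump P has_real_derivative exp_bump ([:0, 0, 1:] * (P - pderiv P)) t) (at t)"
proof -
  consider "t > 0" | "t < 0" | "t = 0" by linarith
  then show ?thesis
  proof cases
    case 1
    have "((\<lambda>t. poly P (1 / t) * exp (- (1 / t))) has_real_derivative
       exp_bump ([:0, 0, 1:] * (P - pderiv P)) t) (at t)"
    proof -
      have inv: "((\<lambda>t. 1 / t) has_real_derivative - (1 / t\<^sup>2)) (at t)"
        using 1 by (auto intro!: derivative_eq_intros simp: power2_eq_square)
      have "((\<lambda>t. poly P (1 / t) * exp (- (1 / t))) has_real_derivative
          poly P (1 / t) * (exp (- (1 / t)) * - (- (1 / t\<^sup>2))) +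
          poly (pderiv P) (1 / t) * - (1 / t\<^sup>2) * exp (- (1 / t))) (at t)"
        by (intro DERIV_mult' DERIV_chain2[OF poly_DERIV inv] DERIV_chain2[OF DERIV_exp DERIV_minus[OF inv]])
      also have "poly P (1 / t) * (exp (- (1 / t)) * - (- (1 / t\<^sup>2))) +
          poly (pderiv P) (1 / t) * - (1 / t\<^sup>2) * exp (- (1 / t))
          = exp_bump ([:0, 0, 1:] * (P - pderiv P)) t"
        using 1 by (simp add: exp_bump_def power2_eq_square algebra_simps)
      finally show ?thesis .
    qed
    then show ?thesis
      by (rule has_field_derivative_transform_within_open[where S = "{0<..}"]) (use 1 in \<open>auto simp: exp_bump_def\<close>)
  next
    case 2
    have "((\<lambda>_. 0) has_real_derivative exp_bump ([:0, 0, 1:] * (P - pderiv P)) t) (at t)"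
      using 2 by (simp add: exp_bump_def)
    then show ?thesis
      by (rule has_field_derivative_transform_within_open[where S = "{..<0}"]) (use 2 in \<open>auto simp: exp_bump_def\<close>)
  next
    case 3
    \<comment> \<open>The difference quotient at \<open>0\<close> is \<open>u P(u) exp(-u)\<close> with \<open>u = 1/h\<close>, and the exponential wins.\<close>
    have "((\<lambda>h. exp_bump P h / h) \<longlongrightarrow> 0) (at_right 0)"
    proof -
      have "((\<lambda>h. poly ([:0, 1:] * P) (inverse h) * exp (- inverse h)) \<longlongrightarrow> 0) (at_right 0)"
        by (rule filterlim_compose[OF poly_times_exp_neg_tendsto_0 filterlim_inverse_at_top_right])
      then show ?thesis
      proof (rule Lim_transform_eventually)
        show "eventually (\<lambda>h. poly ([:0, 1:] * P) (inverse h) * exp (- inverse h) = exp_bump P h / h)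
          (at_right 0)"
          using eventually_at_right_less[of 0]
          by eventually_elim (simp add: exp_bump_def divide_inverse)
      qed
    qed
    moreover have "((\<lambda>h. exp_bump P h / h) \<longlongrightarrow> 0) (at_left 0)"
    proof (rule Lim_transform_eventually[OF tendsto_const])
      show "eventually (\<lambda>h. 0 = exp_bump P h / h) (at_left 0)"
        by (auto simp: eventually_at_filter exp_bump_def intro!: always_eventually)
    qed
    ultimately have "((\<lambda>h. exp_bump P h / h) \<longlongrightarrow> 0) (at 0)"
      by (simp add: filterlim_split_at)
    then show ?thesis using 3 by (simp add: DERIV_def exp_bump_def)
  qed
qed

lemma Cr_on_exp_bump: "Cr_on r UNIV (exp_bump P)"
proof (rule Cr_on_finite_orderI)
  fix k
  show "Cr_on (enat k) UNIV (exp_bump P)"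
  proof (induction k arbitrary: P)
    case 0
    show ?case
      unfolding Cr_on_0 using exp_bump_has_derivative
      by (blast intro: continuous_at_imp_continuous_on DERIV_isCont)
  next
    case (Suc k)
    show ?case
    proof (rule Cr_on_SucI)
      show "(exp_bump P has_derivative (\<lambda>h. h * exp_bump ([:0, 0, 1:] * (P - pderiv P)) t)) (at t)" for t
        using exp_bump_has_derivative[of P t] by (simp add: has_field_derivative_def mult_commute_abs)
      show "Cr_on (enat k) UNIV (\<lambda>t. b * exp_bump ([:0, 0, 1:] * (P - pderiv P)) t)" if "b \<in> Basis" for b :: real
        using Suc.IH that by simp
    qed simp
  qed
qed

text \<open>There is no plateau: inside the ball the function is strictly decreasing in the distance to \<open>p\<close>, so
that there each first partial derivative vanishes only on a hyperplane.\<close>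

definition ball_bump :: "'a::euclidean_space \<Rightarrow> real \<Rightarrow> 'a \<Rightarrow> real" where
  "ball_bump p \<rho> x = exp_bump 1 (\<rho>\<^sup>2 - (x - p) \<bullet> (x - p))"

lemma Cr_on_ball_bump: "Cr_on r UNIV (ball_bump p \<rho>)"
proof -
  have coord: "Cr_on r UNIV (\<lambda>x. x \<bullet> c + - (p \<bullet> c))" for c
    by (rule Cr_on_add[OF open_UNIV Cr_on_bounded_linear[OF bounded_linear_inner_left open_UNIV
          Cr_on_id[OF open_UNIV]] Cr_on_const[OF open_UNIV]])
  have "Cr_on r UNIV (\<lambda>x. \<Sum>c\<in>Basis. (x \<bullet> c + - (p \<bullet> c)) *\<^sub>R (x \<bullet> c + - (p \<bullet> c)))"
    by (rule Cr_on_sum[OF open_UNIV Cr_on_scaleR[OF open_UNIV coord coord]])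
  from Cr_on_add[OF open_UNIV Cr_on_const[OF open_UNIV]
      Cr_on_bounded_linear[OF bounded_linear_minus[OF bounded_linear_ident] open_UNIV this]]
  have "Cr_on r UNIV (\<lambda>x. \<rho>\<^sup>2 + - (\<Sum>c\<in>Basis. (x \<bullet> c + - (p \<bullet> c)) *\<^sub>R (x \<bullet> c + - (p \<bullet> c))))" .
  then have "Cr_on r UNIV (\<lambda>x. \<rho>\<^sup>2 - (x - p) \<bullet> (x - p))"
  proof (rule Cr_on_cong[OF open_UNIV, rotated])
    fix x :: 'a
    have "(x - p) \<bullet> (x - p) = (\<Sum>c\<in>Basis. (x \<bullet> c - p \<bullet> c) * (x \<bullet> c - p \<bullet> c))"
      by (subst euclidean_inner) (simp add: inner_diff_left)
    then show "\<rho>\<^sup>2 + - (\<Sum>c\<in>Basis. (x \<bullet> c + - (p \<bullet> c)) *\<^sub>R (x \<bullet> c + - (p \<bullet> c))) = \<rho>\<^sup>2 - (x - p) \<bullet> (x - p)"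
      by simp
  qed
  from Cr_on_compose[OF open_UNIV open_UNIV _ this Cr_on_exp_bump[of r 1]] show ?thesis
    by (simp add: ball_bump_def[abs_def])
qed

lemma ball_bump_eq_0:
  assumes "0 \<le> \<rho>" "x \<notin> ball p \<rho>"
  shows "ball_bump p \<rho> x = 0"
proof -
  have "\<rho>\<^sup>2 \<le> (norm (x - p))\<^sup>2"
    using assms by (intro power_mono) (auto simp: dist_norm norm_minus_commute)
  then show ?thesis by (simp add: ball_bump_def exp_bump_def power2_norm_eq_inner)
qed

lemma ball_bump_derivative:
  "(ball_bump p \<rho> has_derivative
     (\<lambda>h. - 2 * ((x - p) \<bullet> h) * exp_bump [:0, 0, 1:] (\<rho>\<^sup>2 - (x - p) \<bullet> (x - p)))) (at x)"
proof -
  have 1: "((\<lambda>x. \<rho>\<^sup>2 - (x - p) \<bullet> (x - p)) has_derivative (\<lambda>h. - 2 * ((x - p) \<bullet> h))) (at x)"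
    by (auto intro!: derivative_eq_intros simp: inner_commute)
  have 2: "(exp_bump 1 has_derivative (\<lambda>h. h * exp_bump [:0, 0, 1:] t)) (at t)" for t
    using exp_bump_has_derivative[of 1 t] by (simp add: has_field_derivative_def mult_commute_abs)
  show ?thesis
    using has_derivative_compose[OF 1 2] by (simp add: ball_bump_def[abs_def])
qed

lemma negligible_ball_bump_critical:
  fixes p :: "'a::euclidean_space"
  assumes b: "b \<in> Basis" and "0 < \<rho>"
  shows "negligible {x \<in> cball p \<rho>. frechet_derivative (ball_bump p \<rho>) (at x) b = 0}"
proof (rule negligible_subset)
  show "negligible ({x. b \<bullet> x = b \<bullet> p} \<union> sphere p \<rho>)"
    using b by (intro negligible_Un negligible_hyperplane negligible_sphere) auto
  show "{x \<in> cball p \<rho>. frechet_derivative (ball_bump p \<rho>) (at x) b = 0} \<subseteq> {x. b \<bullet> x = b \<bullet> p} \<union> sphere p \<rho>"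
  proof
    fix x assume x: "x \<in> {x \<in> cball p \<rho>. frechet_derivative (ball_bump p \<rho>) (at x) b = 0}"
    show "x \<in> {x. b \<bullet> x = b \<bullet> p} \<union> sphere p \<rho>"
    proof (cases "x \<in> sphere p \<rho>")
      case False
      then have "norm (x - p) < \<rho>" using x by (auto simp: dist_norm norm_minus_commute)
      then have "(norm (x - p))\<^sup>2 < \<rho>\<^sup>2" by (intro power_strict_mono) auto
      then have "exp_bump [:0, 0, 1:] (\<rho>\<^sup>2 - (x - p) \<bullet> (x - p)) \<noteq> 0"
        by (simp add: exp_bump_def power2_norm_eq_inner)
      moreover have "- 2 * ((x - p) \<bullet> b) * exp_bump [:0, 0, 1:] (\<rho>\<^sup>2 - (x - p) \<bullet> (x - p)) = 0"
        using x by (simp add: frechet_derivative_at[OF ball_bump_derivative, symmetric])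
      ultimately have "(x - p) \<bullet> b = 0" by simp
      then have "b \<bullet> x = b \<bullet> p" by (metis inner_commute inner_diff_right right_minus_eq)
      then show ?thesis by simp
    qed simp
  qed
qed

section \<open>The torus\<close>

lemma torus_of_eq_iff: "torus_of x = torus_of y \<longleftrightarrow> x - y \<in> int_vec"
  by (simp add: torus.abs_eq_iff)

lemma torus_of_rep [simp]: "torus_of (rep_torus y) = y"
  using Quotient_torus by (rule Quotient_abs_rep)

lemma torus_of_add: "torus_of (x + y) = torus_of x + torus_of y"
  by (simp add: plus_torus.abs_eq)

lemma torus_mat_torus_of: "torus_mat A (torus_of x) = torus_of (map_matrix real_of_int A *v x)"
  by (simp add: torus_mat.abs_eq)

lemma torus_mat_add: "torus_mat A (x + y) = torus_mat A x + torus_mat A y"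
  by transfer (simp add: matrix_vector_right_distrib int_vec_0)

lemma open_torus_of_image:
  fixes B :: "(real^'d) set"
  assumes "open B" shows "open (torus_of ` B)"
proof -
  have "torus_of -` (torus_of ` B) = (\<Union>z\<in>int_vec. (\<lambda>x. z + x) ` B)"
  proof (intro set_eqI iffI)
    fix x assume "x \<in> torus_of -` (torus_of ` B)"
    then obtain b where "b \<in> B" "x - b \<in> int_vec" by (auto simp: torus_of_eq_iff)
    then show "x \<in> (\<Union>z\<in>int_vec. (\<lambda>x. z + x) ` B)"
      by (intro UN_I[of "x - b"] image_eqI[of _ _ b]) auto
  next
    fix x assume "x \<in> (\<Union>z\<in>int_vec. (\<lambda>x. z + x) ` B)"
    then obtain z b where "z \<in> int_vec" "b \<in> B" "x = z + b" by auto
    then show "x \<in> torus_of -` (torus_of ` B)"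
      by (auto simp: torus_of_eq_iff intro!: image_eqI[of _ _ b])
  qed
  then show ?thesis using assms by (auto simp: open_torus_def intro: open_translation)
qed

lemma open_vimage_torus_of: "open S \<Longrightarrow> open (torus_of -` S)"
  by (simp add: open_torus_def)

text \<open>Second countability makes the Borel sets of products with the torus coincide with the product
\<open>\<sigma>\<close>-algebra.\<close>

instance torus :: (finite) second_countable_topology
proof
  obtain \<B> :: "(real^'a) set set" where \<B>: "countable \<B>" "topological_basis \<B>"
    using ex_countable_basis by blast
  have "topological_basis ((`) torus_of ` \<B>)"
  proof (rule topological_basisI)
    show "open S" if "S \<in> (`) torus_of ` \<B>" for S
      using that \<B>(2) by (auto intro: open_torus_of_image topological_basis_open)
    fix S and y :: "'a torus" assume S: "open S" "y \<in> S"
    then have "rep_torus y \<in> torus_of -` S" by simp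
    then obtain B where "B \<in> \<B>" "rep_torus y \<in> B" "B \<subseteq> torus_of -` S"
      using topological_basisE[OF \<B>(2) open_vimage_torus_of[OF S(1)]] by metis
    then show "\<exists>B\<in>(`) torus_of ` \<B>. y \<in> B \<and> B \<subseteq> S"
      by (intro bexI[of _ "torus_of ` B"]) (auto intro!: image_eqI[of y _ "rep_torus y"])
  qed
  then show "\<exists>B::'a torus set set. countable B \<and> open = generate_topology B"
    using \<B>(1) by (intro exI[of _ "(`) torus_of ` \<B>"] conjI topological_basis_imp_subbasis) auto
qed

instance torus :: (finite) topological_monoid_add
proof
  fix a b :: "'a torus"
  have "continuous_on UNIV (\<lambda>p :: 'a torus \<times> 'a torus. fst p + snd p)"
  proof (subst continuous_on_open_vimage[OF open_UNIV], intro allI impI)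
    fix S :: "'a torus set" assume S: "open S"
    show "open ((\<lambda>p. fst p + snd p) -` S \<inter> UNIV)"
    proof (rule open_prod_intro)
      fix p :: "'a torus \<times> 'a torus" assume p: "p \<in> (\<lambda>p. fst p + snd p) -` S \<inter> UNIV"
      define T where "T = (\<lambda>q :: (real^'a) \<times> (real^'a). fst q + snd q) -` (torus_of -` S)"
      have "open T" unfolding T_def
        by (rule open_vimage[OF open_vimage_torus_of[OF S]]) (intro continuous_intros)
      moreover have "(rep_torus (fst p), rep_torus (snd p)) \<in> T"
        using p by (simp add: T_def torus_of_add)
      ultimately obtain A B where AB: "open A" "open B" "rep_torus (fst p) \<in> A" "rep_torus (snd p) \<in> B"
        "A \<times> B \<subseteq> T"
        by (auto elim: open_prod_elim)
      have "torus_of ` A \<times> torus_of ` B \<subseteq> (\<lambda>p. fst p + snd p) -` S"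
      proof safe
        fix x y assume "x \<in> A" "y \<in> B"
        then have "(x, y) \<in> T" using AB(5) by auto
        then show "(torus_of x, torus_of y) \<in> (\<lambda>p. fst p + snd p) -` S"
          by (simp add: T_def torus_of_add)
      qed
      moreover have "p \<in> torus_of ` A \<times> torus_of ` B"
        using AB by (metis SigmaI imageI prod.collapse torus_of_rep)
      ultimately show "\<exists>A B. open A \<and> open B \<and> p \<in> A \<times> B \<and> A \<times> B \<subseteq> (\<lambda>p. fst p + snd p) -` S \<inter> UNIV"
        using AB(1,2) by (intro exI[of _ "torus_of ` A"] exI[of _ "torus_of ` B"])
          (auto intro: open_torus_of_image)
    qed
  qed
  then have "((\<lambda>p. fst p + snd p) \<longlongrightarrow> fst (a, b) + snd (a, b)) (at (a, b))"
    unfolding continuous_on_def by (rule bspec) simp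
  then have "((\<lambda>p. fst p + snd p) \<longlongrightarrow> fst (a, b) + snd (a, b)) (nhds (a, b))"
    by (rule tendsto_at_iff_tendsto_nhds[THEN iffD1])
  then show "LIM p (nhds a \<times>\<^sub>F nhds b). fst p + snd p :> nhds (a + b)"
    by (simp add: nhds_prod)
qed

subsection \<open>Translation invariance of Lebesgue measure\<close>

definition unit_box :: "(real^'d) set" where
  "unit_box = {x. \<forall>i. 0 \<le> x $ i \<and> x $ i < 1}"

lemma unit_box_borel [measurable]: "unit_box \<in> sets borel"
proof -
  have "unit_box = (\<Inter>i. {x :: real^'a. 0 \<le> x $ i \<and> x $ i < 1})"
    by (auto simp: unit_box_def)
  also have "\<dots> \<in> sets borel" by measurable
  finally show ?thesis .
qed

lemma unit_box_cell:
  fixes x :: "real^'d"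
  shows "\<exists>!z. z \<in> int_vec \<and> x - z \<in> unit_box"
proof (rule ex1I[of _ "\<chi> i. of_int \<lfloor>x $ i\<rfloor>"])
  show "(\<chi> i. of_int \<lfloor>x $ i\<rfloor>) \<in> int_vec \<and> x - (\<chi> i. of_int \<lfloor>x $ i\<rfloor>) \<in> unit_box"
    by (auto simp: int_vec_def unit_box_def) linarith
next
  fix z assume z: "z \<in> int_vec \<and> x - z \<in> unit_box"
  show "z = (\<chi> i. of_int \<lfloor>x $ i\<rfloor>)"
  proof (subst vec_eq_iff, intro allI)
    fix i
    have "z $ i \<in> \<int>" using z by (simp add: int_vec_def)
    then obtain k where k: "z $ i = of_int k" by (auto elim: Ints_cases)
    moreover have "0 \<le> x $ i - z $ i" "x $ i - z $ i < 1"
      using z by (auto simp: unit_box_def)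
    ultimately have "\<lfloor>x $ i\<rfloor> = k" by (intro floor_unique) linarith+
    then show "z $ i = (\<chi> i. of_int \<lfloor>x $ i\<rfloor>) $ i" by (simp add: k)
  qed
qed

lemma countable_int_vec: "countable (int_vec :: (real^'d) set)"
proof (rule countable_subset)
  show "int_vec \<subseteq> range (\<lambda>f :: 'd \<Rightarrow> int. \<chi> i. real_of_int (f i))"
  proof
    fix z :: "real^'d" assume "z \<in> int_vec"
    then have "\<forall>i. \<exists>k. z $ i = of_int k" by (auto simp: int_vec_def elim!: Ints_cases)
    then obtain f where "\<forall>i. z $ i = of_int (f i)" by metis
    then show "z \<in> range (\<lambda>f. \<chi> i. real_of_int (f i))"
      by (intro image_eqI[of _ _ f]) (auto simp: vec_eq_iff)
  qed
qed simp

lemma emeasure_lborel_translate: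
  fixes A :: "'a::euclidean_space set"
  assumes "A \<in> sets borel"
  shows "emeasure lborel {x. c + x \<in> A} = emeasure lborel A"
proof -
  have "emeasure lborel A = emeasure (distr lborel borel ((+) c)) A"
    by (simp add: lborel_distr_plus)
  also have "\<dots> = emeasure lborel {x. c + x \<in> A}"
    using assms by (simp add: emeasure_distr vimage_def)
  finally show ?thesis by simp
qed

text \<open>The cells \<open>z + unit_box\<close> tile the space. Cutting the translated box along them and moving each piece
back by its \<open>z\<close> rearranges the translated box into the original one; by periodicity \<open>T\<close> looks the
same in each piece.\<close>

lemma emeasure_periodic_unit_box_translate:
  fixes a :: "real^'d"
  assumes T[measurable]: "T \<in> sets borel" and per: "\<And>x z. z \<in> int_vec \<Longrightarrow> z + x \<in> T \<longleftrightarrow> x \<in> T"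
  shows "emeasure lborel {x\<in>T. x - a \<in> unit_box} = emeasure lborel {x\<in>T. x \<in> unit_box}"
proof -
  define E where "E z = {x\<in>T. x - a \<in> unit_box \<and> x - z \<in> unit_box}" for z
  define F where "F z = {x\<in>T. x \<in> unit_box \<and> x - (a - z) \<in> unit_box}" for z
  have [measurable]: "E z \<in> sets borel" "F z \<in> sets borel" for z
    unfolding E_def F_def by measurable
  have EF: "emeasure lborel (E z) = emeasure lborel (F z)" if "z \<in> int_vec" for z
  proof -
    have "{x. z + x \<in> E z} = F z"
      using per[OF that] by (auto simp: E_def F_def algebra_simps)
    then show ?thesis using emeasure_lborel_translate[of "E z" z] by simp
  qed
  have cell: "\<exists>z\<in>int_vec. x - z \<in> unit_box" for x :: "real^'d"
    using unit_box_cell by blast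
  have "{x\<in>T. x - a \<in> unit_box} = (\<Union>z\<in>int_vec. E z)"
    using cell by (auto simp: E_def)
  moreover have "disjoint_family_on E int_vec"
    unfolding disjoint_family_on_def using unit_box_cell by (auto simp: E_def)
  ultimately have 1: "emeasure lborel {x\<in>T. x - a \<in> unit_box} = (\<integral>\<^sup>+z. emeasure lborel (E z) \<partial>count_space int_vec)"
    by (simp add: emeasure_UN_countable countable_int_vec)
  have "\<exists>z\<in>int_vec. x - (a - z) \<in> unit_box" for x
  proof -
    obtain w where "w \<in> int_vec" "(x - a) - w \<in> unit_box" using unit_box_cell by blast
    then show ?thesis by (intro bexI[of _ "- w"]) (auto simp: algebra_simps int_vec_uminus)
  qed
  then have "{x\<in>T. x \<in> unit_box} = (\<Union>z\<in>int_vec. F z)"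
    by (auto simp: F_def)
  moreover have "disjoint_family_on F int_vec"
    unfolding disjoint_family_on_def
  proof (intro ballI impI)
    fix z w :: "real^'d" assume zw: "z \<in> int_vec" "w \<in> int_vec" "z \<noteq> w"
    have "False" if x: "x \<in> F z" "x \<in> F w" for x
    proof -
      have "- z \<in> int_vec \<and> (x - a) - (- z) \<in> unit_box" "- w \<in> int_vec \<and> (x - a) - (- w) \<in> unit_box"
        using x zw by (auto simp: F_def algebra_simps int_vec_uminus)
      then have "- z = - w" using unit_box_cell by blast
      then show False using zw by simp
    qed
    then show "F z \<inter> F w = {}" by blast
  qed
  ultimately have 2: "emeasure lborel {x\<in>T. x \<in> unit_box} = (\<integral>\<^sup>+z. emeasure lborel (F z) \<partial>count_space int_vec)"
    by (simp add: emeasure_UN_countable countable_int_vec)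
  show ?thesis unfolding 1 2 by (intro nn_integral_cong) (simp add: EF)
qed

lemma torus_of_measurable [measurable]: "torus_of \<in> borel_measurable borel"
  by (rule borel_measurable_continuous_onI[OF continuous_torus_of])

lemma space_torus_lebesgue [simp]: "space torus_lebesgue = UNIV"
  and sets_torus_lebesgue [simp, measurable_cong]: "sets torus_lebesgue = sets borel"
  by (simp_all add: torus_lebesgue_def)

lemma emeasure_torus_lebesgue:
  assumes [measurable]: "S \<in> sets borel"
  shows "emeasure torus_lebesgue S = emeasure lborel {x \<in> torus_of -` S. x \<in> unit_box}"
proof -
  have "emeasure torus_lebesgue S = emeasure (restrict_space lborel unit_box) (torus_of -` S \<inter> unit_box)"
    unfolding torus_lebesgue_def unit_box_def[symmetric]
    by (subst emeasure_distr) (auto simp: space_restrict_space intro!: measurable_restrict_space1)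
  also have "\<dots> = emeasure lborel (torus_of -` S \<inter> unit_box)"
    by (subst emeasure_restrict_space) auto
  finally show ?thesis by (simp add: Int_def vimage_def)
qed

lemma finite_measure_torus_lebesgue: "finite_measure (torus_lebesgue :: ('d::finite) torus measure)"
proof (rule finite_measureI)
  have "emeasure lborel (unit_box :: (real^'d) set) \<le> emeasure lborel (cbox 0 1 :: (real^'d) set)"
    by (intro emeasure_mono) (auto simp: unit_box_def mem_box_cart less_imp_le)
  also have "\<dots> < \<infinity>" by (rule emeasure_lborel_cbox_finite)
  finally show "emeasure (torus_lebesgue :: 'd torus measure) (space torus_lebesgue) \<noteq> \<infinity>"
    by (simp add: emeasure_torus_lebesgue)
qed

lemma emeasure_torus_lebesgue_translate:
  fixes c :: "'d::finite torus"
  assumes [measurable]: "S \<in> sets borel"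
  shows "emeasure torus_lebesgue {y. y + c \<in> S} = emeasure torus_lebesgue S"
proof -
  define a where "a = rep_torus c"
  define T where "T = torus_of -` S"
  have c: "c = torus_of a" by (simp add: a_def)
  have [measurable]: "T \<in> sets borel" unfolding T_def using measurable_sets[OF torus_of_measurable assms] by simp
  have [measurable]: "{y. y + c \<in> S} \<in> sets borel" by measurable
  have per: "z + x \<in> T \<longleftrightarrow> x \<in> T" if "z \<in> int_vec" for x z
  proof -
    have "torus_of (z + x) = torus_of x" using that by (simp add: torus_of_eq_iff)
    then show ?thesis by (simp add: T_def)
  qed
  have "emeasure torus_lebesgue {y. y + c \<in> S} = emeasure lborel {x. a + x \<in> {x\<in>T. x - a \<in> unit_box}}"
    by (subst emeasure_torus_lebesgue) (auto simp: T_def c torus_of_add[symmetric] add.commute)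
  also have "\<dots> = emeasure lborel {x\<in>T. x - a \<in> unit_box}"
    by (rule emeasure_lborel_translate) measurable
  also have "\<dots> = emeasure lborel {x\<in>T. x \<in> unit_box}"
    using per by (rule emeasure_periodic_unit_box_translate[rotated]) measurable
  also have "\<dots> = emeasure torus_lebesgue S"
    by (simp add: emeasure_torus_lebesgue T_def)
  finally show ?thesis .
qed

subsection \<open>Trigonometric polynomials\<close>

text \<open>The embedding realizes closed subsets of the torus as compact subsets of a Euclidean space, where
Stone--Weierstrass and distance functions are at hand.\<close>

lift_definition torus_embed :: "'d::finite torus \<Rightarrow> complex^'d" is "\<lambda>x. \<chi> i. cis (2 * pi * x $ i)"
proof -
  fix x y :: "real^'d" assume xy: "x - y \<in> int_vec"
  have "cis (2 * pi * x $ i) = cis (2 * pi * y $ i)" for i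
  proof -
    from xy have "x $ i - y $ i \<in> \<int>" by (simp add: int_vec_def)
    then obtain k where "x $ i - y $ i = of_int k" by (auto elim: Ints_cases)
    then have "2 * pi * x $ i = 2 * pi * y $ i + 2 * pi * of_int k" by (simp add: algebra_simps)
    then show ?thesis by (simp add: cis_mult[symmetric] cis_multiple_2pi)
  qed
  then show "(\<chi> i. cis (2 * pi * x $ i)) = (\<chi> i. cis (2 * pi * y $ i))" by simp
qed

lemma torus_embed_torus_of: "torus_embed (torus_of x) = (\<chi> i. cis (2 * pi * x $ i))"
  by (rule torus_embed.abs_eq)

lemma inj_torus_embed: "inj torus_embed"
proof (rule injI)
  fix y y' :: "'a torus" assume *: "torus_embed y = torus_embed y'"
  define x x' where "x = rep_torus y" and "x' = rep_torus y'"
  have y: "y = torus_of x" "y' = torus_of x'" by (simp_all add: x_def x'_def)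
  have "x $ i - x' $ i \<in> \<int>" for i
  proof -
    have "cis (2 * pi * x $ i) = cis (2 * pi * x' $ i)"
      using * by (simp add: y torus_embed_torus_of vec_eq_iff)
    then obtain n :: int where "2 * pi * x $ i = 2 * pi * x' $ i + 2 * pi * n"
      using sin_cos_eq_iff by (auto simp: cis.ctr complex_eq_iff)
    then have "2 * pi * (x $ i - x' $ i) = 2 * pi * n" by (simp add: algebra_simps)
    then show ?thesis by simp
  qed
  then show "y = y'" by (simp add: y torus_of_eq_iff int_vec_def)
qed

lemma continuous_cis_vec: "continuous_on S (\<lambda>x :: real^'d. \<chi> i. cis (2 * pi * x $ i))"
  by (intro continuous_intros)

lemma continuous_torus_embed: "continuous_on UNIV (torus_embed :: 'd::finite torus \<Rightarrow> _)"
proof (subst continuous_on_open_vimage[OF open_UNIV], intro allI impI)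
  fix B :: "(complex^'d) set" assume "open B"
  then have "open ((\<lambda>x :: real^'d. \<chi> i. cis (2 * pi * x $ i)) -` B)"
    by (rule open_vimage) (rule continuous_cis_vec)
  then show "open (torus_embed -` B \<inter> UNIV)"
    by (simp add: open_torus_def vimage_def torus_embed_torus_of)
qed

lemma compact_torus_embed_image:
  fixes D :: "'d::finite torus set"
  assumes "closed D"
  shows "compact (torus_embed ` D)"
proof -
  have "torus_embed ` D = (\<lambda>x. \<chi> i. cis (2 * pi * x $ i)) ` (torus_of -` D \<inter> cbox 0 1)"
  proof (intro set_eqI iffI)
    fix e assume "e \<in> torus_embed ` D"
    then obtain y where y: "y \<in> D" "e = torus_embed y" by blast
    obtain z where z: "z \<in> int_vec" "rep_torus y - z \<in> unit_box" using unit_box_cell by blast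
    then have eq: "torus_of (rep_torus y - z) = y"
      by (subst (2) torus_of_rep[symmetric]) (simp only: torus_of_eq_iff, simp add: int_vec_uminus)
    show "e \<in> (\<lambda>x. \<chi> i. cis (2 * pi * x $ i)) ` (torus_of -` D \<inter> cbox 0 1)"
    proof (rule image_eqI)
      show "e = (\<chi> i. cis (2 * pi * (rep_torus y - z) $ i))"
        by (simp only: y(2) torus_embed_torus_of[symmetric] eq)
      show "rep_torus y - z \<in> torus_of -` D \<inter> cbox 0 1"
        using y z eq by (auto simp: unit_box_def mem_box_cart less_imp_le)
    qed
  qed (auto simp: torus_embed_torus_of[symmetric])
  moreover have "closed (torus_of -` D)"
    using assms by (simp add: closed_def open_torus_def vimage_Compl)
  then have "compact (torus_of -` D \<inter> cbox 0 1)" by (intro closed_Int_compact compact_cbox)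
  ultimately show ?thesis
    using compact_continuous_image[OF continuous_cis_vec] by metis
qed

text \<open>The real characters of the torus. The phase \<open>c\<close> makes sine and cosine one family, closed under
translations; only integer vectors \<open>\<xi>\<close> give functions that do not depend on the representative.\<close>

definition torus_cos :: "real^'d \<Rightarrow> real \<Rightarrow> 'd::finite torus \<Rightarrow> real" where
  "torus_cos \<xi> c y = cos (2 * pi * (\<xi> \<bullet> rep_torus y) + c)"

lemma inner_int_vec: "x \<in> int_vec \<Longrightarrow> y \<in> int_vec \<Longrightarrow> x \<bullet> y \<in> \<int>"
  by (auto simp: int_vec_def inner_vec_def intro!: Ints_sum Ints_mult)

lemma torus_cos_torus_of:
  assumes "\<xi> \<in> int_vec"
  shows "torus_cos \<xi> c (torus_of x) = cos (2 * pi * (\<xi> \<bullet> x) + c)"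
proof -
  have "torus_of (rep_torus (torus_of x)) = torus_of x" by simp
  then have "rep_torus (torus_of x) - x \<in> int_vec" by (simp only: torus_of_eq_iff)
  with assms have "\<xi> \<bullet> (rep_torus (torus_of x) - x) \<in> \<int>" by (rule inner_int_vec)
  then obtain k where "\<xi> \<bullet> rep_torus (torus_of x) = \<xi> \<bullet> x + of_int k"
    by (auto elim!: Ints_cases simp: inner_diff_right algebra_simps)
  then have "2 * pi * (\<xi> \<bullet> rep_torus (torus_of x)) + c = (2 * pi * (\<xi> \<bullet> x) + c) + 2 * pi * of_int k"
    by (simp add: algebra_simps)
  then show ?thesis unfolding torus_cos_def by (simp only: cos_add[of _ "2 * pi * of_int k"] sin_int_2pin cos_int_2pin mult_1_right mult_zero_right diff_zero)
qed

inductive trig_poly :: "('d::finite torus \<Rightarrow> real) \<Rightarrow> bool" where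
  cos: "\<xi> \<in> int_vec \<Longrightarrow> trig_poly (\<lambda>y. a * torus_cos \<xi> c y)"
| add: "trig_poly p \<Longrightarrow> trig_poly q \<Longrightarrow> trig_poly (\<lambda>y. p y + q y)"

lemma trig_poly_const: "trig_poly (\<lambda>_. a)"
  using trig_poly.cos[OF int_vec_0, of a 0] by (simp add: torus_cos_def)

lemma trig_poly_scale: "trig_poly p \<Longrightarrow> trig_poly (\<lambda>y. a * p y)"
proof (induction rule: trig_poly.induct)
  case (cos \<xi> a' c)
  then show ?case using trig_poly.cos[of \<xi> "a * a'" c] by (simp add: mult.assoc)
next
  case (add p q)
  then show ?case using trig_poly.add by (simp add: distrib_left)
qed

lemma trig_poly_sum: "(\<And>i. i \<in> S \<Longrightarrow> trig_poly (p i)) \<Longrightarrow> trig_poly (\<lambda>y. \<Sum>i\<in>S. p i y)"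
  by (induction S rule: infinite_finite_induct) (auto simp: trig_poly_const intro: trig_poly.add)

text \<open>By \<open>2 cos \<alpha> cos \<beta> = cos (\<alpha> - \<beta>) + cos (\<alpha> + \<beta>)\<close>.\<close>

lemma trig_poly_mult_cos:
  assumes "\<xi> \<in> int_vec"
  shows "trig_poly q \<Longrightarrow> trig_poly (\<lambda>y. torus_cos \<xi> c y * q y)"
proof (induction rule: trig_poly.induct)
  case (cos \<eta> b e)
  have "- \<eta> \<in> int_vec" using cos by (rule int_vec_uminus)
  then have "trig_poly (\<lambda>y. b / 2 * torus_cos (\<xi> + - \<eta>) (c - e) y + b / 2 * torus_cos (\<xi> + \<eta>) (c + e) y)"
    using assms cos by (intro trig_poly.intros int_vec_add)
  also have "(\<lambda>y. b / 2 * torus_cos (\<xi> + - \<eta>) (c - e) y + b / 2 * torus_cos (\<xi> + \<eta>) (c + e) y)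
    = (\<lambda>y. torus_cos \<xi> c y * (b * torus_cos \<eta> e y))"
  proof
    fix y
    have "torus_cos (\<xi> + - \<eta>) (c - e) y + torus_cos (\<xi> + \<eta>) (c + e) y = 2 * torus_cos \<xi> c y * torus_cos \<eta> e y"
      unfolding torus_cos_def mult.assoc cos_times_cos by (simp add: inner_add_left algebra_simps)
    then show "b / 2 * torus_cos (\<xi> + - \<eta>) (c - e) y + b / 2 * torus_cos (\<xi> + \<eta>) (c + e) y
      = torus_cos \<xi> c y * (b * torus_cos \<eta> e y)"
      unfolding distrib_left[symmetric] by simp
  qed
  finally show ?case .
next
  case (add p q)
  then show ?case using trig_poly.add by (simp add: distrib_left)
qed

lemma trig_poly_mult: "trig_poly p \<Longrightarrow> trig_poly q \<Longrightarrow> trig_poly (\<lambda>y. p y * q y)"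
proof (induction rule: trig_poly.induct)
  case (cos \<xi> a c)
  show ?case using trig_poly_scale[OF trig_poly_mult_cos[OF cos], of a c] by (simp add: mult.assoc)
next
  case (add p p')
  then show ?case using trig_poly.add by (simp add: distrib_right)
qed

text \<open>The coordinates of the embedding are \<open>cos (2\<pi> y\<^sub>i)\<close> and \<open>sin (2\<pi> y\<^sub>i)\<close>, so linear functions become
trigonometric polynomials, and these form an algebra.\<close>

lemma trig_poly_torus_embed:
  fixes P :: "complex^'d \<Rightarrow> real"
  assumes "real_polynomial_function P"
  shows "trig_poly (\<lambda>y. P (torus_embed y))"
  using assms
proof (induction rule: real_polynomial_function.induct)
  case (linear f)
  then have lin: "linear f" by (rule bounded_linear.linear)
  have ax: "axis i (1 :: real) \<in> int_vec" for i :: 'd by (auto simp: int_vec_def axis_def)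
  have "f (torus_embed y) = (\<Sum>i\<in>UNIV. f (axis i 1) * torus_cos (axis i 1) 0 y
      + f (axis i \<i>) * torus_cos (axis i 1) (- (pi / 2)) y)" (is "_ = ?R") for y
  proof -
    define x where "x = rep_torus y"
    have y: "y = torus_of x" by (simp add: x_def)
    have "torus_embed y = (\<Sum>i\<in>UNIV. cos (2 * pi * x $ i) *\<^sub>R axis i 1 + sin (2 * pi * x $ i) *\<^sub>R axis i \<i>)"
      by (simp add: y torus_embed_torus_of vec_eq_iff axis_def if_distrib sum.distrib complex_eq_iff
          cong: if_cong)
    also have "f \<dots> = (\<Sum>i\<in>UNIV. cos (2 * pi * x $ i) * f (axis i 1) + sin (2 * pi * x $ i) * f (axis i \<i>))"
      using lin by (simp add: linear_sum linear_add linear_cmul)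
    also have "\<dots> = ?R"
    proof -
      have "sin t = cos (t + - (pi / 2))" for t :: real by (simp add: cos_diff)
      then show ?thesis
        by (simp add: y torus_cos_torus_of[OF ax] inner_axis' mult.commute)
    qed
    finally show ?thesis .
  qed
  then show ?case by (simp add: trig_poly_sum trig_poly.intros ax)
qed (auto intro: trig_poly_const trig_poly.add trig_poly_mult)

lemma trig_poly_approx:
  fixes F :: "complex^'d \<Rightarrow> real"
  assumes "continuous_on UNIV F" "e > 0"
  obtains p where "trig_poly p" "\<And>y. \<bar>F (torus_embed y) - p y\<bar> < e"
proof -
  obtain P where "real_polynomial_function P" "\<And>x. x \<in> range torus_embed \<Longrightarrow> \<bar>F x - P x\<bar> < e"
    using Stone_Weierstrass_real_polynomial_function[OF compact_torus_embed_image[OF closed_UNIV]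
      continuous_on_subset[OF assms(1) subset_UNIV] assms(2)] by metis
  then show ?thesis using that[OF trig_poly_torus_embed] by blast
qed

text \<open>The approximants are \<open>max 0 (1 - n d)\<close>, where \<open>d\<close> is the distance to the embedded set.\<close>

lemma indicator_closed_torus_limit:
  fixes D :: "'d::finite torus set"
  assumes "closed D"
  obtains F :: "nat \<Rightarrow> complex^'d \<Rightarrow> real" where "\<And>n. continuous_on UNIV (F n)"
    "\<And>n z. 0 \<le> F n z" "\<And>n z. F n z \<le> 1"
    "\<And>y. (\<lambda>n. F n (torus_embed y)) \<longlonglongrightarrow> indicator D y"
proof (cases "D = {}")
  case True
  then show ?thesis using that[of "\<lambda>_ _. 0"] by simp
next
  case False
  define E where "E = torus_embed ` D"
  have E: "closed E" "E \<noteq> {}" "torus_embed y \<in> E \<longleftrightarrow> y \<in> D" for y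
    using compact_torus_embed_image[OF assms] False
    by (simp_all add: E_def compact_imp_closed inj_image_mem_iff[OF inj_torus_embed])
  show ?thesis
  proof (rule that[of "\<lambda>n z. max 0 (1 - real n * infdist z E)"])
    fix y
    show "(\<lambda>n. max 0 (1 - real n * infdist (torus_embed y) E)) \<longlonglongrightarrow> indicator D y"
    proof (cases "y \<in> D")
      case True
      then have "infdist (torus_embed y) E = 0" using E by simp
      then show ?thesis using True by simp
    next
      case False
      then have "infdist (torus_embed y) E \<noteq> 0" using E in_closed_iff_infdist_zero by blast
      then have pos: "infdist (torus_embed y) E > 0" using infdist_nonneg[of "torus_embed y" E] by linarith
      have "eventually (\<lambda>n. max 0 (1 - real n * infdist (torus_embed y) E) = 0) sequentially"
        using eventually_ge_at_top[of "nat \<lceil>1 / infdist (torus_embed y) E\<rceil>"]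
      proof eventually_elim
        case (elim n)
        then have "1 / infdist (torus_embed y) E \<le> real n" by linarith
        then show ?case using pos by (simp add: field_simps)
      qed
      then show ?thesis using False by (simp add: tendsto_eventually)
    qed
  qed (auto intro!: continuous_intros simp: infdist_nonneg)
qed

lemma trig_poly_measurable:
  "trig_poly p \<Longrightarrow> p \<in> borel_measurable borel"
proof (induction rule: trig_poly.induct)
  case (cos \<xi> a c)
  have "open (torus_cos \<xi> c -` B)" if "open B" for B
  proof -
    have "open ((\<lambda>x. cos (2 * pi * (\<xi> \<bullet> x) + c)) -` B)"
      using that by (rule open_vimage) (intro continuous_intros)
    then show ?thesis by (simp add: open_torus_def vimage_def torus_cos_torus_of[OF cos])
  qed
  then have "continuous_on UNIV (torus_cos \<xi> c)" by (simp add: continuous_on_open_vimage)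
  then have [measurable]: "torus_cos \<xi> c \<in> borel_measurable borel" by (rule borel_measurable_continuous_onI)
  show ?case by measurable
qed auto

lemma trig_poly_bounded: "trig_poly p \<Longrightarrow> \<exists>C. \<forall>y. \<bar>p y\<bar> \<le> C"
proof (induction rule: trig_poly.induct)
  case (cos \<xi> a c)
  then show ?case by (intro exI[of _ "\<bar>a\<bar>"]) (auto simp: torus_cos_def abs_mult mult_left_le)
next
  case (add p q)
  then obtain C C' where "\<forall>y. \<bar>p y\<bar> \<le> C" "\<forall>y. \<bar>q y\<bar> \<le> C'" by blast
  then show ?case by (intro exI[of _ "C + C'"]) (meson abs_triangle_ineq add_mono order_trans)
qed

section \<open>Measure preserving families and Keplerian shear\<close>

locale measure_preserving_family = prob_space M for M :: "'a measure" +
  fixes g :: "real \<Rightarrow> 'a \<Rightarrow> 'a"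
  assumes measurable_family [measurable]: "\<And>t. g t \<in> measurable M M"
    and distr_family: "\<And>t. distr M M (g t) = M"
begin

abbreviation "J \<equiv> invariant_algebra M g"
abbreviation "E \<equiv> real_cond_exp M J"

lemma space_J [simp]: "space J = space M"
  by (simp add: invariant_algebra_def space_measure_of_conv)

text \<open>The sets that are invariant up to null sets already form a \<open>\<sigma>\<close>-algebra.\<close>

lemma sets_J: "B \<in> sets J \<longleftrightarrow> B \<in> sets M \<and> (\<forall>t. sym_diff (g t -` B \<inter> space M) B \<in> null_sets M)"
proof
  let ?G = "{B \<in> sets M. \<forall>t. sym_diff (g t -` B \<inter> space M) B \<in> null_sets M}"
  assume "B \<in> sets J"
  moreover have "?G \<subseteq> Pow (space M)" using sets.space_closed by blast
  ultimately have "B \<in> sigma_sets (space M) ?G"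
    by (simp add: invariant_algebra_def)
  then show "B \<in> sets M \<and> (\<forall>t. sym_diff (g t -` B \<inter> space M) B \<in> null_sets M)"
  proof (induction rule: sigma_sets.induct)
    case (Compl A)
    then have "A \<subseteq> space M" using sets.sets_into_space by blast
    then have "sym_diff (g t -` (space M - A) \<inter> space M) (space M - A) = sym_diff (g t -` A \<inter> space M) A" for t
      using measurable_space[OF measurable_family[of t]] by auto
    then show ?case using Compl by auto
  next
    case (Union A)
    have "sym_diff (g t -` (\<Union>i. A i) \<inter> space M) (\<Union>i. A i) \<in> null_sets M" for t
    proof (rule null_sets_subset)
      show "(\<Union>i. sym_diff (g t -` A i \<inter> space M) (A i)) \<in> null_sets M"
        using Union by (intro null_sets_UN) auto
      have [measurable]: "A i \<in> sets M" for i using Union by auto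
      have "g t -` (\<Union>i. A i) \<inter> space M \<in> sets M"
        by (rule measurable_sets[OF measurable_family]) auto
      then show "sym_diff (g t -` (\<Union>i. A i) \<inter> space M) (\<Union>i. A i) \<in> sets M"
        by auto
    qed auto
    then show ?case using Union by auto
  qed auto
next
  assume "B \<in> sets M \<and> (\<forall>t. sym_diff (g t -` B \<inter> space M) B \<in> null_sets M)"
  moreover have "{B \<in> sets M. \<forall>t. sym_diff (g t -` B \<inter> space M) B \<in> null_sets M} \<subseteq> Pow (space M)"
    using sets.space_closed by blast
  ultimately show "B \<in> sets J"
    by (auto simp: invariant_algebra_def)
qed

sublocale finite_measure_subalgebra M J
  by standard (auto simp: subalgebra_def sets_J)

lemma integrable_compose:
  fixes f :: "'a \<Rightarrow> real"
  assumes "integrable M f"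
  shows "integrable M (\<lambda>x. f (g t x))" "(\<integral>x. f (g t x) \<partial>M) = (\<integral>x. f x \<partial>M)"
  using assms integrable_distr[OF measurable_family[of t], of f] integral_distr[OF measurable_family[of t], of f]
  by (simp_all add: distr_family)

lemma cond_exp_contraction:
  assumes f: "integrable M f" and f': "integrable M f'"
  shows "(\<integral>x. \<bar>E f x - E f' x\<bar> \<partial>M) \<le> (\<integral>x. \<bar>f x - f' x\<bar> \<partial>M)"
proof -
  define q where "q x = f x - f' x" for x
  have q: "integrable M q" unfolding q_def using f f' by simp
  have a: "AE x in M. E q x = E f x - E f' x"
    unfolding q_def by (rule real_cond_exp_diff[OF f f'])
  have b: "AE x in M. E q x \<le> E (\<lambda>x. \<bar>q x\<bar>) x"
    by (rule real_cond_exp_mono) (use q in auto)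
  have c: "AE x in M. E (\<lambda>x. - 1 * \<bar>q x\<bar>) x \<le> E q x"
    by (rule real_cond_exp_mono) (use q in auto)
  have d: "AE x in M. E (\<lambda>x. - 1 * \<bar>q x\<bar>) x = - 1 * E (\<lambda>x. \<bar>q x\<bar>) x"
    by (rule real_cond_exp_cmult) (use q in auto)
  have "(\<integral>x. \<bar>E f x - E f' x\<bar> \<partial>M) \<le> (\<integral>x. E (\<lambda>x. \<bar>q x\<bar>) x \<partial>M)"
  proof (rule integral_mono_AE)
    show "AE x in M. \<bar>E f x - E f' x\<bar> \<le> E (\<lambda>x. \<bar>q x\<bar>) x"
      using a b c d by eventually_elim linarith
    show "integrable M (\<lambda>x. \<bar>E f x - E f' x\<bar>)"
      using f f' by (intro integrable_abs Bochner_Integration.integrable_diff real_cond_exp_int)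
    show "integrable M (E (\<lambda>x. \<bar>q x\<bar>))"
      using q by (intro real_cond_exp_int) auto
  qed
  also have "\<dots> = (\<integral>x. \<bar>q x\<bar> \<partial>M)"
    using q by (intro real_cond_exp_int) auto
  finally show ?thesis by (simp add: q_def)
qed

text \<open>The limit relation of Keplerian shear for one pair of observables. For bounded \<open>h\<close> the set of
integrable \<open>f\<close> satisfying it is a closed subspace of \<open>L\<^sup>1\<close>.\<close>

definition decorrelates :: "('a \<Rightarrow> real) \<Rightarrow> ('a \<Rightarrow> real) \<Rightarrow> bool" where
  "decorrelates h f \<longleftrightarrow> ((\<lambda>t. \<integral>x. f (g t x) * h x \<partial>M) \<longlongrightarrow> (\<integral>x. E f x * h x \<partial>M)) at_top"

text \<open>Conditional expectation \<open>0\<close> is part of the conclusion: for an invariant set \<open>A\<close>, the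
correlation of \<open>f\<close> with the indicator of \<open>A\<close> does not depend on the time, so it equals its limit.\<close>

lemma decorrelates_to_zeroI:
  assumes f: "integrable M f" and "\<And>C h. h \<in> borel_measurable M \<Longrightarrow> (\<And>x. \<bar>h x\<bar> \<le> C) \<Longrightarrow>
      ((\<lambda>t. \<integral>x. f (g t x) * h x \<partial>M) \<longlongrightarrow> 0) at_top"
    and h: "h \<in> borel_measurable M" "\<And>x. \<bar>h x\<bar> \<le> C"
  shows "decorrelates h f"
proof -
  have "AE x in M. E f x = 0"
  proof (rule real_cond_exp_charact[OF _ f])
    fix A assume "A \<in> sets J"
    then have A: "A \<in> sets M" "\<And>t. sym_diff (g t -` A \<inter> space M) A \<in> null_sets M"
      by (auto simp: sets_J)
    have [measurable]: "f \<in> borel_measurable M" "A \<in> sets M" using f A by auto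
    have "(\<integral>x. f (g t x) * indicator A x \<partial>M) = (\<integral>x. f x * indicator A x \<partial>M)" for t
    proof -
      have ae: "AE x in M. indicator A (g t x) = (indicator A x :: real)"
      proof (rule AE_I'[OF A(2)[of t]])
        show "{x \<in> space M. indicator A (g t x) \<noteq> (indicator A x :: real)} \<subseteq> sym_diff (g t -` A \<inter> space M) A"
          by (auto simp: indicator_def)
      qed
      have "(\<integral>x. f (g t x) * indicator A x \<partial>M) = (\<integral>x. f (g t x) * indicator A (g t x) \<partial>M)"
        using ae by (intro integral_cong_AE) (auto elim: AE_mp)
      also have "\<dots> = (\<integral>x. f x * indicator A x \<partial>M)"
        using integrable_mult_bounded[OF f, of "indicator A" 1]
        by (intro integrable_compose(2)) auto
      finally show ?thesis .
    qed
    moreover have "((\<lambda>t. \<integral>x. f (g t x) * indicator A x \<partial>M) \<longlongrightarrow> 0) at_top"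
      by (rule assms(2)[of _ 1]) auto
    ultimately have "(\<integral>x. f x * indicator A x \<partial>M) = 0"
      by (simp add: tendsto_const_iff)
    then show "(\<integral>x\<in>A. f x \<partial>M) = (\<integral>x\<in>A. 0 \<partial>M)"
      by (simp add: set_lebesgue_integral_def mult.commute)
  qed auto
  then have "(\<integral>x. E f x * h x \<partial>M) = (\<integral>x. 0 \<partial>M)"
    using h by (intro integral_cong_AE) (auto elim: AE_mp)
  then show ?thesis using assms(2)[OF h] by (simp add: decorrelates_def)
qed

lemma decorrelates_invariant:
  assumes f: "integrable M f" and J: "f \<in> borel_measurable J"
    and "\<And>t x. x \<in> space M \<Longrightarrow> f (g t x) = f x" and h[measurable]: "h \<in> borel_measurable M"
  shows "decorrelates h f"
proof -
  have "(\<integral>x. f (g t x) * h x \<partial>M) = (\<integral>x. f x * h x \<partial>M)" for t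
    using assms by (intro Bochner_Integration.integral_cong) auto
  moreover have "(\<integral>x. E f x * h x \<partial>M) = (\<integral>x. f x * h x \<partial>M)"
    using real_cond_exp_F_meas[OF f J] f by (intro integral_cong_AE) (auto elim: AE_mp)
  ultimately show ?thesis by (simp add: decorrelates_def)
qed

context
  fixes h :: "'a \<Rightarrow> real" and C :: real
  assumes h: "h \<in> borel_measurable M" "\<And>x. \<bar>h x\<bar> \<le> C"
begin

lemma decorrelates_scale:
  assumes f: "integrable M f" and "decorrelates h f"
  shows "decorrelates h (\<lambda>x. c * f x)"
proof -
  have "(\<integral>x. E (\<lambda>x. c * f x) x * h x \<partial>M) = (\<integral>x. c * (E f x * h x) \<partial>M)"
    using real_cond_exp_cmult[OF f, of c] h
    by (intro integral_cong_AE) (auto elim!: AE_mp)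
  then show ?thesis
    using assms(2) tendsto_mult_left[of _ _ at_top c] by (simp add: decorrelates_def mult.assoc)
qed

lemma decorrelates_add:
  assumes f: "integrable M f" and f': "integrable M f'"
    and "decorrelates h f" "decorrelates h f'"
  shows "decorrelates h (\<lambda>x. f x + f' x)"
proof -
  have i: "integrable M (\<lambda>x. q x * h x)" if "integrable M q" for q
    by (rule integrable_mult_bounded[OF that h])
  have "(\<integral>x. E (\<lambda>x. f x + f' x) x * h x \<partial>M) = (\<integral>x. E f x * h x + E f' x * h x \<partial>M)"
    using real_cond_exp_add[OF f f'] h
    by (intro integral_cong_AE) (auto elim!: AE_mp simp: distrib_right)
  also have "\<dots> = (\<integral>x. E f x * h x \<partial>M) + (\<integral>x. E f' x * h x \<partial>M)"
    by (intro Bochner_Integration.integral_add i real_cond_exp_int f f')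
  finally have 1: "(\<integral>x. E (\<lambda>x. f x + f' x) x * h x \<partial>M) = (\<integral>x. E f x * h x \<partial>M) + (\<integral>x. E f' x * h x \<partial>M)" .
  have 2: "(\<integral>x. (f (g t x) + f' (g t x)) * h x \<partial>M) = (\<integral>x. f (g t x) * h x \<partial>M) + (\<integral>x. f' (g t x) * h x \<partial>M)" for t
    unfolding distrib_right by (intro Bochner_Integration.integral_add i integrable_compose f f')
  show ?thesis
    using tendsto_add[OF assms(3,4)[unfolded decorrelates_def]] by (simp add: decorrelates_def 1 2)
qed

text \<open>Composition with the flow and conditional expectation are both \<open>L\<^sup>1\<close> contractions, so replacing \<open>f\<close>
by a nearby \<open>f'\<close> changes the two sides of the limit relation little, uniformly in time.\<close>

lemma decorrelates_closed:
  assumes f: "integrable M f"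
    and approx: "\<And>e. e > 0 \<Longrightarrow>
      \<exists>f'. decorrelates h f' \<and> integrable M f' \<and> (\<integral>x. \<bar>f x - f' x\<bar> \<partial>M) \<le> e"
  shows "decorrelates h f"
proof -
  have C: "0 \<le> C" using h(2)[of undefined] by linarith
  have "((\<lambda>t. (\<integral>x. f (g t x) * h x \<partial>M) - (\<integral>x. E f x * h x \<partial>M)) \<longlongrightarrow> 0) at_top"
  proof (rule tendsto_zero_approx)
    fix e :: real assume "e > 0"
    define d where "d = e / 2 / (C + 1)"
    have "d > 0" using \<open>e > 0\<close> C by (simp add: d_def)
    from approx[OF this] obtain f' where f': "decorrelates h f'" "integrable M f'"
      "(\<integral>x. \<bar>f x - f' x\<bar> \<partial>M) \<le> d" by blast
    have "\<bar>((\<integral>x. f (g t x) * h x \<partial>M) - (\<integral>x. E f x * h x \<partial>M))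
        - ((\<integral>x. f' (g t x) * h x \<partial>M) - (\<integral>x. E f' x * h x \<partial>M))\<bar> \<le> e" for t
    proof -
      have "\<bar>(\<integral>x. f (g t x) * h x \<partial>M) - (\<integral>x. f' (g t x) * h x \<partial>M)\<bar>
          \<le> C * (\<integral>x. \<bar>f (g t x) - f' (g t x)\<bar> \<partial>M)"
        by (rule abs_integral_diff_le[OF integrable_compose(1)[OF f] integrable_compose(1)[OF f'(2)] h])
      also have "(\<integral>x. \<bar>f (g t x) - f' (g t x)\<bar> \<partial>M) = (\<integral>x. \<bar>f x - f' x\<bar> \<partial>M)"
        by (rule integrable_compose(2)) (use f f' in auto)
      finally have 1: "\<bar>(\<integral>x. f (g t x) * h x \<partial>M) - (\<integral>x. f' (g t x) * h x \<partial>M)\<bar> \<le> C * d"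
        using mult_left_mono[OF f'(3) C] by linarith
      have "\<bar>(\<integral>x. E f x * h x \<partial>M) - (\<integral>x. E f' x * h x \<partial>M)\<bar> \<le> C * (\<integral>x. \<bar>E f x - E f' x\<bar> \<partial>M)"
        by (rule abs_integral_diff_le[OF real_cond_exp_int(1)[OF f] real_cond_exp_int(1)[OF f'(2)] h])
      also have "\<dots> \<le> C * d"
        using cond_exp_contraction[OF f f'(2)] f'(3) C by (intro mult_left_mono) auto
      finally have 2: "\<bar>(\<integral>x. E f x * h x \<partial>M) - (\<integral>x. E f' x * h x \<partial>M)\<bar> \<le> C * d" .
      have "2 * (C * d) \<le> 2 * ((C + 1) * d)" using \<open>d > 0\<close> by (simp add: distrib_right)
      also have "\<dots> = e"
      proof -
        have "C + 1 \<noteq> 0" using C by simp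
        then have "(C + 1) * d = e / 2" unfolding d_def mult.commute[of "C + 1"] by (rule nonzero_eq_divide_eq[THEN iffD1, OF _ refl])
        then show ?thesis by simp
      qed
      finally show ?thesis using 1 2 by linarith
    qed
    moreover have "((\<lambda>t. (\<integral>x. f' (g t x) * h x \<partial>M) - (\<integral>x. E f' x * h x \<partial>M)) \<longlongrightarrow> 0) at_top"
      using f'(1) by (simp add: decorrelates_def LIM_zero_iff)
    ultimately show "\<exists>q. (q \<longlongrightarrow> 0) at_top \<and> (\<forall>t. \<bar>(\<integral>x. f (g t x) * h x \<partial>M) - (\<integral>x. E f x * h x \<partial>M) - q t\<bar> \<le> e)"
      by blast
  qed
  then show ?thesis by (simp add: decorrelates_def LIM_zero_iff)
qed

end

lemma integral_cond_exp_square_le: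
  assumes f: "square_integrable M f"
  shows "integrable M (\<lambda>x. (E f x)\<^sup>2)" "(\<integral>x. (E f x)\<^sup>2 \<partial>M) \<le> (\<integral>x. (f x)\<^sup>2 \<partial>M)"
proof -
  have q: "integrable M (\<lambda>x. (f x)\<^sup>2)" and [measurable]: "f \<in> borel_measurable M"
    using f by (auto simp: square_integrable_def)
  have fi: "integrable M f" by (rule square_integrable_imp_integrable) (use q in auto)
  have cvx: "convex_on UNIV (\<lambda>x::real. x\<^sup>2)" by (rule convex_power2)
  show i: "integrable M (\<lambda>x. (E f x)\<^sup>2)"
    by (rule integrable_convex_cond_exp[OF fi, of UNIV]) (use q cvx in auto)
  have "(\<integral>x. (E f x)\<^sup>2 \<partial>M) \<le> (\<integral>x. E (\<lambda>x. (f x)\<^sup>2) x \<partial>M)"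
  proof (rule integral_mono_AE[OF i])
    show "AE x in M. (E f x)\<^sup>2 \<le> E (\<lambda>x. (f x)\<^sup>2) x"
      by (rule real_cond_exp_jensens_inequality(2)[OF fi, of UNIV]) (use q cvx in auto)
  qed (rule real_cond_exp_int(1)[OF q])
  then show "(\<integral>x. (E f x)\<^sup>2 \<partial>M) \<le> (\<integral>x. (f x)\<^sup>2 \<partial>M)"
    using real_cond_exp_int(2)[OF q] by simp
qed

text \<open>Young's form of the Cauchy--Schwarz inequality: the free weight \<open>\<delta>\<close> replaces square roots.\<close>

lemma abs_integral_mult_le:
  fixes u v :: "'a \<Rightarrow> real"
  assumes u: "square_integrable M u" and v: "square_integrable M v" and "\<delta> > 0"
  shows "integrable M (\<lambda>x. u x * v x)"
    and "\<bar>\<integral>x. u x * v x \<partial>M\<bar> \<le> \<delta> / 2 * (\<integral>x. (u x)\<^sup>2 \<partial>M) + (\<integral>x. (v x)\<^sup>2 \<partial>M) / (2 * \<delta>)"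
proof -
  have bnd: "\<bar>u x * v x\<bar> \<le> \<delta> / 2 * (u x)\<^sup>2 + (v x)\<^sup>2 / (2 * \<delta>)" for x
  proof -
    have "0 \<le> (\<delta> * \<bar>u x\<bar> - \<bar>v x\<bar>)\<^sup>2" by simp
    then have "2 * \<delta> * \<bar>u x * v x\<bar> \<le> \<delta>\<^sup>2 * (u x)\<^sup>2 + (v x)\<^sup>2"
      by (simp add: power2_diff power_mult_distrib abs_mult algebra_simps)
    then show ?thesis using \<open>\<delta> > 0\<close> by (simp add: field_simps power2_eq_square)
  qed
  have i: "integrable M (\<lambda>x. \<delta> / 2 * (u x)\<^sup>2 + (v x)\<^sup>2 / (2 * \<delta>))"
    using u v by (auto simp: square_integrable_def)
  show 1: "integrable M (\<lambda>x. u x * v x)"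
  proof (rule Bochner_Integration.integrable_bound[OF i])
    show "AE x in M. norm (u x * v x) \<le> norm (\<delta> / 2 * (u x)\<^sup>2 + (v x)\<^sup>2 / (2 * \<delta>))"
      using bnd by (intro AE_I2) (simp add: abs_le_iff, smt (verit))
  qed (use u v in \<open>auto simp: square_integrable_def\<close>)
  have "\<bar>\<integral>x. u x * v x \<partial>M\<bar> \<le> (\<integral>x. \<bar>u x * v x\<bar> \<partial>M)" by (rule integral_abs_bound)
  also have "\<dots> \<le> (\<integral>x. \<delta> / 2 * (u x)\<^sup>2 + (v x)\<^sup>2 / (2 * \<delta>) \<partial>M)"
    by (rule integral_mono[OF integrable_abs[OF 1] i bnd])
  also have "\<dots> = \<delta> / 2 * (\<integral>x. (u x)\<^sup>2 \<partial>M) + (\<integral>x. (v x)\<^sup>2 \<partial>M) / (2 * \<delta>)"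
    using u v by (simp add: square_integrable_def)
  finally show "\<bar>\<integral>x. u x * v x \<partial>M\<bar> \<le> \<delta> / 2 * (\<integral>x. (u x)\<^sup>2 \<partial>M) + (\<integral>x. (v x)\<^sup>2 \<partial>M) / (2 * \<delta>)" .
qed

text \<open>The other observable \<open>h\<close> is approximated in \<open>L\<^sup>2\<close> by its truncations. The error is uniform in time,
as the \<open>L\<^sup>2\<close> norm of \<open>f\<close> is preserved by the flow and not increased by conditional expectation.\<close>

lemma decorrelates_square_integrable:
  assumes bounded: "\<And>f h C. integrable M f \<Longrightarrow> h \<in> borel_measurable M \<Longrightarrow> (\<And>x. \<bar>h x\<bar> \<le> C) \<Longrightarrow> decorrelates h f"
    and f: "square_integrable M f" and h: "square_integrable M h"
  shows "decorrelates h f"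
proof -
  have q: "integrable M (\<lambda>x. (f x)\<^sup>2)" and [measurable]: "f \<in> borel_measurable M" "h \<in> borel_measurable M"
    and qh: "integrable M (\<lambda>x. (h x)\<^sup>2)"
    using f h by (auto simp: square_integrable_def)
  have fi: "integrable M f" by (rule square_integrable_imp_integrable) (use q in auto)
  define H where "H n x = (if \<bar>h x\<bar> \<le> real n then h x else 0)" for n x
  have [measurable]: "H n \<in> borel_measurable M" for n unfolding H_def by measurable
  have Hh: "\<bar>h x - H n x\<bar> \<le> \<bar>h x\<bar>" for n x by (simp add: H_def)
  have sq: "square_integrable M (\<lambda>x. h x - H n x)" for n
    unfolding square_integrable_def
  proof
    show "integrable M (\<lambda>x. (h x - H n x)\<^sup>2)"
      by (rule Bochner_Integration.integrable_bound[OF qh]) (auto simp: H_def)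
  qed measurable
  have sqH: "square_integrable M (H n)" for n
    unfolding square_integrable_def
  proof
    show "integrable M (\<lambda>x. (H n x)\<^sup>2)"
      by (rule Bochner_Integration.integrable_bound[OF qh]) (auto simp: H_def)
  qed measurable
  have lim: "(\<lambda>n. \<integral>x. (h x - H n x)\<^sup>2 \<partial>M) \<longlonglongrightarrow> (\<integral>x. 0 \<partial>M)"
  proof (rule integral_dominated_convergence[OF _ _ qh])
    show "AE x in M. (\<lambda>n. (h x - H n x)\<^sup>2) \<longlonglongrightarrow> 0"
    proof (rule AE_I2)
      fix x
      have "eventually (\<lambda>n. (h x - H n x)\<^sup>2 = 0) sequentially"
        using eventually_ge_at_top[of "nat \<lceil>\<bar>h x\<bar>\<rceil>"]
      proof eventually_elim
        case (elim n)
        then have "\<bar>h x\<bar> \<le> real n" by linarith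
        then show ?case by (simp add: H_def)
      qed
      then show "(\<lambda>n. (h x - H n x)\<^sup>2) \<longlonglongrightarrow> 0" by (rule tendsto_eventually)
    qed
    show "AE x in M. norm ((h x - H n x)\<^sup>2) \<le> (h x)\<^sup>2" for n
      by (auto simp: H_def)
  qed auto
  have "((\<lambda>t. (\<integral>x. f (g t x) * h x \<partial>M) - (\<integral>x. E f x * h x \<partial>M)) \<longlongrightarrow> 0) at_top"
  proof (rule tendsto_zero_approx)
    fix e :: real assume "e > 0"
    define S where "S = (\<integral>x. (f x)\<^sup>2 \<partial>M)"
    have "0 \<le> S" by (simp add: S_def)
    \<comment> \<open>With this weight the part \<open>\<delta>/2 \<cdot> S\<close> of the error is at most \<open>e/4\<close>; the truncation level takes care of the rest.\<close>
    define \<delta> where "\<delta> = e / 2 / (S + 1)"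
    have "\<delta> > 0" using \<open>e > 0\<close> \<open>0 \<le> S\<close> by (simp add: \<delta>_def)
    have "eventually (\<lambda>n. (\<integral>x. (h x - H n x)\<^sup>2 \<partial>M) < \<delta> * e / 2) sequentially"
      using lim \<open>e > 0\<close> \<open>\<delta> > 0\<close> by (intro order_tendstoD) auto
    then obtain n where n: "(\<integral>x. (h x - H n x)\<^sup>2 \<partial>M) < \<delta> * e / 2"
      by (auto simp: eventually_sequentially)
    have small: "\<bar>(\<integral>x. u x * h x \<partial>M) - (\<integral>x. u x * H n x \<partial>M)\<bar> \<le> e / 2"
      if u: "square_integrable M u" and uS: "(\<integral>x. (u x)\<^sup>2 \<partial>M) \<le> S" for u
    proof -
      have "(\<integral>x. u x * h x \<partial>M) - (\<integral>x. u x * H n x \<partial>M) = (\<integral>x. u x * (h x - H n x) \<partial>M)"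
        using abs_integral_mult_le(1)[OF u h \<open>\<delta> > 0\<close>] abs_integral_mult_le(1)[OF u sqH \<open>\<delta> > 0\<close>]
        by (simp add: right_diff_distrib)
      also have "\<bar>\<dots>\<bar> \<le> \<delta> / 2 * (\<integral>x. (u x)\<^sup>2 \<partial>M) + (\<integral>x. (h x - H n x)\<^sup>2 \<partial>M) / (2 * \<delta>)"
        by (rule abs_integral_mult_le(2)[OF u sq \<open>\<delta> > 0\<close>])
      also have "\<dots> \<le> \<delta> / 2 * (S + 1) + (\<delta> * e / 2) / (2 * \<delta>)"
        using n uS \<open>\<delta> > 0\<close> by (intro add_mono mult_left_mono divide_right_mono) auto
      also have "\<dots> = e / 2"
      proof -
        have "S + 1 \<noteq> 0" using \<open>0 \<le> S\<close> by simp
        then have "\<delta> * (S + 1) = e / 2" unfolding \<delta>_def by (rule nonzero_eq_divide_eq[THEN iffD1, OF _ refl])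
        moreover have "(\<delta> * e / 2) / (2 * \<delta>) = e / 4" using \<open>\<delta> > 0\<close> by simp
        ultimately show ?thesis by simp
      qed
      finally show ?thesis .
    qed
    have "square_integrable M (\<lambda>x. f (g t x))" for t
      unfolding square_integrable_def using integrable_compose(1)[OF q] by auto
    then have 1: "\<bar>(\<integral>x. f (g t x) * h x \<partial>M) - (\<integral>x. f (g t x) * H n x \<partial>M)\<bar> \<le> e / 2" for t
      by (rule small) (use integrable_compose(2)[OF q] in \<open>simp add: S_def\<close>)
    have 2: "\<bar>(\<integral>x. E f x * h x \<partial>M) - (\<integral>x. E f x * H n x \<partial>M)\<bar> \<le> e / 2"
      using integral_cond_exp_square_le[OF f]
      by (intro small) (auto simp: S_def square_integrable_def)
    have "decorrelates (H n) f"
      by (rule bounded[OF fi, of _ "real n"]) (auto simp: H_def)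
    then have 3: "((\<lambda>t. (\<integral>x. f (g t x) * H n x \<partial>M) - (\<integral>x. E f x * H n x \<partial>M)) \<longlongrightarrow> 0) at_top"
      by (simp add: decorrelates_def LIM_zero_iff)
    have "\<bar>(\<integral>x. f (g t x) * h x \<partial>M) - (\<integral>x. E f x * h x \<partial>M)
        - ((\<integral>x. f (g t x) * H n x \<partial>M) - (\<integral>x. E f x * H n x \<partial>M))\<bar> \<le> e" for t
      using 1[of t] 2 by linarith
    with 3 show "\<exists>q. (q \<longlongrightarrow> 0) at_top \<and>
        (\<forall>t. \<bar>(\<integral>x. f (g t x) * h x \<partial>M) - (\<integral>x. E f x * h x \<partial>M) - q t\<bar> \<le> e)"
      by blast
  qed
  then show ?thesis by (simp add: decorrelates_def LIM_zero_iff)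
qed

theorem keplerian_shearI:
  assumes "is_flow g"
    and "\<And>f h C. integrable M f \<Longrightarrow> h \<in> borel_measurable M \<Longrightarrow> (\<And>x. \<bar>h x\<bar> \<le> C) \<Longrightarrow> decorrelates h f"
  shows "keplerian_shear M g"
  unfolding keplerian_shear_def
proof (intro conjI allI impI)
  fix f h assume "square_integrable M f" "square_integrable M h"
  with assms(2) have "decorrelates h f" by (rule decorrelates_square_integrable)
  then show "((\<lambda>t. \<integral>x. f (g t x) * h x \<partial>M) \<longlongrightarrow> (\<integral>x. E f x * h x \<partial>M)) at_top"
    by (simp add: decorrelates_def)
qed (use assms prob_space_axioms distr_family in auto)

end

section \<open>Charts, null sets and countable covers\<close>

lemma is_chartD:
  assumes "is_chart (U, \<phi>)"
  shows "open U" "open (\<phi> ` U)" "inj_on \<phi> U" "continuous_on U \<phi>" "continuous_on (\<phi> ` U) (inv_into U \<phi>)"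
proof -
  have h: "homeomorphism U (\<phi> ` U) \<phi> (inv_into U \<phi>)" using assms by (simp add: is_chart_def)
  show "open U" "open (\<phi> ` U)" using assms by (auto simp: is_chart_def)
  show "inj_on \<phi> U" by (rule inj_on_inverseI[where g = "inv_into U \<phi>"]) (rule homeomorphism_apply1[OF h])
  show "continuous_on U \<phi>" "continuous_on (\<phi> ` U) (inv_into U \<phi>)"
    using h by (auto simp: homeomorphism_def)
qed

lemma chart_image_eq_vimage:
  assumes "is_chart (U, \<phi>)"
  shows "\<phi> ` (U \<inter> V) = inv_into U \<phi> -` V \<inter> \<phi> ` U"
  using is_chartD(3)[OF assms] by auto

lemma open_chart_image:
  assumes c: "is_chart (U, \<phi>)" and "open V"
  shows "open (\<phi> ` (U \<inter> V))"
  unfolding chart_image_eq_vimage[OF c]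
  using continuous_on_open_vimage[OF is_chartD(2)[OF c]] is_chartD(5)[OF c] assms(2) by blast

lemma Cr_atlas_charts: "Cr_atlas r A \<Longrightarrow> c \<in> A \<Longrightarrow> c \<in> Cr_charts r A"
  by (auto simp: Cr_atlas_def Cr_charts_def)

lemma Cr_atlas_cover:
  assumes "Cr_atlas r A"
  obtains U \<phi> where "(U, \<phi>) \<in> A" "x \<in> U"
proof -
  have "x \<in> (\<Union>c\<in>A. fst c)" using assms by (simp add: Cr_atlas_def)
  then obtain c where "c \<in> A" "x \<in> fst c" by blast
  then show ?thesis using that[of "fst c" "snd c"] by simp
qed

text \<open>This is the Lindeloef property; it turns the local computation in charts into a global statement
about \<open>\<mu>\<close>.\<close>

lemma null_cover_local:
  fixes \<mu> :: "'w::second_countable_topology measure"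
  assumes "\<And>p. p \<in> A \<Longrightarrow> \<exists>W N. open W \<and> p \<in> W \<and> N \<in> null_sets \<mu> \<and> W \<inter> A \<subseteq> N"
  obtains N where "N \<in> null_sets \<mu>" "A \<subseteq> N"
proof -
  define F where "F = {W. open W \<and> (\<exists>N\<in>null_sets \<mu>. W \<inter> A \<subseteq> N)}"
  obtain F' where F': "F' \<subseteq> F" "countable F'" "\<Union>F' = \<Union>F"
    using Lindelof[of F] by (auto simp: F_def)
  have "\<forall>W\<in>F'. \<exists>N. N \<in> null_sets \<mu> \<and> W \<inter> A \<subseteq> N" using F'(1) by (auto simp: F_def)
  then obtain N where N: "\<And>W. W \<in> F' \<Longrightarrow> N W \<in> null_sets \<mu> \<and> W \<inter> A \<subseteq> N W" by metis
  show ?thesis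
  proof
    show "(\<Union>W\<in>F'. N W) \<in> null_sets \<mu>" using F'(2) N by (intro null_sets_UN') auto
    show "A \<subseteq> (\<Union>W\<in>F'. N W)"
    proof
      fix p assume p: "p \<in> A"
      then have "p \<in> \<Union>F" using assms[OF p] by (auto simp: F_def)
      then obtain W where "W \<in> F'" "p \<in> W" using F'(3) by blast
      then show "p \<in> (\<Union>W\<in>F'. N W)" using N p by blast
    qed
  qed
qed

lemma measure_eqI_countable_cover:
  assumes sets: "sets N = sets M"
    and X: "countable X" "\<Union>X = space M" "X \<subseteq> sets M"
    and eq: "\<And>B A. B \<in> X \<Longrightarrow> A \<in> sets M \<Longrightarrow> A \<subseteq> B \<Longrightarrow> emeasure N A = emeasure M A"
  shows "N = M"
proof (rule measure_eqI[OF sets])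
  fix A assume "A \<in> sets N"
  then have A: "A \<in> sets M" by (simp add: sets)
  show "emeasure N A = emeasure M A"
  proof (cases "X = {}")
    case True
    then have "A = {}" using X(2) sets.sets_into_space[OF A] by auto
    then show ?thesis by simp
  next
    case False
    define F where "F n = A \<inter> disjointed (from_nat_into X) n" for n
    have rng: "range (from_nat_into X) = X" using False X(1) by (rule range_from_nat_into)
    then have d: "disjointed (from_nat_into X) n \<in> sets M" for n
      using X(3) sets.range_disjointed_sets[of "from_nat_into X" M] by auto
    have FS: "range F \<subseteq> sets M" using d A by (auto simp: F_def)
    have disj: "disjoint_family F"
      using disjoint_family_disjointed[of "from_nat_into X"] by (auto simp: F_def disjoint_family_on_def)
    have UF: "(\<Union>n. F n) = A"
      using UN_disjointed_eq[of "from_nat_into X"] rng X(2) sets.sets_into_space[OF A] by (auto simp: F_def)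
    have "emeasure N (F n) = emeasure M (F n)" for n
    proof (rule eq)
      show "from_nat_into X n \<in> X" using rng by auto
      show "F n \<subseteq> from_nat_into X n" using disjointed_subset[of "from_nat_into X" n] by (auto simp: F_def)
    qed (use FS in auto)
    then show ?thesis
      using suminf_emeasure[OF FS disj] suminf_emeasure[of F N] FS disj by (simp add: UF sets)
  qed
qed

section \<open>Affine tori bundles\<close>

locale affine_bundle =
  fixes r :: enat
    and A\<^sub>M :: "('m::{t2_space, second_countable_topology}, real^'n) chart set"
    and A\<^sub>\<Omega> :: "('w::{t2_space, second_countable_topology}, (real^'n) \<times> (real^'d)) chart set"
    and \<pi> :: "'w \<Rightarrow> 'm"
    and \<T> :: "('m set \<times> ('w \<Rightarrow> 'm \<times> 'd torus)) set"
  assumes tori_bundle: "affine_tori_bundle r A\<^sub>M A\<^sub>\<Omega> \<pi> \<T>" and r: "1 \<le> r"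
begin

lemma atlas_M: "Cr_atlas r A\<^sub>M" and atlas_\<Omega>: "Cr_atlas r A\<^sub>\<Omega>"
  using tori_bundle by (auto simp: affine_tori_bundle_def)

lemma chart_M: "c \<in> A\<^sub>M \<Longrightarrow> is_chart c"
  and chart_\<Omega>: "e \<in> A\<^sub>\<Omega> \<Longrightarrow> is_chart e"
  using atlas_M atlas_\<Omega> by (auto simp: Cr_atlas_def)

lemma continuous_\<pi>: "continuous_on UNIV \<pi>"
  using tori_bundle by (simp add: affine_tori_bundle_def Cr_map_def)

lemma measurable_\<pi> [measurable]: "\<pi> \<in> borel_measurable borel"
  by (rule borel_measurable_continuous_onI[OF continuous_\<pi>])

lemma open_vimage_\<pi>: "open V \<Longrightarrow> open (\<pi> -` V)"
  by (rule open_vimage[OF _ continuous_\<pi>])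

lemma trivializing: "trivializing_atlas r A\<^sub>M A\<^sub>\<Omega> \<pi> \<T>"
  using tori_bundle by (simp add: affine_tori_bundle_def)

lemma triv_cover:
  obtains U \<psi> where "(U, \<psi>) \<in> \<T>" "x \<in> U"
proof -
  have "x \<in> (\<Union>c\<in>\<T>. fst c)" using trivializing by (simp add: trivializing_atlas_def)
  then obtain c where "c \<in> \<T>" "x \<in> fst c" by blast
  then show ?thesis using that[of "fst c" "snd c"] by simp
qed

context
  fixes U \<psi> assumes c: "(U, \<psi>) \<in> \<T>"
begin

abbreviation "\<psi>i \<equiv> inv_into (\<pi> -` U) \<psi>"

lemma triv: "trivialization r A\<^sub>M A\<^sub>\<Omega> \<pi> (U, \<psi>)"
  using trivializing c unfolding trivializing_atlas_def by blast

lemma open_triv: "open U"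
  using triv is_chartD(1) by (auto simp: trivialization_def Cr_charts_def)

lemma open_vimage_triv: "open (\<pi> -` U)"
  by (rule open_vimage_\<pi>[OF open_triv])

lemma bij_triv: "bij_betw \<psi> (\<pi> -` U) (U \<times> UNIV)"
  and continuous_triv: "continuous_on (\<pi> -` U) \<psi>"
  and continuous_triv_inv: "continuous_on (U \<times> UNIV) \<psi>i"
  and Cr_map_triv_inv: "Cr_map r (prod_atlas A\<^sub>M torus_atlas) (U \<times> UNIV) A\<^sub>\<Omega> \<psi>i"
  using triv by (auto simp: trivialization_def Cr_diffeo_def Cr_map_def)

lemma fst_triv: "\<pi> p \<in> U \<Longrightarrow> fst (\<psi> p) = \<pi> p"
  using triv by (auto simp: trivialization_def)

lemma triv_inv: "\<pi> p \<in> U \<Longrightarrow> \<psi>i (\<psi> p) = p"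
  using bij_triv by (simp add: bij_betw_def)

lemma triv_eq: "\<pi> p \<in> U \<Longrightarrow> \<psi> p = (\<pi> p, snd (\<psi> p))"
  using fst_triv by (metis prod.collapse)

lemma triv_triv_inv: "x \<in> U \<Longrightarrow> \<psi> (\<psi>i (x, y)) = (x, y)"
  using bij_betw_inv_into_right[OF bij_triv] by simp

lemma \<pi>_triv_inv: "x \<in> U \<Longrightarrow> \<pi> (\<psi>i (x, y)) = x"
proof -
  assume x: "x \<in> U"
  then have "\<psi>i (x, y) \<in> \<pi> -` U"
    using bij_triv by (intro inv_into_into) (simp add: bij_betw_def)
  then show ?thesis using fst_triv triv_triv_inv[OF x] by (metis fst_conv vimageE)
qed

lemma continuous_snd_triv: "continuous_on (\<pi> -` U) (\<lambda>p. snd (\<psi> p))"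
  by (intro continuous_on_snd continuous_triv)

lemma measurable_triv:
  assumes "sets \<mu> = sets borel"
  shows "\<psi> \<in> measurable (restrict_space \<mu> (\<pi> -` U)) (restrict_space borel U \<Otimes>\<^sub>M borel)"
proof -
  have s: "sets (restrict_space \<mu> (\<pi> -` U)) = sets (restrict_space borel (\<pi> -` U))"
    by (rule sets_restrict_space_cong[OF assms])
  have sp: "space (restrict_space borel (\<pi> -` U)) = \<pi> -` U"
    by (simp add: space_restrict_space)
  have "(\<lambda>p. (\<pi> p, snd (\<psi> p))) \<in> measurable (restrict_space borel (\<pi> -` U)) (restrict_space borel U \<Otimes>\<^sub>M borel)"
    by (intro measurable_Pair measurable_restrict_space2 measurable_restrict_space1
        borel_measurable_continuous_on_restrict continuous_snd_triv)
      (auto simp: sp)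
  then have "\<psi> \<in> measurable (restrict_space borel (\<pi> -` U)) (restrict_space borel U \<Otimes>\<^sub>M borel)"
    by (rule measurable_cong[THEN iffD1, rotated]) (simp add: sp triv_eq[symmetric])
  then show ?thesis by (simp cong: measurable_cong_sets add: measurable_cong_sets[OF s refl])
qed

lemma measurable_triv_inv: "\<psi>i \<in> borel_measurable (restrict_space borel U \<Otimes>\<^sub>M borel)"
proof -
  have "(\<lambda>p. (fst p, snd p)) \<in> measurable (restrict_space borel U \<Otimes>\<^sub>M borel) (borel \<Otimes>\<^sub>M (borel :: 'd torus measure))"
    by (intro measurable_Pair measurable_compose[OF measurable_fst measurable_restrict_space1] measurable_snd)
      auto
  then have "(\<lambda>p. p) \<in> measurable (restrict_space borel U \<Otimes>\<^sub>M borel) (restrict_space (borel :: ('m \<times> 'd torus) measure) (U \<times> UNIV))"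
    by (intro measurable_restrict_space2) (auto simp: borel_prod space_pair_measure space_restrict_space)
  from measurable_comp[OF this borel_measurable_continuous_on_restrict[OF continuous_triv_inv]]
  show ?thesis by (simp add: comp_def)
qed

end

subsection \<open>Compatible flows\<close>

context
  fixes g assumes g: "g \<in> compatible_flows r A\<^sub>M \<pi> \<T>"
begin

lemma flow: "is_flow g"
  using g by (simp add: compatible_flows_def)

lemma generates_ex: "c \<in> \<T> \<Longrightarrow> \<exists>v. generates r A\<^sub>M \<pi> g c v"
  using g by (simp add: compatible_flows_def)

end

context
  fixes U \<psi> g v assumes c: "(U, \<psi>) \<in> \<T>" and gen: "generates r A\<^sub>M \<pi> g (U, \<psi>) v"
begin

lemma continuous_generates: "continuous_on U v"
  using gen by (simp add: generates_def Cr_map_def)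

lemma flow_in_triv: "\<pi> p \<in> U \<Longrightarrow> \<pi> (g t p) \<in> U"
  using gen by (auto simp: generates_def)

lemma triv_flow:
  assumes "\<pi> p \<in> U"
  shows "\<psi> (g t p) = (\<pi> p, snd (\<psi> p) + torus_of (t *\<^sub>R v (\<pi> p)))"
proof -
  have "\<psi> (g t (inv_into (\<pi> -` U) \<psi> (\<pi> p, snd (\<psi> p)))) = (\<pi> p, snd (\<psi> p) + torus_of (t *\<^sub>R v (\<pi> p)))"
    using gen assms by (simp add: generates_def)
  then show ?thesis by (simp add: triv_eq[OF c assms, symmetric] triv_inv[OF c assms])
qed

lemma \<pi>_flow_local: "\<pi> p \<in> U \<Longrightarrow> \<pi> (g t p) = \<pi> p"
  using fst_triv[OF c flow_in_triv] triv_flow by (metis fst_conv)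

lemma flow_eq:
  assumes "\<pi> p \<in> U"
  shows "g t p = inv_into (\<pi> -` U) \<psi> (\<pi> p, snd (\<psi> p) + torus_of (t *\<^sub>R v (\<pi> p)))"
  using triv_inv[OF c flow_in_triv[OF assms]] triv_flow[OF assms] by metis

lemma continuous_flow_local: "continuous_on (\<pi> -` U) (g t)"
proof -
  have "continuous_on (\<pi> -` U) (\<lambda>p. inv_into (\<pi> -` U) \<psi> (\<pi> p, snd (\<psi> p) + torus_of (t *\<^sub>R v (\<pi> p))))"
  proof (rule continuous_on_compose2[OF continuous_triv_inv[OF c]])
    have "continuous_on (\<pi> -` U) (\<lambda>p. v (\<pi> p))"
      by (rule continuous_on_compose2[OF continuous_generates continuous_on_subset[OF continuous_\<pi>]]) auto
    then have "continuous_on (\<pi> -` U) (\<lambda>p. torus_of (t *\<^sub>R v (\<pi> p)))"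
      by (intro continuous_on_compose2[OF continuous_torus_of] continuous_intros) auto
    then show "continuous_on (\<pi> -` U) (\<lambda>p. (\<pi> p, snd (\<psi> p) + torus_of (t *\<^sub>R v (\<pi> p))))"
      by (intro continuous_on_Pair continuous_on_add continuous_snd_triv[OF c]
          continuous_on_subset[OF continuous_\<pi>]) auto
  qed auto
  then show ?thesis by (rule continuous_on_cong[THEN iffD1, rotated 2]) (auto simp: flow_eq)
qed

end

context
  fixes g assumes g: "g \<in> compatible_flows r A\<^sub>M \<pi> \<T>"
begin

lemma \<pi>_flow: "\<pi> (g t p) = \<pi> p"
proof -
  obtain U \<psi> where c: "(U, \<psi>) \<in> \<T>" "\<pi> p \<in> U" by (rule triv_cover)
  then show ?thesis using generates_ex[OF g c(1)] \<pi>_flow_local by blast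
qed

lemma continuous_flow: "continuous_on UNIV (g t)"
proof (rule continuous_at_imp_continuous_on, rule ballI)
  fix p
  obtain U \<psi> where c: "(U, \<psi>) \<in> \<T>" "\<pi> p \<in> U" by (rule triv_cover)
  obtain v where "generates r A\<^sub>M \<pi> g (U, \<psi>) v" using generates_ex[OF g c(1)] by blast
  then show "isCont (g t) p"
    using continuous_flow_local[OF c(1)] open_vimage_triv[OF c(1)] c(2)
    by (auto simp: continuous_on_eq_continuous_at)
qed

lemma measurable_flow: "g t \<in> borel_measurable borel"
  by (rule borel_measurable_continuous_onI[OF continuous_flow])

text \<open>In a trivializing chart the measure is a product, and the flow translates each fibre. Translation
invariance of Lebesgue measure on the torus shows that the measure is preserved over each chart
domain, and countably many of these cover the bundle.\<close>

lemma compatible_measure_invariant: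
  assumes \<mu>: "compatible_measure \<pi> \<T> \<mu>"
  shows "distr \<mu> \<mu> (g t) = \<mu>"
proof -
  have s: "sets \<mu> = sets borel" using \<mu> by (simp add: compatible_measure_def)
  then have sp: "space \<mu> = UNIV" using sets_eq_imp_space_eq by force
  have [measurable]: "g t \<in> measurable \<mu> \<mu>"
    using measurable_flow by (simp add: measurable_cong_sets[OF s s])
  obtain X where X: "X \<subseteq> fst ` \<T>" "countable X" "\<Union>X = \<Union>(fst ` \<T>)"
    using Lindelof[of "fst ` \<T>"] open_triv by force
  have UX: "\<Union>X = UNIV" using trivializing X(3) by (auto simp: trivializing_atlas_def)
  show ?thesis
  proof (rule measure_eqI_countable_cover[where X = "(\<lambda>U. \<pi> -` U) ` X"])
    show "\<Union>((\<lambda>U. \<pi> -` U) ` X) = space \<mu>" using UX by (auto simp: sp)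
    show "(\<lambda>U. \<pi> -` U) ` X \<subseteq> sets \<mu>" using X(1) open_vimage_triv by (force simp: s)
    show "countable ((\<lambda>U. \<pi> -` U) ` X)" using X(2) by simp
    fix B A assume "B \<in> (\<lambda>U. \<pi> -` U) ` X" and A: "A \<in> sets \<mu>" "A \<subseteq> B"
    then obtain U \<psi> where c: "(U, \<psi>) \<in> \<T>" and AU: "A \<subseteq> \<pi> -` U" using X(1) by force
    obtain v where v: "generates r A\<^sub>M \<pi> g (U, \<psi>) v" using generates_ex[OF g c] by blast
    let ?P = "restrict_space borel U \<Otimes>\<^sub>M (borel :: 'd torus measure)"
    let ?N = "restrict_space (distr \<mu> borel \<pi>) U"
    let ?i = "inv_into (\<pi> -` U) \<psi>"
    have D: "distr (restrict_space \<mu> (\<pi> -` U)) ?P \<psi> = ?N \<Otimes>\<^sub>M torus_lebesgue"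
      using \<mu> c by (auto simp: compatible_measure_def)
    have spP: "space ?P = U \<times> UNIV" by (simp add: space_pair_measure space_restrict_space)
    have sP: "sets ?P = sets (?N \<Otimes>\<^sub>M torus_lebesgue)"
      by (intro sets_pair_measure_cong sets_restrict_space_cong) auto
    have B: "\<pi> -` U \<in> sets \<mu>" using open_vimage_triv[OF c] by (simp add: s)
    have meas: "emeasure \<mu> Y = emeasure (?N \<Otimes>\<^sub>M torus_lebesgue) (?i -` Y \<inter> space ?P)"
      and setsY: "?i -` Y \<inter> space ?P \<in> sets (?N \<Otimes>\<^sub>M torus_lebesgue)"
      if Y: "Y \<in> sets \<mu>" "Y \<subseteq> \<pi> -` U" for Y
    proof -
      have S: "?i -` Y \<inter> space ?P \<in> sets ?P"
        using measurable_sets[OF measurable_triv_inv[OF c]] Y by (simp add: s)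
      then show "?i -` Y \<inter> space ?P \<in> sets (?N \<Otimes>\<^sub>M torus_lebesgue)" by (simp only: sP)
      have "\<psi> -` (?i -` Y \<inter> space ?P) \<inter> space (restrict_space \<mu> (\<pi> -` U)) = Y"
      proof (intro set_eqI iffI)
        fix p assume "p \<in> \<psi> -` (?i -` Y \<inter> space ?P) \<inter> space (restrict_space \<mu> (\<pi> -` U))"
        then have "\<pi> p \<in> U" "?i (\<psi> p) \<in> Y" by (simp_all add: space_restrict_space sp)
        then show "p \<in> Y" by (simp add: triv_inv[OF c])
      next
        fix p assume p: "p \<in> Y"
        then have "\<pi> p \<in> U" using Y by auto
        then show "p \<in> \<psi> -` (?i -` Y \<inter> space ?P) \<inter> space (restrict_space \<mu> (\<pi> -` U))"
          using p bij_betwE[OF bij_triv[OF c], rule_format, of p]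
          by (simp add: spP space_restrict_space sp triv_inv[OF c])
      qed
      then have "emeasure (?N \<Otimes>\<^sub>M torus_lebesgue) (?i -` Y \<inter> space ?P) = emeasure (restrict_space \<mu> (\<pi> -` U)) Y"
        unfolding D[symmetric] using S measurable_triv[OF c s] by (simp add: emeasure_distr)
      also have "\<dots> = emeasure \<mu> Y"
        using Y B by (intro emeasure_restrict_space) (auto simp: sp)
      finally show "emeasure \<mu> Y = emeasure (?N \<Otimes>\<^sub>M torus_lebesgue) (?i -` Y \<inter> space ?P)" by simp
    qed
    interpret L: finite_measure "torus_lebesgue :: 'd torus measure" by (rule finite_measure_torus_lebesgue)
    define A' where "A' = g t -` A \<inter> space \<mu>"
    have A': "A' \<in> sets \<mu>" "A' \<subseteq> \<pi> -` U"
      using A AU measurable_sets[of "g t" \<mu> \<mu> A] by (auto simp: A'_def \<pi>_flow subset_iff)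
    have "emeasure (distr \<mu> \<mu> (g t)) A = emeasure \<mu> A'"
      using A by (simp add: emeasure_distr A'_def)
    also have "\<dots> = (\<integral>\<^sup>+x. emeasure torus_lebesgue (Pair x -` (?i -` A' \<inter> space ?P)) \<partial>?N)"
      using meas[OF A'] L.emeasure_pair_measure_alt[OF setsY[OF A']] by simp
    also have "\<dots> = (\<integral>\<^sup>+x. emeasure torus_lebesgue (Pair x -` (?i -` A \<inter> space ?P)) \<partial>?N)"
    proof (rule nn_integral_cong)
      fix x assume "x \<in> space ?N"
      then have x: "x \<in> U" by (simp add: space_restrict_space)
      have "g t (?i (x, y)) = ?i (x, y + torus_of (t *\<^sub>R v x))" for y
        using flow_eq[OF c v, of "?i (x, y)"] by (simp add: \<pi>_triv_inv[OF c x] triv_triv_inv[OF c x] x)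
      then have "Pair x -` (?i -` A' \<inter> space ?P)
          = {y. y + torus_of (t *\<^sub>R v x) \<in> Pair x -` (?i -` A \<inter> space ?P)}"
        using x by (auto simp: A'_def spP sp)
      moreover have "Pair x -` (?i -` A \<inter> space ?P) \<in> sets borel"
        using sets_Pair1[OF setsY[OF A(1) AU]] by (simp only: sets_torus_lebesgue)
      ultimately show "emeasure torus_lebesgue (Pair x -` (?i -` A' \<inter> space ?P))
          = emeasure torus_lebesgue (Pair x -` (?i -` A \<inter> space ?P))"
        by (simp only: emeasure_torus_lebesgue_translate)
    qed
    also have "\<dots> = emeasure \<mu> A"
      using meas[OF A(1) AU] L.emeasure_pair_measure_alt[OF setsY[OF A(1) AU]] by simp
    finally show "emeasure (distr \<mu> \<mu> (g t)) A = emeasure \<mu> A" .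
  qed simp
qed

end

subsection \<open>Null sets of absolutely continuous measures\<close>

lemma inj_on_map_prod: "inj_on f A \<Longrightarrow> inj_on h B \<Longrightarrow> inj_on (map_prod f h) (A \<times> B)"
  by (auto simp: inj_on_def)

text \<open>Absolute continuity is formulated in charts of the total space, so the null set \<open>Z\<close> of the base has
to be transported: a change of charts on the base and the inverse of a trivialization are
differentiable, hence map negligible sets to negligible sets, and in between \<open>Z\<close> is
multiplied by a Euclidean factor for the fibre.\<close>

lemma negligible_chart_imp_null:
  assumes c: "(U, \<psi>) \<in> \<T>" and \<phi>: "(U, \<phi>) \<in> Cr_charts r A\<^sub>M" and Z: "negligible Z"
    and s: "sets \<mu> = sets borel" and ac: "abs_cont_in_charts r A\<^sub>\<Omega> \<mu>"
  obtains N where "N \<in> null_sets \<mu>" "{p. \<pi> p \<in> U \<and> \<phi> (\<pi> p) \<in> Z} \<subseteq> N"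
proof (rule null_cover_local[of "{p. \<pi> p \<in> U \<and> \<phi> (\<pi> p) \<in> Z}" \<mu>])
  fix p assume "p \<in> {p. \<pi> p \<in> U \<and> \<phi> (\<pi> p) \<in> Z}"
  then have p: "\<pi> p \<in> U" by simp
  have sp: "space \<mu> = UNIV" using sets_eq_imp_space_eq[OF s] by simp
  obtain V \<zeta> where V: "(V, \<zeta>) \<in> A\<^sub>\<Omega>" "p \<in> V" by (rule Cr_atlas_cover[OF atlas_\<Omega>])
  obtain V' \<xi> where V': "(V', \<xi>) \<in> A\<^sub>M" "\<pi> p \<in> V'" by (rule Cr_atlas_cover[OF atlas_M])
  \<comment> \<open>An open cube of side \<open>1\<close> contains no two points that differ by a nonzero integer vector.\<close>
  obtain B :: "(real^'d) set" where B: "open B" "inj_on torus_of B" "snd (\<psi> p) \<in> torus_of ` B"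
  proof
    let ?x = "rep_torus (snd (\<psi> p))"
    let ?B = "{y :: real^'d. \<forall>i. y $ i \<in> {?x $ i - 1/2 <..< ?x $ i + 1/2}}"
    have "?B = box (?x - (\<chi> i. 1/2)) (?x + (\<chi> i. 1/2))" by (auto simp: mem_box_cart)
    then show "open ?B" by (simp only: open_box)
    show "inj_on torus_of ?B"
    proof (rule inj_onI)
      fix y z assume yz: "y \<in> ?B" "z \<in> ?B" "torus_of y = torus_of z"
      show "y = z"
      proof (subst vec_eq_iff, intro allI)
        fix i
        have "y $ i - z $ i \<in> \<int>" using yz(3) by (simp add: torus_of_eq_iff int_vec_def)
        then obtain k where k: "y $ i - z $ i = of_int k" by (auto elim: Ints_cases)
        have "y $ i \<in> {?x $ i - 1/2 <..< ?x $ i + 1/2}" "z $ i \<in> {?x $ i - 1/2 <..< ?x $ i + 1/2}"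
          using yz by blast+
        then have "\<bar>real_of_int k\<bar> < 1" unfolding k[symmetric] by auto
        then have "k = 0" by linarith
        then show "y $ i = z $ i" using k by simp
      qed
    qed
    show "snd (\<psi> p) \<in> torus_of ` ?B" by (rule image_eqI[of _ _ ?x]) auto
  qed
  define X where "X = map_prod \<xi> (inv_into B torus_of)"
  let ?Q = "V' \<times> torus_of ` B" and ?i = "inv_into (\<pi> -` U) \<psi>"
  have "(?Q, X) \<in> prod_atlas A\<^sub>M torus_atlas"
    unfolding prod_atlas_def torus_atlas_def X_def using V' B by blast
  then have H: "Cr_on r (X ` (U \<times> UNIV \<inter> ?Q \<inter> ?i -` V)) (\<zeta> \<circ> ?i \<circ> inv_into ?Q X)"
    using Cr_map_triv_inv[OF c] V(1) unfolding Cr_map_def by blast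
  have injX: "inj_on X ?Q"
    unfolding X_def by (intro inj_on_map_prod is_chartD(3)[OF chart_M] V' inj_on_inv_into subset_refl)
  \<comment> \<open>The null set \<open>Z\<close> in the coordinates of the chart \<open>\<xi>\<close>, which belongs to the product charts.\<close>
  define Z' where "Z' = (\<xi> \<circ> inv_into U \<phi>) ` (Z \<inter> \<phi> ` (U \<inter> V'))"
  have "negligible Z'"
    unfolding Z'_def
  proof (rule negligible_differentiable_image_negligible[OF order_refl])
    show "negligible (Z \<inter> \<phi> ` (U \<inter> V'))" by (rule negligible_subset[OF Z]) auto
    have "Cr_related r (U, \<phi>) (V', \<xi>)" using \<phi> V' by (auto simp: Cr_charts_def)
    then have "Cr_on r (\<phi> ` (U \<inter> V')) (\<xi> \<circ> inv_into U \<phi>)" by (simp add: Cr_related_def)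
    then show "(\<xi> \<circ> inv_into U \<phi>) differentiable_on Z \<inter> \<phi> ` (U \<inter> V')"
      by (rule Cr_on_differentiable_on[OF _ r]) auto
  qed
  then have nZ: "negligible (Z' \<times> (UNIV :: (real^'d) set))" by (rule negligible_Times_UNIV)
  define W where "W = V \<inter> \<pi> -` (U \<inter> V') \<inter> ((\<lambda>q. snd (\<psi> q)) -` (torus_of ` B) \<inter> \<pi> -` U)"
  have "open ((\<lambda>q. snd (\<psi> q)) -` (torus_of ` B) \<inter> \<pi> -` U)"
    using continuous_on_open_vimage[OF open_vimage_triv[OF c]] continuous_snd_triv[OF c]
      open_torus_of_image[OF B(1)] by blast
  moreover have "open (V \<inter> \<pi> -` (U \<inter> V'))"
    using is_chartD(1)[OF chart_M[OF V'(1)]] is_chartD(1)[OF chart_\<Omega>[OF V(1)]]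
    by (intro open_Int open_vimage_\<pi> open_triv[OF c])
  ultimately have "open W" unfolding W_def by (rule open_Int[rotated])
  have "p \<in> W" using p V V' B by (simp add: W_def)
  let ?Y = "X ` (U \<times> UNIV \<inter> ?Q \<inter> ?i -` V) \<inter> Z' \<times> UNIV"
  have "negligible ((\<zeta> \<circ> ?i \<circ> inv_into ?Q X) ` ?Y)"
  proof (rule negligible_differentiable_image_negligible[OF order_refl])
    show "negligible ?Y" by (rule negligible_subset[OF nZ]) auto
    show "(\<zeta> \<circ> ?i \<circ> inv_into ?Q X) differentiable_on ?Y"
      by (rule Cr_on_differentiable_on[OF H r]) auto
  qed
  then obtain N0 where N0: "N0 \<in> null_sets lborel" "(\<zeta> \<circ> ?i \<circ> inv_into ?Q X) ` ?Y \<subseteq> N0"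
    by (rule negligible_Borel_cover)
  have "absolutely_continuous lborel (distr (restrict_space \<mu> V) borel \<zeta>)"
    using ac Cr_atlas_charts[OF atlas_\<Omega> V(1)] by (auto simp: abs_cont_in_charts_def)
  then have n: "N0 \<in> null_sets (distr (restrict_space \<mu> V) borel \<zeta>)"
    using N0(1) by (auto simp: absolutely_continuous_def)
  have V_sets: "V \<in> sets \<mu>" using is_chartD(1)[OF chart_\<Omega>[OF V(1)]] by (simp add: s)
  have "\<zeta> \<in> borel_measurable (restrict_space borel V)"
    by (rule borel_measurable_continuous_on_restrict[OF is_chartD(4)[OF chart_\<Omega>[OF V(1)]]])
  then have m: "\<zeta> \<in> borel_measurable (restrict_space \<mu> V)"
    by (simp add: measurable_cong_sets[OF sets_restrict_space_cong[OF s] refl])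
  have "N0 \<in> sets borel" using N0(1) by auto
  from measurable_sets[OF m this] have "\<zeta> -` N0 \<inter> V \<in> sets (restrict_space \<mu> V)"
    by (simp add: space_restrict_space sp)
  then have "\<zeta> -` N0 \<inter> V \<in> sets \<mu>" using V_sets sets_restrict_space_iff[of V \<mu>] by (simp add: sp)
  moreover have "emeasure \<mu> (\<zeta> -` N0 \<inter> V) = 0"
    using n m \<open>N0 \<in> sets borel\<close> V_sets
    by (simp add: null_sets_def emeasure_distr space_restrict_space sp emeasure_restrict_space)
  ultimately have "\<zeta> -` N0 \<inter> V \<in> null_sets \<mu>" by (simp add: null_sets_def)
  moreover have "W \<inter> {p. \<pi> p \<in> U \<and> \<phi> (\<pi> p) \<in> Z} \<subseteq> \<zeta> -` N0 \<inter> V"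
  proof
    fix q assume q: "q \<in> W \<inter> {p. \<pi> p \<in> U \<and> \<phi> (\<pi> p) \<in> Z}"
    then have qU: "\<pi> q \<in> U" "\<phi> (\<pi> q) \<in> Z" "q \<in> V" "\<pi> q \<in> V'" "snd (\<psi> q) \<in> torus_of ` B"
      by (auto simp: W_def)
    have \<psi>q: "\<psi> q \<in> U \<times> UNIV \<inter> ?Q \<inter> ?i -` V"
      using qU triv_eq[OF c qU(1)] triv_inv[OF c qU(1)] by (auto simp: mem_Times_iff fst_triv[OF c])
    have "inv_into U \<phi> (\<phi> (\<pi> q)) = \<pi> q"
      using \<phi> qU(1) by (intro inv_into_f_f is_chartD(3)) (simp_all add: Cr_charts_def)
    then have "\<xi> (\<pi> q) \<in> Z'"
      using qU by (auto simp: Z'_def intro!: image_eqI[of _ _ "\<phi> (\<pi> q)"])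
    then have "X (\<psi> q) \<in> ?Y"
      using \<psi>q fst_triv[OF c qU(1)] by (auto simp: X_def mem_Times_iff)
    moreover have "(\<zeta> \<circ> ?i \<circ> inv_into ?Q X) (X (\<psi> q)) = \<zeta> q"
      using \<psi>q triv_inv[OF c qU(1)] injX by simp
    ultimately have "\<zeta> q \<in> (\<zeta> \<circ> ?i \<circ> inv_into ?Q X) ` ?Y" by (rule rev_image_eqI[OF _ sym])
    then show "q \<in> \<zeta> -` N0 \<inter> V" using N0(2) qU by auto
  qed
  ultimately show "\<exists>W N. open W \<and> p \<in> W \<and> N \<in> null_sets \<mu> \<and> W \<inter> {p. \<pi> p \<in> U \<and> \<phi> (\<pi> p) \<in> Z} \<subseteq> N"
    using \<open>open W\<close> \<open>p \<in> W\<close> by blast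
qed (use that in blast)

end

section \<open>Decorrelation over a chart\<close>

text \<open>Closed sets are the ones to approximate by continuous functions in the fibre, whereas on the base
any Borel set will do.\<close>

lemma sigma_sets_borel_times_closed:
  "sets (borel :: ('a::second_countable_topology \<times> 'b::second_countable_topology) measure)
    = sigma_sets UNIV {C \<times> D | C D. C \<in> sets borel \<and> closed D}" (is "_ = sigma_sets UNIV ?G")
proof
  have "C \<times> D \<in> sets (borel :: ('a \<times> 'b) measure)" if "C \<in> sets borel" "closed D" for C D
    using that by (simp add: borel_prod[symmetric] pair_measureI borel_closed)
  then show "sigma_sets UNIV ?G \<subseteq> sets (borel :: ('a \<times> 'b) measure)"
    by (intro sets.sigma_sets_subset[of _ borel, simplified]) auto
  interpret S: sigma_algebra UNIV "sigma_sets UNIV ?G" by (rule sigma_algebra_sigma_sets) simp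
  have "C \<times> D \<in> sigma_sets UNIV ?G" if C: "C \<in> sets borel" and D: "D \<in> sets borel"
    for C :: "'a set" and D :: "'b set"
  proof -
    have "D \<in> sigma_sets UNIV {D. closed D}" using D by (simp add: borel_eq_closed)
    then show ?thesis
    proof (induction rule: sigma_sets.induct)
      case (Basic D)
      then show ?case using C by (intro sigma_sets.Basic) auto
    next
      case (Compl D)
      have "C \<times> UNIV \<in> sigma_sets UNIV ?G" using C by (intro sigma_sets.Basic) auto
      then have "C \<times> UNIV - C \<times> D \<in> sigma_sets UNIV ?G" using Compl by blast
      also have "C \<times> UNIV - C \<times> D = C \<times> (UNIV - D)" by auto
      finally show ?case .
    next
      case (Union D)
      then have "(\<Union>i. C \<times> D i) \<in> sigma_sets UNIV ?G" by blast
      also have "(\<Union>i. C \<times> D i) = C \<times> (\<Union>i. D i)" by auto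
      finally show ?case .
    qed (simp add: sigma_sets.Empty)
  qed
  then show "sets (borel :: ('a \<times> 'b) measure) \<subseteq> sigma_sets UNIV ?G"
    unfolding borel_prod[symmetric] sets_pair_measure space_borel UNIV_Times_UNIV
    by (intro S.sigma_sets_subset) auto
qed

locale bundle_flow = affine_bundle r A\<^sub>M A\<^sub>\<Omega> \<pi> \<T>
  for r :: enat
    and A\<^sub>M :: "('m::{t2_space, second_countable_topology}, real^'n) chart set"
    and A\<^sub>\<Omega> :: "('w::{t2_space, second_countable_topology}, (real^'n) \<times> (real^'d)) chart set"
    and \<pi> :: "'w \<Rightarrow> 'm"
    and \<T> :: "('m set \<times> ('w \<Rightarrow> 'm \<times> 'd torus)) set" +
  fixes g :: "real \<Rightarrow> 'w \<Rightarrow> 'w" and \<mu> :: "'w measure"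
  assumes g: "g \<in> compatible_flows r A\<^sub>M \<pi> \<T>"
    and prob: "prob_space \<mu>" and \<mu>: "compatible_measure \<pi> \<T> \<mu>"
begin

lemma sets_\<mu> [measurable_cong, simp]: "sets \<mu> = sets borel"
  using \<mu> by (simp add: compatible_measure_def)

lemma space_\<mu> [simp]: "space \<mu> = UNIV"
  using sets_eq_imp_space_eq[OF sets_\<mu>] by simp

sublocale measure_preserving_family \<mu> g
proof -
  interpret prob_space \<mu> by (rule prob)
  show "measure_preserving_family \<mu> g"
  proof
    show "g t \<in> measurable \<mu> \<mu>" for t
      using measurable_flow[OF g] by (simp add: measurable_cong_sets[OF sets_\<mu> sets_\<mu>])
    show "distr \<mu> \<mu> (g t) = \<mu>" for t by (rule compatible_measure_invariant[OF g \<mu>])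
  qed
qed

text \<open>The flow moves points only within the fibres, so functions of the base point are invariant.\<close>

lemma decorrelates_base_function:
  fixes L :: "'m set"
  assumes L: "L \<in> sets borel" and h: "h \<in> borel_measurable \<mu>"
  shows "decorrelates h (\<lambda>p. a * indicator L (\<pi> p))"
proof (rule decorrelates_invariant)
  have [measurable]: "\<pi> \<in> borel_measurable \<mu>"
    using measurable_\<pi> by (simp add: measurable_cong_sets[OF sets_\<mu> refl])
  have P: "\<pi> -` L \<in> sets borel" using measurable_sets[OF measurable_\<pi> L] by simp
  have "\<pi> -` L \<in> sets J"
    unfolding sets_J using P by (simp add: \<pi>_flow[OF g] vimage_def)
  then have "(indicator (\<pi> -` L) :: 'w \<Rightarrow> real) \<in> borel_measurable J"
    by (rule borel_measurable_indicator)
  then have "(\<lambda>p. a * indicator (\<pi> -` L) p) \<in> borel_measurable J" by simp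
  also have "(\<lambda>p. a * indicator (\<pi> -` L) p) = (\<lambda>p. a * indicator L (\<pi> p) :: real)"
    by (auto simp: indicator_def)
  finally show "(\<lambda>p. a * indicator L (\<pi> p)) \<in> borel_measurable J" .
  show "integrable \<mu> (\<lambda>p. a * indicator L (\<pi> p))"
    using L by (intro integrable_const_bound[where B = "\<bar>a\<bar>"]) (auto simp: indicator_def)
qed (use h in \<open>auto simp: \<pi>_flow[OF g]\<close>)

context
  fixes U \<psi> v K
  assumes c: "(U, \<psi>) \<in> \<T>" and v: "generates r A\<^sub>M \<pi> g (U, \<psi>) v" and K: "K \<subseteq> U"
    and nonres: "\<And>\<xi> N. \<xi> \<in> int_vec \<Longrightarrow> \<xi> \<noteq> 0 \<Longrightarrow> N \<in> null_sets lborel \<Longrightarrow>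
      AE p in \<mu>. \<pi> p \<in> K \<longrightarrow> \<xi> \<bullet> v (\<pi> p) \<notin> N"
begin

lemma measurable_over_chart:
  fixes q :: "'w \<Rightarrow> real"
  assumes L: "L \<in> sets borel" "L \<subseteq> U" and q: "q \<in> borel_measurable (restrict_space borel (\<pi> -` U))"
  shows "(\<lambda>p. indicator L (\<pi> p) * q p) \<in> borel_measurable \<mu>"
proof -
  have "(\<lambda>p. indicator (\<pi> -` U) p *\<^sub>R q p) \<in> borel_measurable borel"
    using q open_vimage_triv[OF c] by (subst (asm) borel_measurable_restrict_space_iff) auto
  then have "(\<lambda>p. indicator L (\<pi> p) * (indicator (\<pi> -` U) p *\<^sub>R q p)) \<in> borel_measurable borel"
    using L by measurable
  also have "(\<lambda>p. indicator L (\<pi> p) * (indicator (\<pi> -` U) p *\<^sub>R q p)) = (\<lambda>p. indicator L (\<pi> p) * q p)"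
    using L by (auto simp: indicator_def fun_eq_iff subset_iff)
  finally show ?thesis by (simp add: measurable_cong_sets[OF sets_\<mu> refl])
qed

lemma measurable_torus_over_chart:
  fixes q :: "'d torus \<Rightarrow> real"
  assumes L: "L \<in> sets borel" "L \<subseteq> U" and q: "q \<in> borel_measurable borel"
  shows "(\<lambda>p. indicator L (\<pi> p) * q (snd (\<psi> p))) \<in> borel_measurable \<mu>"
  by (rule measurable_over_chart[OF L])
    (rule measurable_compose[OF borel_measurable_continuous_on_restrict[OF continuous_snd_triv[OF c]] q])

text \<open>The flow adds \<open>2\<pi> t \<xi>\<bullet>v\<close> to the phase of the character. Splitting off this term by the addition
formula leaves two oscillatory integrals, to which the Riemann--Lebesgue lemma applies because the
resonant sets \<open>{\<xi>\<bullet>v \<in> N}\<close> are null over \<open>K\<close>.\<close>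

lemma decorrelates_character:
  assumes L: "L \<in> sets borel" "L \<subseteq> K" and \<xi>: "\<xi> \<in> int_vec" "\<xi> \<noteq> 0"
    and h: "h \<in> borel_measurable \<mu>" "\<And>x. \<bar>h x\<bar> \<le> C"
  shows "decorrelates h (\<lambda>p. indicator L (\<pi> p) * (a * torus_cos \<xi> e (snd (\<psi> p))))"
proof -
  have LU: "L \<subseteq> U" using L K by simp
  have cos_m: "torus_cos \<xi> e' \<in> borel_measurable borel" for e'
    using trig_poly_measurable[OF trig_poly.cos[OF \<xi>(1), of 1 e']] by simp
  have m: "(\<lambda>p. indicator L (\<pi> p) * (a * torus_cos \<xi> e' (snd (\<psi> p)))) \<in> borel_measurable \<mu>" for e'
    by (rule measurable_torus_over_chart[OF L(1) LU]) (use cos_m in measurable)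
  have bd: "\<bar>indicator L (\<pi> p) * (a * torus_cos \<xi> e' (snd (\<psi> p)))\<bar> \<le> \<bar>a\<bar>" for e' p
    by (auto simp: indicator_def torus_cos_def abs_mult mult_left_le)
  have i: "integrable \<mu> (\<lambda>p. indicator L (\<pi> p) * (a * torus_cos \<xi> e' (snd (\<psi> p))))" for e'
    using m bd by (intro integrable_const_bound[where B = "\<bar>a\<bar>"]) auto
  \<comment> \<open>Cut off outside \<open>L\<close>, since \<open>v\<close> is unspecified outside \<open>U\<close>.\<close>
  define \<theta> where "\<theta> p = indicator L (\<pi> p) * (\<xi> \<bullet> v (\<pi> p))" for p
  have "continuous_on (\<pi> -` U) (\<lambda>p. \<xi> \<bullet> v (\<pi> p))"
    by (intro continuous_intros continuous_on_compose2[OF continuous_generates[OF c v]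
        continuous_on_subset[OF continuous_\<pi>]]) auto
  then have \<theta>m: "\<theta> \<in> borel_measurable \<mu>"
    unfolding \<theta>_def by (intro measurable_over_chart[OF L(1) LU] borel_measurable_continuous_on_restrict)
  show ?thesis
  proof (rule decorrelates_to_zeroI[OF i])
    fix k :: "'w \<Rightarrow> real" and C' assume k: "k \<in> borel_measurable \<mu>" "\<And>x. \<bar>k x\<bar> \<le> C'"
    define b where "b e' p = indicator L (\<pi> p) * (a * torus_cos \<xi> e' (snd (\<psi> p))) * k p" for e' p
    have bi: "integrable \<mu> (b e')" for e'
      unfolding b_def by (rule integrable_mult_bounded[OF i k])
    have RL: "((\<lambda>t. \<integral>p. b e' p * cos (t * \<theta> p + e'') \<partial>\<mu>) \<longlongrightarrow> 0) at_top" for e' e''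
    proof (rule Riemann_Lebesgue_absolutely_continuous[OF bi \<theta>m])
      fix N :: "real set" assume "N \<in> null_sets lborel"
      from nonres[OF \<xi> this] show "AE p in \<mu>. \<theta> p \<in> N \<longrightarrow> b e' p = 0"
        by eventually_elim (use L in \<open>auto simp: \<theta>_def b_def indicator_def\<close>)
    qed
    have lim: "filterlim (\<lambda>t::real. 2 * pi * t) at_top at_top"
      by (rule filterlim_tendsto_pos_mult_at_top[OF tendsto_const _ filterlim_ident]) simp
    have RL': "((\<lambda>t. \<integral>p. b e' p * cos (2 * pi * t * \<theta> p + e'') \<partial>\<mu>) \<longlongrightarrow> 0) at_top" for e' e''
      by (rule filterlim_compose[OF RL lim])
    have shift: "cos (\<alpha> + \<beta>) = cos \<alpha> * cos (\<beta> + 0) + cos (\<alpha> + pi / 2) * cos (\<beta> + - (pi / 2))" for \<alpha> \<beta> :: real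
      by (simp add: cos_add cos_diff)
    have ig: "integrable \<mu> (\<lambda>p. b e' p * cos (2 * pi * t * \<theta> p + e''))" for e' e'' t
      by (rule integrable_mult_bounded[OF bi, of _ 1]) (use \<theta>m in auto)
    have eq: "(\<integral>p. indicator L (\<pi> (g t p)) * (a * torus_cos \<xi> e (snd (\<psi> (g t p)))) * k p \<partial>\<mu>)
      = (\<integral>p. b e p * cos (2 * pi * t * \<theta> p + 0) \<partial>\<mu>) + (\<integral>p. b (e + pi / 2) p * cos (2 * pi * t * \<theta> p + - (pi / 2)) \<partial>\<mu>)" for t
    proof -
      have "indicator L (\<pi> (g t p)) * (a * torus_cos \<xi> e (snd (\<psi> (g t p)))) * k p
        = b e p * cos (2 * pi * t * \<theta> p + 0) + b (e + pi / 2) p * cos (2 * pi * t * \<theta> p + - (pi / 2))" for p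
      proof (cases "\<pi> p \<in> L")
        case True
        define x where "x = rep_torus (snd (\<psi> p))"
        have y: "snd (\<psi> p) = torus_of x" by (simp add: x_def)
        have "snd (\<psi> (g t p)) = torus_of (x + t *\<^sub>R v (\<pi> p))"
          using triv_flow[OF c v, of p t] True LU by (auto simp: y torus_of_add)
        then have "torus_cos \<xi> e (snd (\<psi> (g t p))) = cos ((2 * pi * (\<xi> \<bullet> x) + e) + 2 * pi * t * \<theta> p)"
          using True by (simp add: torus_cos_torus_of[OF \<xi>(1)] \<theta>_def inner_add_right algebra_simps)
        also have "\<dots> = cos (2 * pi * (\<xi> \<bullet> x) + e) * cos (2 * pi * t * \<theta> p + 0)
            + cos (2 * pi * (\<xi> \<bullet> x) + e + pi / 2) * cos (2 * pi * t * \<theta> p + - (pi / 2))"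
          by (rule shift)
        also have "\<dots> = torus_cos \<xi> e (snd (\<psi> p)) * cos (2 * pi * t * \<theta> p + 0)
            + torus_cos \<xi> (e + pi / 2) (snd (\<psi> p)) * cos (2 * pi * t * \<theta> p + - (pi / 2))"
          by (simp only: y torus_cos_torus_of[OF \<xi>(1)] add.assoc)
        finally show ?thesis
          using True by (simp only: b_def \<pi>_flow[OF g] indicator_simps) (simp add: distrib_left distrib_right mult_ac)
      qed (simp add: b_def \<pi>_flow[OF g])
      then show ?thesis by (simp only: Bochner_Integration.integral_add[OF ig ig])
    qed
    show "((\<lambda>t. \<integral>p. indicator L (\<pi> (g t p)) * (a * torus_cos \<xi> e (snd (\<psi> (g t p)))) * k p \<partial>\<mu>) \<longlongrightarrow> 0) at_top"
      using tendsto_add[OF RL'[of e 0] RL'[of "e + pi / 2" "- (pi / 2)"]] unfolding eq by simp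
  qed (rule h)+
qed

lemma decorrelates_trig_poly:
  assumes L: "L \<in> sets borel" "L \<subseteq> K" and p: "trig_poly p"
    and h: "h \<in> borel_measurable \<mu>" "\<And>x. \<bar>h x\<bar> \<le> C"
  shows "decorrelates h (\<lambda>q. indicator L (\<pi> q) * p (snd (\<psi> q)))"
    and "integrable \<mu> (\<lambda>q. indicator L (\<pi> q) * p (snd (\<psi> q)))"
proof -
  have i: "integrable \<mu> (\<lambda>q. indicator L (\<pi> q) * p (snd (\<psi> q)))" if tp: "trig_poly p"
    for p :: "'d torus \<Rightarrow> real"
  proof -
    obtain B where B: "\<forall>y. \<bar>p y\<bar> \<le> B" using trig_poly_bounded[OF tp] by blast
    have "(\<lambda>q. indicator L (\<pi> q) * p (snd (\<psi> q))) \<in> borel_measurable \<mu>"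
      using L K by (intro measurable_torus_over_chart trig_poly_measurable[OF tp]) auto
    moreover have "0 \<le> B" using B abs_ge_zero order_trans by blast
    ultimately show ?thesis
      using B by (intro integrable_const_bound[where B = B]) (auto simp: indicator_def)
  qed
  show "integrable \<mu> (\<lambda>q. indicator L (\<pi> q) * p (snd (\<psi> q)))" by (rule i[OF p])
  show "decorrelates h (\<lambda>q. indicator L (\<pi> q) * p (snd (\<psi> q)))"
    using p
  proof (induction rule: trig_poly.induct)
    case (cos \<xi> a e)
    show ?case
    proof (cases "\<xi> = 0")
      case True
      then show ?thesis
        using decorrelates_base_function[OF L(1) h(1), of "a * cos e"]
        by (simp add: torus_cos_def mult.commute)
    next
      case False
      then show ?thesis by (rule decorrelates_character[OF L cos _ h])
    qed
  next
    case (add p p')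
    then show ?case
      using decorrelates_add[OF h i[OF add(1)] i[OF add(2)]] by (simp add: distrib_left)
  qed
qed

lemma decorrelates_rectangle:
  assumes L: "L \<in> sets borel" "L \<subseteq> K" and D: "closed D"
    and h: "h \<in> borel_measurable \<mu>" "\<And>x. \<bar>h x\<bar> \<le> C"
  shows "decorrelates h (\<lambda>q. indicator L (\<pi> q) * indicator D (snd (\<psi> q)))"
proof -
  have LU: "L \<subseteq> U" using L K by simp
  obtain F where F: "\<And>n. continuous_on UNIV (F n)" "\<And>n z. 0 \<le> F n z" "\<And>n z. F n z \<le> (1::real)"
    "\<And>y. (\<lambda>n. F n (torus_embed y)) \<longlonglongrightarrow> indicator D y"
    using indicator_closed_torus_limit[OF D] by metis
  have Fm: "(\<lambda>y. F n (torus_embed y)) \<in> borel_measurable borel" for n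
    by (rule borel_measurable_continuous_onI) (rule continuous_on_compose2[OF F(1) continuous_torus_embed], simp)
  define s where "s n q = indicator L (\<pi> q) * F n (torus_embed (snd (\<psi> q)))" for n q
  have sm: "s n \<in> borel_measurable \<mu>" for n
    unfolding s_def by (rule measurable_torus_over_chart[OF L(1) LU Fm])
  have sb: "\<bar>s n q\<bar> \<le> 1" for n q using F(2,3) by (auto simp: s_def indicator_def)
  have si: "integrable \<mu> (s n)" for n
    by (rule integrable_const_bound[where B = 1]) (use sb sm in auto)
  have sd: "decorrelates h (s n)" for n
  proof (rule decorrelates_closed[OF h si])
    fix e :: real assume "e > 0"
    then obtain p where p: "trig_poly p" "\<And>y. \<bar>F n (torus_embed y) - p y\<bar> < e"
      using trig_poly_approx[OF F(1)] by metis
    note dp = decorrelates_trig_poly[OF L p(1) h]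
    have "(\<integral>q. \<bar>s n q - indicator L (\<pi> q) * p (snd (\<psi> q))\<bar> \<partial>\<mu>) \<le> (\<integral>q. e \<partial>\<mu>)"
    proof (rule integral_mono)
      show "\<bar>s n q - indicator L (\<pi> q) * p (snd (\<psi> q))\<bar> \<le> e" for q
        using p(2)[of "snd (\<psi> q)"] \<open>e > 0\<close> by (auto simp: s_def indicator_def)
    qed (use si dp(2) in auto)
    also have "\<dots> = e" using prob_space by simp
    finally show "\<exists>f'. decorrelates h f' \<and> integrable \<mu> f' \<and> (\<integral>x. \<bar>s n x - f' x\<bar> \<partial>\<mu>) \<le> e"
      using dp by blast
  qed
  have Dm: "indicator D \<in> borel_measurable (borel :: 'd torus measure)"
    using D by (intro borel_measurable_indicator borel_closed)
  have fi: "integrable \<mu> (\<lambda>q. indicator L (\<pi> q) * indicator D (snd (\<psi> q)) :: real)"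
    using measurable_torus_over_chart[OF L(1) LU Dm]
    by (intro integrable_const_bound[where B = 1]) (auto simp: indicator_def)
  have "(\<lambda>n. \<integral>q. \<bar>indicator L (\<pi> q) * indicator D (snd (\<psi> q)) - s n q\<bar> \<partial>\<mu>) \<longlonglongrightarrow> 0"
  proof (rule tendsto_integral_abs_diff_zero[OF fi sm])
    show "integrable \<mu> (\<lambda>_. 1 :: real)" by simp
    show "(\<lambda>n. s n q) \<longlonglongrightarrow> indicator L (\<pi> q) * indicator D (snd (\<psi> q))" for q
      unfolding s_def by (intro tendsto_mult tendsto_const F(4))
    show "\<bar>s n q\<bar> \<le> 1" for n q by (rule sb)
  qed
  note lim = this
  show ?thesis
  proof (rule decorrelates_closed[OF h fi])
    fix e :: real assume "e > 0"
    from order_tendstoD(2)[OF lim this]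
    obtain n where "(\<integral>q. \<bar>indicator L (\<pi> q) * indicator D (snd (\<psi> q)) - s n q\<bar> \<partial>\<mu>) < e"
      by (auto simp: eventually_sequentially)
    then show "\<exists>f'. decorrelates h f' \<and> integrable \<mu> f' \<and>
        (\<integral>q. \<bar>indicator L (\<pi> q) * indicator D (snd (\<psi> q)) - f' q\<bar> \<partial>\<mu>) \<le> e"
      using sd si by (intro exI[of _ "s n"]) auto
  qed
qed

text \<open>Over \<open>L\<close> every observable is a function on \<open>U \<times> T\<^sup>d\<close> read in the trivialization, and there rectangles
generate the \<open>\<sigma>\<close>-algebra.\<close>

lemma decorrelates_over_chart:
  assumes L: "L \<in> sets borel" "L \<subseteq> K" and f: "integrable \<mu> f"
    and h: "h \<in> borel_measurable \<mu>" "\<And>x. \<bar>h x\<bar> \<le> C"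
  shows "decorrelates h (\<lambda>q. indicator L (\<pi> q) * f q)"
proof -
  have LU: "L \<subseteq> U" using L K by simp
  let ?R = "restrict_space \<mu> (\<pi> -` L)"
  have PL: "\<pi> -` L \<in> sets borel" using measurable_sets[OF measurable_\<pi> L(1)] by simp
  have "\<psi> \<in> borel_measurable (restrict_space borel (\<pi> -` L))"
    using LU by (intro borel_measurable_continuous_on_restrict continuous_on_subset[OF continuous_triv[OF c]]) auto
  then have \<psi>m: "\<psi> \<in> borel_measurable ?R"
    by (simp add: measurable_cong_sets[OF sets_restrict_space_cong[OF sets_\<mu>] refl])
  define M2 where "M2 = distr ?R borel \<psi>"
  have [simp]: "space M2 = UNIV" "sets M2 = sets borel" by (simp_all add: M2_def)
  interpret M2: finite_measure M2
  proof (rule finite_measureI)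
    have "emeasure M2 (space M2) \<le> emeasure \<mu> (\<pi> -` L)"
      using PL \<psi>m by (simp add: M2_def emeasure_distr emeasure_restrict_space space_restrict_space)
    then show "emeasure M2 (space M2) \<noteq> \<infinity>"
      using emeasure_finite[of "\<pi> -` L"] by (auto simp: top_unique)
  qed
  have ind: "indicator (\<pi> -` L) q = (indicator L (\<pi> q) :: real)" for q by (simp add: indicator_def)
  have tr: "integrable M2 F \<longleftrightarrow> integrable \<mu> (\<lambda>q. indicator L (\<pi> q) * F (\<psi> q))"
    "integral\<^sup>L M2 F = (\<integral>q. indicator L (\<pi> q) * F (\<psi> q) \<partial>\<mu>)"
    if "F \<in> borel_measurable borel" for F :: "'m \<times> 'd torus \<Rightarrow> real"
    using that \<psi>m PL unfolding M2_def
    by (simp_all add: integrable_distr_eq integral_distr integrable_restrict_space integral_restrict_space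
        set_integrable_def set_lebesgue_integral_def ind)
  have trm: "F \<in> borel_measurable borel" if "integrable M2 F" for F :: "'m \<times> 'd torus \<Rightarrow> real"
    using borel_measurable_integrable[OF that] by (simp add: measurable_cong_sets[of M2 borel])
  have ti: "integrable \<mu> (\<lambda>q. indicator L (\<pi> q) * F (\<psi> q))" if "integrable M2 F"
    for F :: "'m \<times> 'd torus \<Rightarrow> real"
    using tr(1)[OF trm[OF that]] that by simp
  have all: "decorrelates h (\<lambda>q. indicator L (\<pi> q) * F (\<psi> q))" if F: "integrable M2 F"
    for F :: "'m \<times> 'd torus \<Rightarrow> real"
    using F
  proof (induction rule: M2.integrable_closed_class[where G = "{C \<times> D | C D. C \<in> sets borel \<and> closed D}",
        consumes 1, case_names sets Int GP space basic scale add closed])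
    case sets
    show ?case by (simp add: sigma_sets_borel_times_closed)
  next
    case Int
    have "\<exists>C D. C1 \<times> D1 \<inter> C2 \<times> D2 = C \<times> D \<and> C \<in> sets borel \<and> closed D"
      if "C1 \<in> sets borel" "closed D1" "C2 \<in> sets borel" "closed D2"
      for C1 C2 :: "'m set" and D1 D2 :: "'d torus set"
      using that by (intro exI[of _ "C1 \<inter> C2"] exI[of _ "D1 \<inter> D2"]) auto
    then show ?case unfolding Int_stable_def by blast
  next
    case GP
    show ?case by simp
  next
    case space
    show ?case using decorrelates_base_function[OF L(1) h(1), of 1] by simp
  next
    case (basic A)
    then obtain C' D where A: "A = C' \<times> D" "C' \<in> sets borel" "closed D" by auto
    have "decorrelates h (\<lambda>q. indicator (L \<inter> C') (\<pi> q) * indicator D (snd (\<psi> q)))"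
      using A L by (intro decorrelates_rectangle[OF _ _ _ h]) auto
    also have "(\<lambda>q. indicator (L \<inter> C') (\<pi> q) * indicator D (snd (\<psi> q)))
        = (\<lambda>q. indicator L (\<pi> q) * indicator A (\<psi> q) :: real)"
      using LU by (auto simp: fun_eq_iff A indicator_def mem_Times_iff fst_triv[OF c] subset_iff)
    finally show ?case .
  next
    case (scale F k)
    then show ?case using decorrelates_scale[OF h ti[OF scale(1)], of k] by (simp add: mult_ac)
  next
    case (add F F')
    then show ?case using decorrelates_add[OF h ti[OF add(1)] ti[OF add(2)]] by (simp add: distrib_left)
  next
    case (closed F)
    show ?case
    proof (rule decorrelates_closed[OF h ti[OF closed(1)]])
      fix e :: real assume "e > 0"
      from closed(2)[OF this] obtain F' where F': "decorrelates h (\<lambda>q. indicator L (\<pi> q) * F' (\<psi> q))"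
        "integrable M2 F'" "(\<integral>x. \<bar>F x - F' x\<bar> \<partial>M2) \<le> e" by blast
      have "(\<integral>q. \<bar>indicator L (\<pi> q) * F (\<psi> q) - indicator L (\<pi> q) * F' (\<psi> q)\<bar> \<partial>\<mu>)
          = (\<integral>q. indicator L (\<pi> q) * \<bar>F (\<psi> q) - F' (\<psi> q)\<bar> \<partial>\<mu>)"
        by (intro Bochner_Integration.integral_cong) (auto simp: indicator_def)
      also have "\<dots> \<le> e"
        using F'(3) trm[OF closed(1)] trm[OF F'(2)] by (subst (asm) tr(2)) auto
      finally show "\<exists>f'. decorrelates h f' \<and> integrable \<mu> f' \<and>
          (\<integral>q. \<bar>indicator L (\<pi> q) * F (\<psi> q) - f' q\<bar> \<partial>\<mu>) \<le> e"
        using F' ti[OF F'(2)] by blast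
    qed
  qed
  define F where "F z = indicator (U \<times> UNIV) z *\<^sub>R f (inv_into (\<pi> -` U) \<psi> z)" for z
  have fm: "f \<in> borel_measurable borel"
    using borel_measurable_integrable[OF f] by (simp add: measurable_cong_sets[OF sets_\<mu> refl])
  have "(\<lambda>z. f (inv_into (\<pi> -` U) \<psi> z)) \<in> borel_measurable (restrict_space borel (U \<times> UNIV))"
    by (rule measurable_compose[OF borel_measurable_continuous_on_restrict[OF continuous_triv_inv[OF c]] fm])
  moreover have "U \<times> (UNIV :: 'd torus set) \<in> sets borel"
    using open_triv[OF c] by (intro borel_open open_Times) auto
  ultimately have Fm: "F \<in> borel_measurable borel"
    unfolding F_def by (subst (asm) borel_measurable_restrict_space_iff) auto
  have eq: "indicator L (\<pi> q) * F (\<psi> q) = indicator L (\<pi> q) * f q" for q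
    using LU by (auto simp: F_def indicator_def mem_Times_iff fst_triv[OF c] triv_inv[OF c])
  have "integrable \<mu> (\<lambda>q. indicator L (\<pi> q) * f q)"
    using integrable_real_mult_indicator[of "\<pi> -` L" \<mu> f] f PL by (simp add: ind mult.commute)
  then have "integrable M2 F" using tr(1)[OF Fm] by (simp add: eq)
  from all[OF this] show ?thesis by (simp add: eq)
qed

end

theorem keplerian_shear_if_nonresonant:
  fixes U :: "nat \<Rightarrow> 'm set"
  assumes c: "\<And>n. (U n, \<psi> n) \<in> \<T>" and v: "\<And>n. generates r A\<^sub>M \<pi> g (U n, \<psi> n) (v n)"
    and K: "\<And>n. K n \<subseteq> U n" "\<And>n. compact (K n)" "(\<Union>n. K n) = UNIV"
    and nonres: "\<And>n \<xi> N. \<xi> \<in> int_vec \<Longrightarrow> \<xi> \<noteq> 0 \<Longrightarrow> N \<in> null_sets lborel \<Longrightarrow>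
      AE p in \<mu>. \<pi> p \<in> K n \<longrightarrow> \<xi> \<bullet> v n (\<pi> p) \<notin> N"
  shows "keplerian_shear \<mu> g"
proof (rule keplerian_shearI[OF flow[OF g]])
  fix f h :: "'w \<Rightarrow> real" and C
  assume f: "integrable \<mu> f" and h: "h \<in> borel_measurable \<mu>" "\<And>x. \<bar>h x\<bar> \<le> C"
  \<comment> \<open>A Borel partition subordinate to the cover decomposes \<open>f\<close> into pieces over single charts.\<close>
  define L where "L = disjointed K"
  have LK: "L n \<subseteq> K n" for n unfolding L_def by (rule disjointed_subset)
  have "range K \<subseteq> sets borel" using K(2) by (auto intro!: borel_closed compact_imp_closed)
  then have L: "L n \<in> sets borel" for n
    using sets.range_disjointed_sets[of K borel] by (auto simp: L_def)
  have disj: "disjoint_family L" unfolding L_def by (rule disjoint_family_disjointed)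
  have UL: "(\<Union>n. L n) = UNIV" unfolding L_def UN_disjointed_eq by (rule K(3))
  have d: "decorrelates h (\<lambda>q. indicator (L n) (\<pi> q) * f q)" for n
    by (rule decorrelates_over_chart[OF c v K(1) nonres L LK f h])
  have i: "integrable \<mu> (\<lambda>q. indicator (L n) (\<pi> q) * f q)" for n
  proof -
    have "\<pi> -` L n \<in> sets \<mu>" using measurable_sets[OF measurable_\<pi> L] by simp
    from integrable_real_mult_indicator[OF this f] show ?thesis
      by (simp add: indicator_def mult.commute)
  qed
  define s where "s n q = (\<Sum>k<n. indicator (L k) (\<pi> q) * f q)" for n q
  have si: "integrable \<mu> (s n)" for n unfolding s_def by (intro Bochner_Integration.integrable_sum i)
  have sd: "decorrelates h (s n)" for n
  proof (induction n)
    case 0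
    show ?case using decorrelates_scale[OF h i[of 0] d[of 0], of 0] by (simp add: s_def)
  next
    case (Suc n)
    show ?case using decorrelates_add[OF h si i Suc d[of n]] by (simp add: s_def)
  qed
  have s: "s n q = indicator (\<Union>k<n. L k) (\<pi> q) * f q" for n q
    unfolding s_def sum_distrib_right[symmetric]
    by (subst indicator_UN_disjoint) (use disj in \<open>auto simp: disjoint_family_on_def\<close>)
  have lim: "(\<lambda>n. \<integral>q. \<bar>f q - s n q\<bar> \<partial>\<mu>) \<longlonglongrightarrow> 0"
  proof (rule tendsto_integral_abs_diff_zero[OF f _ integrable_abs[OF f]])
    show "s n \<in> borel_measurable \<mu>" for n using si by auto
    show "(\<lambda>n. s n q) \<longlonglongrightarrow> f q" for q
    proof -
      have "(\<lambda>n. indicator (\<Union>k<n. L k) (\<pi> q) * f q) \<longlonglongrightarrow> indicator (\<Union>k. L k) (\<pi> q) * f q"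
        by (intro tendsto_mult tendsto_const LIMSEQ_indicator_UN)
      then show ?thesis by (simp add: s UL)
    qed
    show "\<bar>s n q\<bar> \<le> \<bar>f q\<bar>" for n q by (auto simp: s indicator_def)
  qed
  show "decorrelates h f"
  proof (rule decorrelates_closed[OF h f])
    fix e :: real assume "e > 0"
    from order_tendstoD(2)[OF lim this] obtain n where "(\<integral>q. \<bar>f q - s n q\<bar> \<partial>\<mu>) < e"
      by (auto simp: eventually_sequentially)
    then show "\<exists>f'. decorrelates h f' \<and> integrable \<mu> f' \<and> (\<integral>q. \<bar>f q - f' q\<bar> \<partial>\<mu>) \<le> e"
      using sd si by (intro exI[of _ "s n"]) auto
  qed
qed

end

section \<open>Perturbing a compatible flow\<close>

context affine_bundle
begin

subsection \<open>Maps of class \<open>C^r\<close> on the base\<close>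

lemma Cr_charts_chart: "c \<in> Cr_charts r A\<^sub>M \<Longrightarrow> is_chart c"
  by (simp add: Cr_charts_def)

text \<open>\<open>Cr_map\<close> tests a function only in the charts of the given atlas; the charts \<open>\<phi> i\<close> that define the
topology may come from the maximal atlas.\<close>

lemma Cr_map_euclidean_chart:
  fixes f :: "'m \<Rightarrow> 'e::euclidean_space"
  assumes \<phi>: "(U, \<phi>) \<in> Cr_charts r A\<^sub>M" and S: "open S" and f: "Cr_map r A\<^sub>M S euclidean_atlas f"
  shows "Cr_on r (\<phi> ` (U \<inter> S)) (f \<circ> inv_into U \<phi>)"
proof (rule Cr_on_local)
  fix x assume "x \<in> \<phi> ` (U \<inter> S)"
  then obtain m where m: "m \<in> U" "m \<in> S" "x = \<phi> m" by blast
  obtain V \<xi> where V: "(V, \<xi>) \<in> A\<^sub>M" "m \<in> V" by (rule Cr_atlas_cover[OF atlas_M])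
  note cU = Cr_charts_chart[OF \<phi>] and cV = chart_M[OF V(1)]
  have oV: "open V" by (rule is_chartD(1)[OF cV])
  let ?O = "\<phi> ` (U \<inter> (V \<inter> S))"
  have O: "open ?O" by (rule open_chart_image[OF cU open_Int[OF oV S]])
  have T: "open (\<xi> ` (V \<inter> S))" by (rule open_chart_image[OF cV S])
  have "Cr_related r (U, \<phi>) (V, \<xi>)" using \<phi> V by (auto simp: Cr_charts_def)
  then have "Cr_on r (\<phi> ` (U \<inter> V)) (\<xi> \<circ> inv_into U \<phi>)" by (simp add: Cr_related_def)
  then have F: "Cr_on r ?O (\<xi> \<circ> inv_into U \<phi>)" by (rule Cr_on_subset) auto
  have "Cr_on r (\<xi> ` (S \<inter> V \<inter> f -` UNIV)) (id \<circ> f \<circ> inv_into V \<xi>)"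
    using f V(1) by (auto simp: Cr_map_def euclidean_atlas_def)
  then have f': "Cr_on r (\<xi> ` (V \<inter> S)) (f \<circ> inv_into V \<xi>)" by (simp add: Int_commute)
  have inv: "inv_into U \<phi> (\<phi> m) = m" if "m \<in> U" for m
    using is_chartD(3)[OF cU] that by simp
  have "Cr_on r ?O (\<lambda>x. (f \<circ> inv_into V \<xi>) ((\<xi> \<circ> inv_into U \<phi>) x))"
    by (rule Cr_on_compose[OF O T _ F f']) (auto simp: inv)
  then have "Cr_on r ?O (f \<circ> inv_into U \<phi>)"
    by (rule Cr_on_cong[OF O, rotated]) (use is_chartD(3)[OF cV] in \<open>auto simp: inv\<close>)
  then show "\<exists>N. open N \<and> x \<in> N \<and> Cr_on r N (f \<circ> inv_into U \<phi>)"
    using O m V(2) by blast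
qed

lemma Cr_map_euclideanI:
  fixes f :: "'m \<Rightarrow> 'e::euclidean_space"
  assumes S: "open S"
    and f: "\<And>V \<xi>. (V, \<xi>) \<in> A\<^sub>M \<Longrightarrow> Cr_on r (\<xi> ` (V \<inter> S)) (f \<circ> inv_into V \<xi>)"
  shows "Cr_map r A\<^sub>M S euclidean_atlas f"
  unfolding Cr_map_def
proof
  show "continuous_on S f"
  proof (rule continuous_at_imp_continuous_on, rule ballI)
    fix m assume m: "m \<in> S"
    obtain V \<xi> where V: "(V, \<xi>) \<in> A\<^sub>M" "m \<in> V" by (rule Cr_atlas_cover[OF atlas_M])
    note cV = chart_M[OF V(1)]
    have "continuous_on (V \<inter> S) (\<lambda>x. (f \<circ> inv_into V \<xi>) (\<xi> x))"
      by (rule continuous_on_compose2[OF Cr_on_continuous[OF f[OF V(1)]]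
            continuous_on_subset[OF is_chartD(4)[OF cV]]]) auto
    then have "continuous_on (V \<inter> S) f"
      by (rule continuous_on_cong[THEN iffD1, rotated 2]) (use is_chartD(3)[OF cV] in auto)
    then show "isCont f m"
      using is_chartD(1)[OF cV] S m V(2) by (simp add: continuous_on_eq_continuous_at open_Int)
  qed
  have "Cr_on r (\<xi> ` (S \<inter> V \<inter> f -` UNIV)) (id \<circ> f \<circ> inv_into V \<xi>)" if "(V, \<xi>) \<in> A\<^sub>M" for V \<xi>
    using f[OF that] by (simp add: Int_commute)
  then show "\<forall>(U, \<phi>)\<in>A\<^sub>M. \<forall>(V, \<xi>)\<in>euclidean_atlas.
      Cr_on r (\<phi> ` (S \<inter> U \<inter> f -` V)) (\<xi> \<circ> f \<circ> inv_into U \<phi>)"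
    by (auto simp: euclidean_atlas_def)
qed

lemma Cr_map_euclidean_cong:
  fixes f h :: "'m \<Rightarrow> 'e::euclidean_space"
  assumes S: "open S" and f: "Cr_map r A\<^sub>M S euclidean_atlas f" and eq: "\<And>x. x \<in> S \<Longrightarrow> f x = h x"
  shows "Cr_map r A\<^sub>M S euclidean_atlas h"
proof (rule Cr_map_euclideanI[OF S])
  fix V \<xi> assume V: "(V, \<xi>) \<in> A\<^sub>M"
  show "Cr_on r (\<xi> ` (V \<inter> S)) (h \<circ> inv_into V \<xi>)"
    by (rule Cr_on_cong[OF open_chart_image[OF chart_M[OF V] S] _
          Cr_map_euclidean_chart[OF Cr_atlas_charts[OF atlas_M V] S f]])
      (use is_chartD(3)[OF chart_M[OF V]] eq in auto)
qed

lemma Cr_map_add_scaleR: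
  fixes f :: "'m \<Rightarrow> 'e::euclidean_space"
  assumes S: "open S" and f: "Cr_map r A\<^sub>M S euclidean_atlas f" and w: "Cr_map r A\<^sub>M UNIV euclidean_atlas w"
  shows "Cr_map r A\<^sub>M S euclidean_atlas (\<lambda>x. f x + w x *\<^sub>R a)"
proof (rule Cr_map_euclideanI[OF S])
  fix V \<xi> assume V: "(V, \<xi>) \<in> A\<^sub>M"
  have O: "open (\<xi> ` (V \<inter> S))" by (rule open_chart_image[OF chart_M[OF V] S])
  note V' = Cr_atlas_charts[OF atlas_M V]
  have "Cr_on r (\<xi> ` (V \<inter> S)) (w \<circ> inv_into V \<xi>)"
    by (rule Cr_on_subset[OF Cr_map_euclidean_chart[OF V' open_UNIV w]]) auto
  from Cr_on_add[OF O Cr_map_euclidean_chart[OF V' S f] Cr_on_scaleR[OF O this Cr_on_const[OF O]]]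
  show "Cr_on r (\<xi> ` (V \<inter> S)) ((\<lambda>x. f x + w x *\<^sub>R a) \<circ> inv_into V \<xi>)"
    by (simp add: comp_def)
qed

definition chart_bump :: "'m set \<Rightarrow> ('m \<Rightarrow> real^'n) \<Rightarrow> real^'n \<Rightarrow> real \<Rightarrow> 'm \<Rightarrow> real" where
  "chart_bump U \<phi> p \<rho> m = (if m \<in> U then ball_bump p \<rho> (\<phi> m) else 0)"

text \<open>The extension by \<open>0\<close> is of class \<open>C^r\<close> because the support is contained in the preimage of the closed
ball, which is compact and hence closed in the Hausdorff space \<open>M\<close>.\<close>

lemma Cr_map_chart_bump:
  assumes \<phi>: "(U, \<phi>) \<in> Cr_charts r A\<^sub>M" and "0 \<le> \<rho>" and sub: "cball p \<rho> \<subseteq> \<phi> ` U"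
  shows "Cr_map r A\<^sub>M UNIV euclidean_atlas (chart_bump U \<phi> p \<rho>)"
proof (rule Cr_map_euclideanI[OF open_UNIV])
  note cU = Cr_charts_chart[OF \<phi>]
  fix V \<xi> assume V: "(V, \<xi>) \<in> A\<^sub>M"
  note cV = chart_M[OF V]
  define Z where "Z = inv_into U \<phi> ` cball p \<rho>"
  have "compact Z"
    unfolding Z_def using continuous_on_subset[OF is_chartD(5)[OF cU] sub]
    by (intro compact_continuous_image) auto
  then have "closed Z" by (rule compact_imp_closed)
  have ZU: "Z \<subseteq> U" unfolding Z_def using sub by (auto intro: inv_into_into)
  have zero: "chart_bump U \<phi> p \<rho> m = 0" if "m \<notin> Z" for m
  proof (cases "m \<in> U")
    case True
    then have "\<phi> m \<notin> cball p \<rho>"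
      using that is_chartD(3)[OF cU] by (auto simp: Z_def intro: rev_image_eqI)
    then show ?thesis
      using ball_bump_eq_0[OF \<open>0 \<le> \<rho>\<close>, of "\<phi> m" p] by (auto simp: chart_bump_def)
  qed (simp add: chart_bump_def)
  have inv: "inv_into V \<xi> (\<xi> m) = m" if "m \<in> V" for m
    using is_chartD(3)[OF cV] that by simp
  show "Cr_on r (\<xi> ` (V \<inter> UNIV)) (chart_bump U \<phi> p \<rho> \<circ> inv_into V \<xi>)"
  proof (rule Cr_on_local)
    fix x assume "x \<in> \<xi> ` (V \<inter> UNIV)"
    then obtain m where m: "m \<in> V" "x = \<xi> m" by blast
    show "\<exists>N. open N \<and> x \<in> N \<and> Cr_on r N (chart_bump U \<phi> p \<rho> \<circ> inv_into V \<xi>)"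
    proof (cases "m \<in> U")
      case True
      have O: "open (\<xi> ` (V \<inter> U))" by (rule open_chart_image[OF cV is_chartD(1)[OF cU]])
      have "Cr_related r (U, \<phi>) (V, \<xi>)" using \<phi> V by (auto simp: Cr_charts_def)
      then have F: "Cr_on r (\<xi> ` (V \<inter> U)) (\<phi> \<circ> inv_into V \<xi>)"
        by (simp add: Cr_related_def Int_commute)
      have "Cr_on r (\<xi> ` (V \<inter> U)) (\<lambda>x. ball_bump p \<rho> ((\<phi> \<circ> inv_into V \<xi>) x))"
        by (rule Cr_on_compose[OF O open_UNIV _ F Cr_on_ball_bump]) auto
      then have "Cr_on r (\<xi> ` (V \<inter> U)) (chart_bump U \<phi> p \<rho> \<circ> inv_into V \<xi>)"
        by (rule Cr_on_cong[OF O, rotated]) (auto simp: chart_bump_def inv)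
      then show ?thesis using O m True by blast
    next
      case False
      have O: "open (\<xi> ` (V \<inter> - Z))" by (rule open_chart_image[OF cV]) (simp add: \<open>closed Z\<close> open_Compl)
      have "Cr_on r (\<xi> ` (V \<inter> - Z)) (chart_bump U \<phi> p \<rho> \<circ> inv_into V \<xi>)"
        by (rule Cr_on_cong[OF O _ Cr_on_const[OF O, of r 0]]) (auto simp: inv zero)
      then show ?thesis using O m False ZU by blast
    qed
  qed
qed

subsection \<open>Generating functions\<close>

lemma generates_cong:
  assumes c: "(U, \<psi>) \<in> \<T>" and v: "generates r A\<^sub>M \<pi> g (U, \<psi>) v" and eq: "\<And>x. x \<in> U \<Longrightarrow> v x = v' x"
  shows "generates r A\<^sub>M \<pi> g (U, \<psi>) v'"
  using v Cr_map_euclidean_cong[OF open_triv[OF c], of v v'] eq by (auto simp: generates_def)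

lemma gen_fun_eqI:
  assumes c: "(U, \<psi>) \<in> \<T>" and v: "generates r A\<^sub>M \<pi> g (U, \<psi>) v"
  shows "gen_fun r A\<^sub>M \<pi> g (U, \<psi>) = restrict v U"
  unfolding gen_fun_def
proof (rule the_equality)
  show "restrict v U \<in> extensional (fst (U, \<psi>)) \<and> generates r A\<^sub>M \<pi> g (U, \<psi>) (restrict v U)"
    using generates_cong[OF c v, of "restrict v U"] by simp
  fix v' assume v': "v' \<in> extensional (fst (U, \<psi>)) \<and> generates r A\<^sub>M \<pi> g (U, \<psi>) v'"
  show "v' = restrict v U"
  proof
    fix x show "v' x = restrict v U x"
      using v' generates_unique[OF conjunct2[OF v'] v, of x] by (cases "x \<in> U") (auto simp: extensional_def)
  qed
qed

lemma gen_fun_generates: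
  assumes g: "g \<in> compatible_flows r A\<^sub>M \<pi> \<T>" and c: "(U, \<psi>) \<in> \<T>"
  shows "generates r A\<^sub>M \<pi> g (U, \<psi>) (gen_fun r A\<^sub>M \<pi> g (U, \<psi>))"
proof -
  obtain v where v: "generates r A\<^sub>M \<pi> g (U, \<psi>) v" using generates_ex[OF g c] by blast
  show ?thesis unfolding gen_fun_eqI[OF c v] by (rule generates_cong[OF c v]) simp
qed

lemma Cr_on_gen_fun:
  assumes g: "g \<in> compatible_flows r A\<^sub>M \<pi> \<T>" and c: "(U, \<psi>) \<in> \<T>" and \<phi>: "(U, \<phi>) \<in> Cr_charts r A\<^sub>M"
  shows "Cr_on r (\<phi> ` U) (gen_fun r A\<^sub>M \<pi> g (U, \<psi>) \<circ> inv_into U \<phi>)"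
proof -
  have "Cr_map r A\<^sub>M U euclidean_atlas (gen_fun r A\<^sub>M \<pi> g (U, \<psi>))"
    using gen_fun_generates[OF g c] by (simp add: generates_def)
  from Cr_map_euclidean_chart[OF \<phi> open_triv[OF c] this] show ?thesis by simp
qed

subsection \<open>Perturbation of a flow over one trivializing chart\<close>

text \<open>Over \<open>U\<close>, the flow followed by the translation by \<open>t w a\<close> in the fibre. It is a flow since
translations of a torus commute.\<close>

definition perturbed_flow ::
  "'m set \<Rightarrow> ('w \<Rightarrow> 'm \<times> 'd torus) \<Rightarrow> (real \<Rightarrow> 'w \<Rightarrow> 'w) \<Rightarrow> ('m \<Rightarrow> real) \<Rightarrow> real^'d \<Rightarrow> real \<Rightarrow> 'w \<Rightarrow> 'w"
  where "perturbed_flow U \<psi> g w a t p =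
    (if \<pi> p \<in> U then inv_into (\<pi> -` U) \<psi> (\<pi> p, snd (\<psi> (g t p)) + torus_of (t *\<^sub>R w (\<pi> p) *\<^sub>R a))
     else g t p)"

lemma affine_change_ex:
  assumes "(U\<^sub>0, \<psi>\<^sub>0) \<in> \<T>" and "(V, \<psi>) \<in> \<T>"
  shows "\<exists>(A :: int^'d^'d) \<alpha>. \<forall>x\<in>U\<^sub>0 \<inter> V. \<forall>y.
    \<psi> (inv_into (\<pi> -` U\<^sub>0) \<psi>\<^sub>0 (x, y)) = (x, \<alpha> x + torus_mat A y)"
proof -
  have "affine_change r A\<^sub>M \<pi> (U\<^sub>0, \<psi>\<^sub>0) (V, \<psi>)"
    using trivializing assms unfolding trivializing_atlas_def by blast
  then show ?thesis unfolding affine_change_def by blast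
qed

context
  fixes U\<^sub>0 \<psi>\<^sub>0 g w
  assumes c\<^sub>0: "(U\<^sub>0, \<psi>\<^sub>0) \<in> \<T>" and g: "g \<in> compatible_flows r A\<^sub>M \<pi> \<T>"
    and w: "Cr_map r A\<^sub>M UNIV euclidean_atlas w" and w0: "\<And>x. x \<notin> U\<^sub>0 \<Longrightarrow> w x = (0::real)"
begin

abbreviation "pf a \<equiv> perturbed_flow U\<^sub>0 \<psi>\<^sub>0 g w a"

lemma \<pi>_perturbed_flow: "\<pi> (pf a t p) = \<pi> p"
  by (simp add: perturbed_flow_def \<pi>_triv_inv[OF c\<^sub>0] \<pi>_flow[OF g])

lemma is_flow_perturbed: "is_flow (pf a)"
  unfolding is_flow_def
proof (intro conjI allI)
  obtain v where v: "generates r A\<^sub>M \<pi> g (U\<^sub>0, \<psi>\<^sub>0) v" using generates_ex[OF g c\<^sub>0] by blast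
  have g0: "g 0 = id" and gst: "\<And>s t. g (s + t) = g s \<circ> g t"
    using flow[OF g] by (auto simp: is_flow_def)
  have t0: "torus_of 0 = (0 :: 'd torus)" by (simp add: zero_torus.abs_eq)
  have pf: "pf a t p = inv_into (\<pi> -` U\<^sub>0) \<psi>\<^sub>0 (\<pi> p, snd (\<psi>\<^sub>0 p) + torus_of (t *\<^sub>R (v (\<pi> p) + w (\<pi> p) *\<^sub>R a)))"
    if "\<pi> p \<in> U\<^sub>0" for t p
    using that by (simp add: perturbed_flow_def triv_flow[OF c\<^sub>0 v] scaleR_add_right torus_of_add add.assoc)
  show "pf a 0 = id"
  proof
    fix p show "pf a 0 p = id p"
    proof (cases "\<pi> p \<in> U\<^sub>0")
      case True
      then show ?thesis by (simp add: pf t0 triv_eq[OF c\<^sub>0, symmetric] triv_inv[OF c\<^sub>0])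
    qed (simp add: perturbed_flow_def g0)
  qed
  show "pf a (s + t) = pf a s \<circ> pf a t" for s t
  proof
    fix p show "pf a (s + t) p = (pf a s \<circ> pf a t) p"
    proof (cases "\<pi> p \<in> U\<^sub>0")
      case True
      then have "\<psi>\<^sub>0 (pf a t p) = (\<pi> p, snd (\<psi>\<^sub>0 p) + torus_of (t *\<^sub>R (v (\<pi> p) + w (\<pi> p) *\<^sub>R a)))"
        by (simp add: pf triv_triv_inv[OF c\<^sub>0])
      then show ?thesis
        using True pf[of "pf a t p" s]
        by (simp add: pf[OF True, of "s + t"] \<pi>_perturbed_flow scaleR_add_left torus_of_add add_ac)
    next
      case False
      then show ?thesis by (simp add: perturbed_flow_def gst \<pi>_flow[OF g])
    qed
  qed
qed

text \<open>In another trivialization the additional velocity \<open>w a\<close> appears as \<open>w (A a)\<close>. As the matrix \<open>A\<close> is the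
same over the whole overlap, and \<open>w\<close> vanishes outside \<open>U\<^sub>0\<close>, this is again of class \<open>C^r\<close>.\<close>

lemma perturbed_flow_generates:
  assumes c: "(V, \<psi>) \<in> \<T>" and v: "generates r A\<^sub>M \<pi> g (V, \<psi>) v"
    and change: "\<And>x y. x \<in> U\<^sub>0 \<inter> V \<Longrightarrow> \<psi> (inv_into (\<pi> -` U\<^sub>0) \<psi>\<^sub>0 (x, y)) = (x, \<alpha> x + torus_mat A y)"
  shows "generates r A\<^sub>M \<pi> (pf a) (V, \<psi>) (\<lambda>x. v x + w x *\<^sub>R (map_matrix real_of_int A *v a))"
  unfolding generates_def prod.case
proof (intro conjI allI ballI)
  have "Cr_map r A\<^sub>M V euclidean_atlas v" using v by (simp add: generates_def)
  then show "Cr_map r A\<^sub>M V euclidean_atlas (\<lambda>x. v x + w x *\<^sub>R (map_matrix real_of_int A *v a))"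
    by (rule Cr_map_add_scaleR[OF open_triv[OF c] _ w])
  show "pf a t ` (\<pi> -` V) \<subseteq> \<pi> -` V" for t by (auto simp: \<pi>_perturbed_flow)
  fix t x y assume x: "x \<in> V"
  define p where "p = inv_into (\<pi> -` V) \<psi> (x, y)"
  have p: "\<pi> p = x" "\<psi> p = (x, y)" using x by (simp_all add: p_def \<pi>_triv_inv[OF c] triv_triv_inv[OF c])
  have gp: "\<psi> (g t p) = (x, y + torus_of (t *\<^sub>R v x))" using triv_flow[OF c v, of p t] p x by simp
  show "\<psi> (pf a t p) = (x, y + torus_of (t *\<^sub>R (v x + w x *\<^sub>R (map_matrix real_of_int A *v a))))"
  proof (cases "x \<in> U\<^sub>0")
    case True
    define y' where "y' = snd (\<psi>\<^sub>0 (g t p))"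
    have "\<pi> (g t p) \<in> U\<^sub>0" using True p by (simp add: \<pi>_flow[OF g])
    from triv_inv[OF c\<^sub>0 this] triv_eq[OF c\<^sub>0 this]
    have "g t p = inv_into (\<pi> -` U\<^sub>0) \<psi>\<^sub>0 (x, y')"
      using p by (simp add: \<pi>_flow[OF g] y'_def)
    with change[of x y'] gp True x have 1: "\<alpha> x + torus_mat A y' = y + torus_of (t *\<^sub>R v x)" by simp
    have "\<psi> (pf a t p) = (x, \<alpha> x + torus_mat A (y' + torus_of (t *\<^sub>R w x *\<^sub>R a)))"
      using change True x p by (simp add: perturbed_flow_def y'_def)
    also have "\<alpha> x + torus_mat A (y' + torus_of (t *\<^sub>R w x *\<^sub>R a))
        = (\<alpha> x + torus_mat A y') + torus_of (t *\<^sub>R w x *\<^sub>R (map_matrix real_of_int A *v a))"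
      by (simp add: torus_mat_add torus_mat_torus_of add.assoc matrix_vector_mult_scaleR)
    also have "\<dots> = y + torus_of (t *\<^sub>R (v x + w x *\<^sub>R (map_matrix real_of_int A *v a)))"
      unfolding 1 by (simp add: scaleR_add_right torus_of_add add.assoc)
    finally show ?thesis .
  next
    case False
    then show ?thesis using p gp w0[OF False] by (simp add: perturbed_flow_def)
  qed
qed

lemma perturbed_flow_generates_self:
  assumes v: "generates r A\<^sub>M \<pi> g (U\<^sub>0, \<psi>\<^sub>0) v"
  shows "generates r A\<^sub>M \<pi> (pf a) (U\<^sub>0, \<psi>\<^sub>0) (\<lambda>x. v x + w x *\<^sub>R a)"
proof -
  have id: "map_matrix real_of_int (mat 1 :: int^'d^'d) = mat 1"
    by (simp add: vec_eq_iff mat_def map_matrix_def)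
  have "torus_mat (mat 1) y = y" for y :: "'d torus"
    using torus_mat_torus_of[of "mat 1" "rep_torus y"] by (simp add: id)
  then have "generates r A\<^sub>M \<pi> (pf a) (U\<^sub>0, \<psi>\<^sub>0) (\<lambda>x. v x + w x *\<^sub>R (map_matrix real_of_int (mat 1) *v a))"
    by (intro perturbed_flow_generates[OF c\<^sub>0 v, of "\<lambda>_. 0"]) (simp add: triv_triv_inv[OF c\<^sub>0])
  then show ?thesis by (simp add: id)
qed

lemma perturbed_flow_compatible: "pf a \<in> compatible_flows r A\<^sub>M \<pi> \<T>"
  unfolding compatible_flows_def
proof (intro CollectI conjI ballI is_flow_perturbed)
  fix c assume "c \<in> \<T>"
  then obtain V \<psi> where c: "c = (V, \<psi>)" "(V, \<psi>) \<in> \<T>" by (cases c) auto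
  obtain v where v: "generates r A\<^sub>M \<pi> g (V, \<psi>) v" using generates_ex[OF g c(2)] by blast
  obtain A :: "int^'d^'d" and \<alpha> where "\<forall>x\<in>U\<^sub>0 \<inter> V. \<forall>y.
    \<psi> (inv_into (\<pi> -` U\<^sub>0) \<psi>\<^sub>0 (x, y)) = (x, \<alpha> x + torus_mat A y)"
    using affine_change_ex[OF c\<^sub>0 c(2)] by blast
  then have "generates r A\<^sub>M \<pi> (pf a) (V, \<psi>) (\<lambda>x. v x + w x *\<^sub>R (map_matrix real_of_int A *v a))"
    by (intro perturbed_flow_generates[OF c(2) v]) auto
  then show "\<exists>v. generates r A\<^sub>M \<pi> (pf a) c v" unfolding c(1) by blast
qed

end

end

section \<open>Genericity\<close>

text \<open>Where \<open>w \<noteq> 0\<close>, the equation \<open>u + s w = 0\<close> determines \<open>s\<close>, as the value of \<open>- u / w\<close>. So these sets are the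
level sets of one function, and a finite measure has only countably many atoms.\<close>

lemma countable_levels_positive_measure:
  fixes u w :: "'a::euclidean_space \<Rightarrow> real"
  assumes L: "compact L" and u: "continuous_on L u" and w: "continuous_on L w"
  shows "countable {s. emeasure lborel {x\<in>L. w x \<noteq> 0 \<and> u x + s * w x = 0} \<noteq> 0}"
proof -
  have Lb: "L \<in> sets borel" using L by (simp add: borel_closed compact_imp_closed)
  let ?R = "restrict_space lborel L"
  have meas: "f \<in> borel_measurable ?R" if "continuous_on L f" for f :: "'a \<Rightarrow> real"
    using borel_measurable_continuous_on_restrict[OF that]
    by (simp add: measurable_cong_sets[OF sets_restrict_space_cong[OF sets_lborel] refl])
  note [measurable] = meas[OF u] meas[OF w]
  define L' where "L' = {x\<in>L. w x \<noteq> 0}"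
  define q where "q x = - u x / w x" for x
  have L'R: "L' \<in> sets ?R"
  proof -
    have "{x\<in>space ?R. w x \<noteq> 0} \<in> sets ?R" by measurable
    then show ?thesis by (simp add: L'_def space_restrict_space)
  qed
  define N where "N = distr (density ?R (indicator L')) borel q"
  have qm: "q \<in> borel_measurable ?R" unfolding q_def by measurable
  have fin: "emeasure lborel L < \<infinity>" using L by (rule emeasure_compact_finite)
  have em: "emeasure N S = emeasure lborel (q -` S \<inter> L')" if "S \<in> sets borel" for S
  proof -
    have s: "q -` S \<inter> space ?R \<in> sets ?R" using measurable_sets[OF qm that] .
    then have "emeasure N S = (\<integral>\<^sup>+x. indicator L' x * indicator (q -` S \<inter> space ?R) x \<partial>?R)"
      unfolding N_def using that qm L'R by (simp add: emeasure_distr emeasure_density)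
    also have "\<dots> = (\<integral>\<^sup>+x. indicator (q -` S \<inter> L') x \<partial>?R)"
      by (intro nn_integral_cong) (auto simp: indicator_def)
    also have "\<dots> = emeasure ?R (q -` S \<inter> L')"
    proof (rule nn_integral_indicator)
      have "(q -` S \<inter> space ?R) \<inter> L' \<in> sets ?R" using s L'R by (rule sets.Int)
      also have "(q -` S \<inter> space ?R) \<inter> L' = q -` S \<inter> L'"
        by (auto simp: L'_def space_restrict_space)
      finally show "q -` S \<inter> L' \<in> sets ?R" .
    qed
    also have "\<dots> = emeasure lborel (q -` S \<inter> L')"
      using Lb by (intro emeasure_restrict_space) (auto simp: L'_def)
    finally show ?thesis .
  qed
  interpret N: finite_measure N
  proof (rule finite_measureI)
    have "emeasure N UNIV \<le> emeasure lborel L"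
      using em[of UNIV] Lb by (auto simp: L'_def intro!: emeasure_mono)
    then show "emeasure N (space N) \<noteq> \<infinity>" using fin by (auto simp: N_def top_unique)
  qed
  have "emeasure lborel {x\<in>L. w x \<noteq> 0 \<and> u x + s * w x = 0} = ennreal (measure N {s})" for s
  proof -
    have "{x\<in>L. w x \<noteq> 0 \<and> u x + s * w x = 0} = q -` {s} \<inter> L'"
      by (auto simp: q_def L'_def field_simps add_eq_0_iff)
    then show ?thesis using em[of "{s}"] N.emeasure_eq_measure[of "{s}"] by simp
  qed
  then have "{s. emeasure lborel {x\<in>L. w x \<noteq> 0 \<and> u x + s * w x = 0} \<noteq> 0} = {s. measure N {s} \<noteq> 0}"
    by simp
  then show ?thesis using N.countable_support by simp
qed

lemma countable_ball_cover:
  fixes W :: "'a::euclidean_space set"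
  assumes "open W"
  obtains P :: "('a \<times> real) set" where "countable P" "\<And>p \<rho>. (p, \<rho>) \<in> P \<Longrightarrow> 0 < \<rho> \<and> cball p \<rho> \<subseteq> W"
    "W \<subseteq> (\<Union>(p, \<rho>)\<in>P. cball p \<rho>)"
proof -
  define F where "F = {B. \<exists>p \<rho>. 0 < \<rho> \<and> cball p \<rho> \<subseteq> W \<and> B = ball p (\<rho> :: real)}"
  obtain F' where F': "F' \<subseteq> F" "countable F'" "\<Union>F' = \<Union>F"
    using Lindelof[of F] by (auto simp: F_def)
  have "\<forall>B\<in>F'. \<exists>q. 0 < snd q \<and> cball (fst q) (snd q) \<subseteq> W \<and> B = ball (fst q) (snd q)"
  proof
    fix B assume "B \<in> F'"
    then obtain p \<rho> where "0 < \<rho>" "cball p \<rho> \<subseteq> W" "B = ball p \<rho>" using F'(1) by (auto simp: F_def)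
    then show "\<exists>q. 0 < snd q \<and> cball (fst q) (snd q) \<subseteq> W \<and> B = ball (fst q) (snd q)"
      by (intro exI[of _ "(p, \<rho>)"]) simp
  qed
  then obtain q where q: "\<And>B. B \<in> F' \<Longrightarrow> 0 < snd (q B) \<and> cball (fst (q B)) (snd (q B)) \<subseteq> W \<and> B = ball (fst (q B)) (snd (q B))"
    by metis
  show ?thesis
  proof
    show "countable (q ` F')" using F'(2) by simp
    show "0 < \<rho> \<and> cball p \<rho> \<subseteq> W" if "(p, \<rho>) \<in> q ` F'" for p \<rho>
    proof -
      from that obtain B where "B \<in> F'" "q B = (p, \<rho>)" by (metis imageE)
      then show ?thesis using q[of B] by simp
    qed
    show "W \<subseteq> (\<Union>(p, \<rho>)\<in>q ` F'. cball p \<rho>)"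
    proof
      fix x assume "x \<in> W"
      then obtain e where e: "e > 0" "cball x e \<subseteq> W" using assms open_contains_cball by blast
      then have "ball x e \<in> F" by (auto simp: F_def)
      then have "x \<in> \<Union>F'" using e(1) F'(3) by (metis UnionI centre_in_ball)
      then obtain B where B: "B \<in> F'" "x \<in> B" by blast
      then have "x \<in> cball (fst (q B)) (snd (q B))" using q[OF B(1)] ball_subset_cball by blast
      then show "x \<in> (\<Union>(p, \<rho>)\<in>q ` F'. cball p \<rho>)"
        using B(1) by (intro UN_I[of "q B"]) (auto simp: case_prod_beta)
    qed
  qed
qed

locale charted_bundle = affine_bundle r A\<^sub>M A\<^sub>\<Omega> \<pi> \<T>
  for r :: enat
    and A\<^sub>M :: "('m::{t2_space, second_countable_topology}, real^'n) chart set"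
    and A\<^sub>\<Omega> :: "('w::{t2_space, second_countable_topology}, (real^'n) \<times> (real^'d)) chart set"
    and \<pi> :: "'w \<Rightarrow> 'm"
    and \<T> :: "('m set \<times> ('w \<Rightarrow> 'm \<times> 'd torus)) set" +
  fixes I :: "'i set"
    and U :: "'i \<Rightarrow> 'm set"
    and \<psi> :: "'i \<Rightarrow> 'w \<Rightarrow> 'm \<times> 'd torus"
    and \<phi> :: "'i \<Rightarrow> 'm \<Rightarrow> real^'n"
    and K :: "'i \<Rightarrow> 'm set"
  assumes cover: "compact_chart_cover r A\<^sub>M \<T> I U \<psi> \<phi> K"
begin

abbreviation "\<F> \<equiv> compatible_flows r A\<^sub>M \<pi> \<T>"
abbreviation "X \<equiv> flow_topology r A\<^sub>M \<pi> \<T> I U \<psi> \<phi> K"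

lemma cover_charts:
  assumes "i \<in> I"
  shows "(U i, \<psi> i) \<in> \<T>" "(U i, \<phi> i) \<in> Cr_charts r A\<^sub>M" "compact (K i)" "K i \<subseteq> U i" "is_chart (U i, \<phi> i)"
  using cover assms Cr_charts_chart by (auto simp: compact_chart_cover_def)

text \<open>The generating function in coordinates; the topology is that of uniform convergence of its derivatives on \<open>\<phi> i ` K i\<close>.\<close>

definition vel :: "'i \<Rightarrow> (real \<Rightarrow> 'w \<Rightarrow> 'w) \<Rightarrow> real^'n \<Rightarrow> real^'d" where
  "vel i g = gen_fun r A\<^sub>M \<pi> g (U i, \<psi> i) \<circ> inv_into (U i) (\<phi> i)"

text \<open>Some fixed coordinate direction. Control of the derivative in one direction is enough to exclude resonances.\<close>

definition e\<^sub>1 :: "real^'n" where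
  "e\<^sub>1 = (SOME b. b \<in> Basis)"

lemma e\<^sub>1: "e\<^sub>1 \<in> Basis"
  unfolding e\<^sub>1_def by (rule SOME_Basis)

lemma length_e\<^sub>1: "enat (length [e\<^sub>1]) \<le> r"
  using r by (simp add: one_enat_def)

definition dvel :: "'i \<Rightarrow> real^'d \<Rightarrow> (real \<Rightarrow> 'w \<Rightarrow> 'w) \<Rightarrow> real^'n \<Rightarrow> real" where
  "dvel i \<xi> g x = \<xi> \<bullet> pderivs [e\<^sub>1] (vel i g) x"

lemma Cr_on_vel: "i \<in> I \<Longrightarrow> g \<in> \<F> \<Longrightarrow> Cr_on r (\<phi> i ` U i) (vel i g)"
  unfolding vel_def using cover_charts by (intro Cr_on_gen_fun) auto

lemma continuous_dvel: "i \<in> I \<Longrightarrow> g \<in> \<F> \<Longrightarrow> continuous_on (\<phi> i ` U i) (dvel i \<xi> g)"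
proof -
  assume "i \<in> I" "g \<in> \<F>"
  then have "continuous_on (\<phi> i ` U i) (pderivs [e\<^sub>1] (vel i g))"
    using Cr_on_vel[of i g] length_e\<^sub>1 e\<^sub>1 unfolding Cr_on_def by (meson Cons_in_lists_iff lists.Nil)
  then show ?thesis unfolding dvel_def[abs_def] by (intro continuous_intros)
qed

lemma compact_piece: "i \<in> I \<Longrightarrow> compact (cball p \<rho> \<inter> \<phi> i ` K i)"
  and piece_subset: "i \<in> I \<Longrightarrow> cball p \<rho> \<inter> \<phi> i ` K i \<subseteq> \<phi> i ` U i"
proof -
  assume i: "i \<in> I"
  note c = cover_charts[OF i]
  have "compact (\<phi> i ` K i)"
    using c by (intro compact_continuous_image continuous_on_subset[OF is_chartD(4)])
  then show "compact (cball p \<rho> \<inter> \<phi> i ` K i)" by (rule compact_Int[OF compact_cball])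
  show "cball p \<rho> \<inter> \<phi> i ` K i \<subseteq> \<phi> i ` U i" using c by auto
qed

lemmas closed_piece = compact_imp_closed[OF compact_piece]

definition noncritical :: "'i \<Rightarrow> real^'n \<Rightarrow> real \<Rightarrow> real^'d \<Rightarrow> nat \<Rightarrow> (real \<Rightarrow> 'w \<Rightarrow> 'w) set" where
  "noncritical i p \<rho> \<xi> k = {g \<in> \<F>.
    emeasure lborel {x \<in> cball p \<rho> \<inter> \<phi> i ` K i. dvel i \<xi> g x = 0} < ennreal (1 / Suc k)}"

text \<open>The sets \<open>{\<bar>\<xi>\<bullet>\<partial>v\<bar> \<le> 1/l}\<close> decrease to the critical set, so one of them still has measure below the
bound, and it contains the critical sets of all flows whose derivative is within \<open>1/l\<close>.\<close>

lemma openin_noncritical: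
  assumes i: "i \<in> I"
  shows "openin X (noncritical i p \<rho> \<xi> k)"
  unfolding openin_flow_topology
proof (intro conjI ballI allI impI)
  show "noncritical i p \<rho> \<xi> k \<subseteq> \<F>" by (auto simp: noncritical_def)
  fix g G
  assume "g \<in> noncritical i p \<rho> \<xi> k" and G: "range G \<subseteq> \<F> \<and> flows_converge r A\<^sub>M \<pi> I U \<psi> \<phi> K G g"
  then have g: "g \<in> \<F>" and small: "emeasure lborel {x \<in> cball p \<rho> \<inter> \<phi> i ` K i. dvel i \<xi> g x = 0} < ennreal (1 / Suc k)"
    by (auto simp: noncritical_def)
  let ?L = "cball p \<rho> \<inter> \<phi> i ` K i"
  have cont: "continuous_on ?L (dvel i \<xi> g)"
    by (rule continuous_on_subset[OF continuous_dvel[OF i g] piece_subset[OF i]])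
  define S where "S l = {x\<in>?L. \<bar>dvel i \<xi> g x\<bar> \<le> 1 / Suc l}" for l :: nat
  have S: "S l \<in> sets lborel" for l
  proof -
    have "closed (?L \<inter> (\<lambda>x. \<bar>dvel i \<xi> g x\<bar>) -` {..1 / Suc l})"
      by (rule continuous_closed_preimage[OF continuous_on_rabs[OF cont] closed_piece[OF i] closed_atMost])
    also have "?L \<inter> (\<lambda>x. \<bar>dvel i \<xi> g x\<bar>) -` {..1 / Suc l} = S l" by (auto simp: S_def)
    finally show ?thesis by (simp add: borel_closed)
  qed
  have "(\<lambda>l. emeasure lborel (S l)) \<longlonglongrightarrow> emeasure lborel (\<Inter>l. S l)"
  proof (rule Lim_emeasure_decseq)
    show "range S \<subseteq> sets lborel" using S by auto
    show "decseq S"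
    proof (rule decseq_SucI, rule subsetI)
      fix l x assume "x \<in> S (Suc l)"
      moreover have "1 / real (Suc (Suc l)) \<le> 1 / real (Suc l)" by (simp add: frac_le)
      ultimately show "x \<in> S l" unfolding S_def by (auto intro: order_trans)
    qed
    show "emeasure lborel (S l) \<noteq> \<infinity>" for l
    proof -
      have "emeasure lborel (S l) \<le> emeasure lborel ?L"
        using compact_imp_closed[OF compact_piece[OF i]] by (intro emeasure_mono) (auto simp: S_def borel_closed)
      also have "\<dots> < \<infinity>" by (rule emeasure_compact_finite[OF compact_piece[OF i]])
      finally show ?thesis by simp
    qed
  qed
  moreover have "(\<Inter>l. S l) = {x\<in>?L. dvel i \<xi> g x = 0}"
  proof (intro set_eqI iffI)
    fix x assume x: "x \<in> (\<Inter>l. S l)"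
    have "\<bar>dvel i \<xi> g x\<bar> \<le> 0"
    proof (rule LIMSEQ_le_const)
      show "(\<lambda>l. 1 / real (Suc l)) \<longlonglongrightarrow> 0" by (rule LIMSEQ_Suc[OF lim_1_over_n])
    qed (use x in \<open>auto simp: S_def\<close>)
    then show "x \<in> {x\<in>?L. dvel i \<xi> g x = 0}" using x by (auto simp: S_def)
  qed (auto simp: S_def)
  ultimately have "(\<lambda>l. emeasure lborel (S l)) \<longlonglongrightarrow> emeasure lborel {x\<in>?L. dvel i \<xi> g x = 0}" by simp
  from order_tendstoD(2)[OF this small] obtain l where l: "emeasure lborel (S l) < ennreal (1 / Suc k)"
    by (auto simp: eventually_sequentially)
  have "uniform_limit (\<phi> i ` K i) (\<lambda>m. pderivs [e\<^sub>1] (vel i (G m))) (pderivs [e\<^sub>1] (vel i g)) sequentially"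
    using G i e\<^sub>1 length_e\<^sub>1 unfolding flows_converge_def vel_def by (meson Cons_in_lists_iff lists.Nil)
  \<comment> \<open>The summand \<open>1\<close> only avoids a division by \<open>0\<close> for \<open>\<xi> = 0\<close>.\<close>
  then have "eventually (\<lambda>m. \<forall>x\<in>\<phi> i ` K i. dist (pderivs [e\<^sub>1] (vel i (G m)) x) (pderivs [e\<^sub>1] (vel i g) x)
      < 1 / Suc l / (norm \<xi> + 1)) sequentially"
    by (rule uniform_limitD) (simp add: add_nonneg_pos)
  then show "eventually (\<lambda>m. G m \<in> noncritical i p \<rho> \<xi> k) sequentially"
  proof eventually_elim
    case (elim m)
    have "{x\<in>?L. dvel i \<xi> (G m) x = 0} \<subseteq> S l"
    proof
      fix x assume x: "x \<in> {x\<in>?L. dvel i \<xi> (G m) x = 0}"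
      let ?d = "pderivs [e\<^sub>1] (vel i (G m)) x - pderivs [e\<^sub>1] (vel i g) x"
      have "\<bar>dvel i \<xi> g x\<bar> = \<bar>\<xi> \<bullet> ?d\<bar>"
        using x by (simp only: mem_Collect_eq inner_diff_right dvel_def)
      also have "\<dots> \<le> norm \<xi> * norm ?d" by (rule Cauchy_Schwarz_ineq2)
      also have "\<dots> \<le> (norm \<xi> + 1) * norm ?d" by (simp add: mult_right_mono)
      also have "\<dots> \<le> (norm \<xi> + 1) * (1 / Suc l / (norm \<xi> + 1))"
        using elim x by (intro mult_left_mono) (auto simp: dist_norm intro!: less_imp_le)
      also have "\<dots> = 1 / Suc l"
      proof -
        have "norm \<xi> + 1 \<noteq> 0" using norm_ge_zero[of \<xi>] by linarith
        then show ?thesis by simp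
      qed
      finally show "x \<in> S l" using x by (simp add: S_def)
    qed
    then have "emeasure lborel {x\<in>?L. dvel i \<xi> (G m) x = 0} < ennreal (1 / Suc k)"
      using l S[of l] by (meson emeasure_mono le_less_trans)
    then show ?case using G by (auto simp: noncritical_def)
  qed
qed

text \<open>The perturbation adds \<open>s \<beta> \<xi>\<close> to the velocity, hence \<open>s |\<xi>|\<^sup>2 \<partial>\<beta>\<close> to \<open>\<xi>\<bullet>\<partial>v\<close>. For all but countably many \<open>s\<close> the
critical set in the ball becomes null, and along a sequence of such \<open>s\<close> tending to \<open>0\<close> the perturbed
flows converge to the given one: in every chart of the cover the generating function changes by
\<open>s\<close> times a fixed function of class \<open>C^r\<close>, whose derivatives are bounded on the compact piece.\<close>

lemma dense_noncritical:
  assumes i: "i \<in> I" and \<rho>: "0 < \<rho>" and sub: "cball p \<rho> \<subseteq> \<phi> i ` U i" and \<xi>: "\<xi> \<noteq> 0"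
  shows "X closure_of noncritical i p \<rho> \<xi> k = topspace X"
proof (rule antisym[OF closure_of_subset_topspace], rule subsetI)
  fix g assume "g \<in> topspace X"
  then have g: "g \<in> \<F>" by (simp add: topspace_flow_topology)
  note c = cover_charts[OF i]
  let ?L = "cball p \<rho> \<inter> \<phi> i ` K i"
  define w where "w = chart_bump (U i) (\<phi> i) p \<rho>"
  have w: "Cr_map r A\<^sub>M UNIV euclidean_atlas w"
    unfolding w_def using c \<rho> sub by (intro Cr_map_chart_bump) auto
  have w0: "w x = 0" if "x \<notin> U i" for x using that by (simp add: w_def chart_bump_def)
  define h where "h s = perturbed_flow (U i) (\<psi> i) g w (s *\<^sub>R \<xi>)" for s
  have h: "h s \<in> \<F>" for s
    unfolding h_def by (rule perturbed_flow_compatible[OF c(1) g w w0])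
  have oU: "open (\<phi> j ` U j)" if "j \<in> I" for j
    by (rule is_chartD(2)[OF cover_charts(5)[OF that]])
  have wj: "Cr_on r (\<phi> j ` U j) (\<lambda>x. (w \<circ> inv_into (U j) (\<phi> j)) x *\<^sub>R a)" if "j \<in> I" for j and a :: "real^'d"
    using Cr_map_euclidean_chart[OF cover_charts(2)[OF that] open_UNIV w]
    by (intro Cr_on_scaleR[OF oU[OF that]] Cr_on_const[OF oU[OF that]]) (simp add: comp_def)
  have vel_h: "vel j (h s) x = vel j g x + s *\<^sub>R ((w \<circ> inv_into (U j) (\<phi> j)) x *\<^sub>R a)"
    if j: "j \<in> I" and x: "x \<in> \<phi> j ` U j"
      and gen: "\<And>b v. generates r A\<^sub>M \<pi> g (U j, \<psi> j) v \<Longrightarrow>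
        generates r A\<^sub>M \<pi> (perturbed_flow (U i) (\<psi> i) g w (s *\<^sub>R \<xi>)) (U j, \<psi> j) (\<lambda>x. v x + w x *\<^sub>R (s *\<^sub>R a))"
    for j s x a
  proof -
    note cj = cover_charts[OF j]
    have "inv_into (U j) (\<phi> j) x \<in> U j" using x by (rule inv_into_into)
    then show ?thesis
      using gen_fun_eqI[OF cj(1) gen[OF gen_fun_generates[OF g cj(1)]]]
      by (simp add: vel_def h_def mult.commute)
  qed
  have conv: "flows_converge r A\<^sub>M \<pi> I U \<psi> \<phi> K (\<lambda>m. h (s m)) g" if s: "s \<longlonglongrightarrow> 0" for s
    unfolding flows_converge_def vel_def[symmetric]
  proof (intro ballI impI)
    fix j and bs :: "(real^'n) list"
    assume j: "j \<in> I" and bs: "bs \<in> lists Basis" "enat (length bs) \<le> r"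
    note cj = cover_charts[OF j]
    obtain A :: "int^'d^'d" and \<alpha> where A: "\<forall>x\<in>U i \<inter> U j. \<forall>y.
        \<psi> j (inv_into (\<pi> -` U i) (\<psi> i) (x, y)) = (x, \<alpha> x + torus_mat A y)"
      using affine_change_ex[OF c(1) cj(1)] by blast
    define a where "a = map_matrix real_of_int A *v \<xi>"
    define q where "q = pderivs bs (\<lambda>x. (w \<circ> inv_into (U j) (\<phi> j)) x *\<^sub>R a)"
    have gen: "generates r A\<^sub>M \<pi> (perturbed_flow (U i) (\<psi> i) g w (s *\<^sub>R \<xi>)) (U j, \<psi> j) (\<lambda>x. v x + w x *\<^sub>R (s *\<^sub>R a))"
      if v: "generates r A\<^sub>M \<pi> g (U j, \<psi> j) v" for v s
    proof -
      have "s *\<^sub>R a = map_matrix real_of_int A *v (s *\<^sub>R \<xi>)" by (simp add: a_def matrix_vector_mult_scaleR)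
      then show ?thesis
        using perturbed_flow_generates[OF c(1) g w w0 cj(1) v, of \<alpha> A "s *\<^sub>R \<xi>"] A by simp
    qed
    have eq: "pderivs bs (vel j (h s)) x = pderivs bs (vel j g) x + s *\<^sub>R q x" if x: "x \<in> \<phi> j ` U j" for s x
    proof -
      have "pderivs bs (vel j (h s)) x
          = pderivs bs (\<lambda>x. vel j g x + s *\<^sub>R ((w \<circ> inv_into (U j) (\<phi> j)) x *\<^sub>R a)) x"
        by (rule pderivs_cong_open[OF oU[OF j] vel_h[OF j _ gen] x])
      then show ?thesis
        unfolding q_def using pderivs_add_scaleR[OF oU[OF j] Cr_on_vel[OF j g] wj[OF j] bs x] by simp
    qed
    have "continuous_on (\<phi> j ` U j) q"
      using wj[OF j] bs unfolding Cr_on_def q_def by blast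
    then have "compact (q ` (\<phi> j ` K j))"
      using cj by (intro compact_continuous_image[OF continuous_on_subset]
          compact_continuous_image[OF continuous_on_subset[OF is_chartD(4)[OF cj(5)]]]) auto
    then obtain B where B: "B > 0" "\<And>x. x \<in> \<phi> j ` K j \<Longrightarrow> norm (q x) \<le> B"
      using compact_imp_bounded bounded_pos by (metis imageI)
    show "uniform_limit (\<phi> j ` K j) (\<lambda>m. pderivs bs (vel j (h (s m)))) (pderivs bs (vel j g)) sequentially"
    proof (rule uniform_limitI)
      fix e :: real assume "e > 0"
      then have "eventually (\<lambda>m. dist (s m) 0 < e / B) sequentially"
        using s B(1) by (intro tendstoD) auto
      then show "eventually (\<lambda>m. \<forall>x\<in>\<phi> j ` K j. dist (pderivs bs (vel j (h (s m))) x) (pderivs bs (vel j g) x) < e) sequentially"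
      proof eventually_elim
        case (elim m)
        show ?case
        proof
          fix x assume x: "x \<in> \<phi> j ` K j"
          then have "x \<in> \<phi> j ` U j" using cj(4) by auto
          then have "dist (pderivs bs (vel j (h (s m))) x) (pderivs bs (vel j g) x) = \<bar>s m\<bar> * norm (q x)"
            by (simp add: eq dist_norm)
          also have "\<dots> \<le> \<bar>s m\<bar> * B" using B(2)[OF x] by (intro mult_left_mono) auto
          also have "\<dots> < e" using elim B(1) by (simp add: dist_real_def pos_less_divide_eq)
          finally show "dist (pderivs bs (vel j (h (s m))) x) (pderivs bs (vel j g) x) < e" .
        qed
      qed
    qed
  qed
  define \<beta> where "\<beta> x = frechet_derivative (ball_bump p \<rho>) (at x) e\<^sub>1" for x :: "real^'n"
  have dvel_h: "dvel i \<xi> (h s) x = dvel i \<xi> g x + s * ((\<xi> \<bullet> \<xi>) * \<beta> x)" if x: "x \<in> \<phi> i ` U i" for s x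
  proof -
    have gen: "generates r A\<^sub>M \<pi> (perturbed_flow (U i) (\<psi> i) g w (s *\<^sub>R \<xi>)) (U i, \<psi> i) (\<lambda>x. v x + w x *\<^sub>R (s *\<^sub>R \<xi>))"
      if "generates r A\<^sub>M \<pi> g (U i, \<psi> i) v" for v
      by (rule perturbed_flow_generates_self[OF c(1) g w w0 that])
    have bump: "(w \<circ> inv_into (U i) (\<phi> i)) x *\<^sub>R \<xi> = ball_bump p \<rho> x *\<^sub>R \<xi>" if "x \<in> \<phi> i ` U i" for x
      using that inv_into_into[OF that] f_inv_into_f[OF that] by (simp add: w_def chart_bump_def)
    have "pderivs [e\<^sub>1] (vel i (h s)) x = pderivs [e\<^sub>1] (\<lambda>x. vel i g x + s *\<^sub>R ((w \<circ> inv_into (U i) (\<phi> i)) x *\<^sub>R \<xi>)) x"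
      by (rule pderivs_cong_open[OF oU[OF i] vel_h[OF i _ gen] x])
    also have "\<dots> = pderivs [e\<^sub>1] (vel i g) x + s *\<^sub>R pderivs [e\<^sub>1] (\<lambda>x. (w \<circ> inv_into (U i) (\<phi> i)) x *\<^sub>R \<xi>) x"
      using e\<^sub>1 by (intro pderivs_add_scaleR[OF oU[OF i] Cr_on_vel[OF i g] wj[OF i] _ length_e\<^sub>1 x]) auto
    also have "pderivs [e\<^sub>1] (\<lambda>x. (w \<circ> inv_into (U i) (\<phi> i)) x *\<^sub>R \<xi>) x = pderivs [e\<^sub>1] (\<lambda>x. ball_bump p \<rho> x *\<^sub>R \<xi>) x"
      by (rule pderivs_cong_open[OF oU[OF i] bump x])
    also have "\<dots> = \<beta> x *\<^sub>R \<xi>"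
    proof -
      have d: "(ball_bump p \<rho> has_derivative frechet_derivative (ball_bump p \<rho>) (at x)) (at x)"
        using ball_bump_derivative frechet_derivative_at by metis
      have "((\<lambda>x. ball_bump p \<rho> x *\<^sub>R \<xi>) has_derivative (\<lambda>k. frechet_derivative (ball_bump p \<rho>) (at x) k *\<^sub>R \<xi>)) (at x)"
        by (rule has_derivative_scaleR_left[OF d])
      from frechet_derivative_at[OF this, symmetric] show ?thesis by (simp add: \<beta>_def)
    qed
    finally show ?thesis by (simp only: dvel_def inner_add_right inner_scaleR_right) (simp add: mult_ac)
  qed
  \<comment> \<open>The exceptional parameters, for which the critical set has positive measure where \<open>\<partial>\<beta> \<noteq> 0\<close>.\<close>
  define bad where "bad = {s. emeasure lborel {x\<in>?L. (\<xi> \<bullet> \<xi>) * \<beta> x \<noteq> 0 \<and> dvel i \<xi> g x + s * ((\<xi> \<bullet> \<xi>) * \<beta> x) = 0} \<noteq> 0}"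
  have cont_\<beta>: "continuous_on S \<beta>" for S
  proof -
    have "continuous_on UNIV (pderivs [e\<^sub>1] (ball_bump p \<rho>))"
      using Cr_on_ball_bump[of r p \<rho>] e\<^sub>1 length_e\<^sub>1 unfolding Cr_on_def by (meson Cons_in_lists_iff lists.Nil)
    then show ?thesis unfolding \<beta>_def[abs_def] by (auto intro: continuous_on_subset)
  qed
  have "countable bad"
    unfolding bad_def
    by (intro countable_levels_positive_measure compact_piece[OF i] continuous_intros cont_\<beta>
        continuous_on_subset[OF continuous_dvel[OF i g] piece_subset[OF i]])
  then have "\<exists>s. 0 < s \<and> s < 1 / real (Suc m) \<and> s \<notin> bad" for m
  proof -
    have "uncountable ({0<..<1 / real (Suc m)} - bad)"
      using \<open>countable bad\<close> by (intro uncountable_minus_countable uncountable_open_interval[THEN iffD2]) auto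
    then obtain s where "s \<in> {0<..<1 / real (Suc m)} - bad" by (metis countable_empty ex_in_conv)
    then show ?thesis by (intro exI[of _ s]) simp
  qed
  then obtain s where s: "\<And>m. 0 < s m" "\<And>m. s m < 1 / real (Suc m)" "\<And>m. s m \<notin> bad" by metis
  have "s \<longlonglongrightarrow> 0"
    by (rule tendsto_sandwich[OF _ _ tendsto_const LIMSEQ_Suc[OF lim_1_over_n]])
      (use s in \<open>auto intro!: always_eventually less_imp_le\<close>)
  then have lim: "flows_converge r A\<^sub>M \<pi> I U \<psi> \<phi> K (\<lambda>m. h (s m)) g" by (rule conv)
  have hs: "h (s m) \<in> noncritical i p \<rho> \<xi> k" for m
  proof -
    let ?C = "{x\<in>?L. (\<xi> \<bullet> \<xi>) * \<beta> x \<noteq> 0 \<and> dvel i \<xi> g x + s m * ((\<xi> \<bullet> \<xi>) * \<beta> x) = 0}"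
    have "negligible {x\<in>cball p \<rho>. \<beta> x = 0}"
      unfolding \<beta>_def by (rule negligible_ball_bump_critical[OF e\<^sub>1 \<rho>])
    then obtain N where N: "N \<in> null_sets lborel" "{x\<in>cball p \<rho>. \<beta> x = 0} \<subseteq> N"
      by (rule negligible_Borel_cover)
    have eq: "{x\<in>?L. dvel i \<xi> (h (s m)) x = 0} = {x\<in>?L. dvel i \<xi> g x + s m * ((\<xi> \<bullet> \<xi>) * \<beta> x) = 0}"
    proof (rule Collect_cong, rule conj_cong[OF refl])
      fix x assume "x \<in> ?L"
      then have "x \<in> \<phi> i ` U i" using piece_subset[OF i] by blast
      from dvel_h[OF this]
      show "dvel i \<xi> (h (s m)) x = 0 \<longleftrightarrow> dvel i \<xi> g x + s m * ((\<xi> \<bullet> \<xi>) * \<beta> x) = 0" by simp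
    qed
    have Cm: "?C \<in> sets lborel"
    proof -
      let ?u = "\<lambda>x. dvel i \<xi> g x + s m * ((\<xi> \<bullet> \<xi>) * \<beta> x)"
      have "continuous_on ?L ?u"
        by (intro continuous_intros cont_\<beta> continuous_on_subset[OF continuous_dvel[OF i g] piece_subset[OF i]])
      then have "closed (?L \<inter> ?u -` {0})"
        by (rule continuous_closed_preimage[OF _ closed_piece[OF i] closed_singleton])
      moreover have "open {x. (\<xi> \<bullet> \<xi>) * \<beta> x \<noteq> 0}"
        by (intro open_Collect_neq continuous_intros cont_\<beta>)
      ultimately have "(?L \<inter> ?u -` {0}) \<inter> {x. (\<xi> \<bullet> \<xi>) * \<beta> x \<noteq> 0} \<in> sets borel"
        by (rule sets.Int[OF borel_closed borel_open])
      also have "(?L \<inter> ?u -` {0}) \<inter> {x. (\<xi> \<bullet> \<xi>) * \<beta> x \<noteq> 0} = ?C" by blast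
      finally show ?thesis by simp
    qed
    have "emeasure lborel {x\<in>?L. dvel i \<xi> (h (s m)) x = 0} \<le> emeasure lborel (?C \<union> N)"
      unfolding eq using N Cm \<xi> by (intro emeasure_mono) auto
    also have "\<dots> \<le> emeasure lborel ?C + emeasure lborel N"
      using N Cm by (intro emeasure_subadditive) auto
    also have "\<dots> = 0" using s(3)[of m] N by (simp add: bad_def null_setsD1)
    finally show ?thesis using h by (simp add: noncritical_def)
  qed
  show "g \<in> X closure_of noncritical i p \<rho> \<xi> k"
    unfolding in_closure_of
  proof (intro conjI allI impI)
    show "g \<in> topspace X" using g by (simp only: topspace_flow_topology)
    fix T assume T: "g \<in> T \<and> openin X T"
    have "range (\<lambda>m. h (s m)) \<subseteq> \<F>" using h by auto
    moreover have "\<forall>G. range G \<subseteq> \<F> \<and> flows_converge r A\<^sub>M \<pi> I U \<psi> \<phi> K G g \<longrightarrow>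
        eventually (\<lambda>m. G m \<in> T) sequentially"
      using T unfolding openin_flow_topology by (elim conjE) (erule (1) bspec)
    ultimately have "eventually (\<lambda>m. h (s m) \<in> T) sequentially"
      using lim by (elim allE[of _ "\<lambda>m. h (s m)"] impE conjI)
    then obtain m where "h (s m) \<in> T" by (auto simp: eventually_sequentially)
    then show "\<exists>y. y \<in> noncritical i p \<rho> \<xi> k \<and> y \<in> T" using hs by blast
  qed
qed

text \<open>A second countable space is covered by countably many open sets that each meet only finitely many
members of the locally finite cover.\<close>

lemma countable_nonempty_indices: "countable {i\<in>I. U i \<noteq> {}}"
proof -
  define F where "F = {N. open N \<and> finite {i\<in>I. U i \<inter> N \<noteq> {}}}"
  obtain F' where F': "F' \<subseteq> F" "countable F'" "\<Union>F' = \<Union>F"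
    using Lindelof[of F] by (auto simp: F_def)
  have "\<Union>F = UNIV" using cover by (auto simp: F_def compact_chart_cover_def)
  have "{i\<in>I. U i \<noteq> {}} \<subseteq> (\<Union>N\<in>F'. {i\<in>I. U i \<inter> N \<noteq> {}})"
  proof
    fix i assume "i \<in> {i\<in>I. U i \<noteq> {}}"
    then obtain m where m: "i \<in> I" "m \<in> U i" by blast
    have "m \<in> \<Union>F'" by (simp add: F'(3) \<open>\<Union>F = UNIV\<close>)
    then obtain N where N: "N \<in> F'" "m \<in> N" by blast
    with m have "i \<in> {i\<in>I. U i \<inter> N \<noteq> {}}" by blast
    with N(1) show "i \<in> (\<Union>N\<in>F'. {i\<in>I. U i \<inter> N \<noteq> {}})" by (rule UN_I)
  qed
  moreover have "countable (\<Union>N\<in>F'. {i\<in>I. U i \<inter> N \<noteq> {}})"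
    using F' by (intro countable_UN) (auto simp: F_def intro: countable_finite)
  ultimately show ?thesis by (rule countable_subset)
qed

text \<open>The velocity is of class \<open>C\<^sup>1\<close> in the chart since \<open>r \<ge> 1\<close>, so the criterion on critical points applies.\<close>

lemma negligible_resonances:
  assumes i: "i \<in> I" and g: "g \<in> \<F>" and crit: "negligible {x\<in>\<phi> i ` K i. dvel i \<xi> g x = 0}"
    and N: "N \<in> null_sets lborel"
  shows "negligible {x\<in>\<phi> i ` K i. \<xi> \<bullet> vel i g x \<in> N}"
proof (rule negligible_vimage_noncritical[OF is_chartD(2)[OF cover_charts(5)[OF i]] e\<^sub>1, where
      f' = "\<lambda>x k. \<xi> \<bullet> frechet_derivative (vel i g) (at x) k"])
  show "((\<lambda>x. \<xi> \<bullet> vel i g x) has_derivative (\<lambda>k. \<xi> \<bullet> frechet_derivative (vel i g) (at x) k)) (at x)"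
    if "x \<in> \<phi> i ` U i" for x
    using Cr_on_differentiable[OF Cr_on_vel[OF i g] r that]
    by (intro has_derivative_inner_right) (simp add: frechet_derivative_works)
  show "continuous_on (\<phi> i ` U i) (\<lambda>x. \<xi> \<bullet> frechet_derivative (vel i g) (at x) e\<^sub>1)"
    using continuous_dvel[OF i g, of \<xi>] by (simp add: dvel_def[abs_def])
  show "negligible {x \<in> \<phi> i ` K i. \<xi> \<bullet> frechet_derivative (vel i g) (at x) e\<^sub>1 = 0}"
    using crit by (simp add: dvel_def)
  show "\<phi> i ` K i \<subseteq> \<phi> i ` U i" using cover_charts(4)[OF i] by auto
qed (rule N)

theorem keplerian_shear_of_negligible_critical_sets:
  assumes g: "g \<in> \<F>"
    and crit: "\<And>i \<xi>. i \<in> I \<Longrightarrow> U i \<noteq> {} \<Longrightarrow> \<xi> \<in> int_vec \<Longrightarrow> \<xi> \<noteq> 0 \<Longrightarrow>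
      negligible {x\<in>\<phi> i ` K i. dvel i \<xi> g x = 0}"
    and meas: "prob_space \<mu>" "compatible_measure \<pi> \<T> \<mu>" "abs_cont_in_charts r A\<^sub>\<Omega> \<mu>"
  shows "keplerian_shear \<mu> g"
proof -
  interpret bundle_flow r A\<^sub>M A\<^sub>\<Omega> \<pi> \<T> g \<mu>
    by (intro bundle_flow.intro affine_bundle_axioms bundle_flow_axioms.intro g meas)
  let ?I = "{i\<in>I. U i \<noteq> {}}"
  have "(\<Union>i\<in>I. K i) = UNIV" using cover by (simp add: compact_chart_cover_def)
  then have KI: "(\<Union>i\<in>?I. K i) = UNIV" using cover_charts(4) by blast
  then have "?I \<noteq> {}" by auto
  define j where "j = from_nat_into ?I"
  have j: "range j = ?I"
    unfolding j_def by (rule range_from_nat_into[OF \<open>?I \<noteq> {}\<close> countable_nonempty_indices])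
  then have jI: "j n \<in> I" "U (j n) \<noteq> {}" for n by blast+
  show ?thesis
  proof (rule keplerian_shear_if_nonresonant[where U = "\<lambda>n. U (j n)" and \<psi> = "\<lambda>n. \<psi> (j n)"
        and K = "\<lambda>n. K (j n)" and v = "\<lambda>n. gen_fun r A\<^sub>M \<pi> g (U (j n), \<psi> (j n))"])
    show "(U (j n), \<psi> (j n)) \<in> \<T>" "K (j n) \<subseteq> U (j n)" "compact (K (j n))" for n
      using cover_charts[OF jI(1)] by auto
    show "generates r A\<^sub>M \<pi> g (U (j n), \<psi> (j n)) (gen_fun r A\<^sub>M \<pi> g (U (j n), \<psi> (j n)))" for n
      by (rule gen_fun_generates[OF g cover_charts(1)[OF jI(1)]])
    have "(\<Union>n. K (j n)) = (\<Union>i\<in>range j. K i)" by simp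
    also have "\<dots> = UNIV" unfolding j by (rule KI)
    finally show "(\<Union>n. K (j n)) = UNIV" .
    fix n and N :: "real set" and \<xi> :: "real^'d"
    assume \<xi>: "\<xi> \<in> int_vec" "\<xi> \<noteq> 0" and N: "N \<in> null_sets lborel"
    let ?i = "j n"
    note cn = cover_charts[OF jI(1), of n]
    have "negligible {x\<in>\<phi> ?i ` K ?i. \<xi> \<bullet> vel ?i g x \<in> N}"
      by (rule negligible_resonances[OF jI(1) g crit[OF jI \<xi>] N])
    then obtain N' where N': "N' \<in> null_sets \<mu>"
      "{p. \<pi> p \<in> U ?i \<and> \<phi> ?i (\<pi> p) \<in> {x\<in>\<phi> ?i ` K ?i. \<xi> \<bullet> vel ?i g x \<in> N}} \<subseteq> N'"
      by (rule negligible_chart_imp_null[OF cn(1,2) _ sets_\<mu> meas(3)])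
    show "AE p in \<mu>. \<pi> p \<in> K ?i \<longrightarrow> \<xi> \<bullet> gen_fun r A\<^sub>M \<pi> g (U ?i, \<psi> ?i) (\<pi> p) \<notin> N"
    proof (rule AE_I'[OF N'(1)], rule subsetI)
      fix p assume "p \<in> {p\<in>space \<mu>. \<not> (\<pi> p \<in> K ?i \<longrightarrow> \<xi> \<bullet> gen_fun r A\<^sub>M \<pi> g (U ?i, \<psi> ?i) (\<pi> p) \<notin> N)}"
      then have p: "\<pi> p \<in> K ?i" "\<xi> \<bullet> gen_fun r A\<^sub>M \<pi> g (U ?i, \<psi> ?i) (\<pi> p) \<in> N" by auto
      then have "\<pi> p \<in> U ?i" using cn(4) by auto
      moreover from this have "vel ?i g (\<phi> ?i (\<pi> p)) = gen_fun r A\<^sub>M \<pi> g (U ?i, \<psi> ?i) (\<pi> p)"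
        using is_chartD(3)[OF cn(5)] by (simp add: vel_def)
      ultimately show "p \<in> N'" using p N'(2) by auto
    qed
  qed
qed

theorem generic_keplerian_shear:
  "baire_generic X {g \<in> \<F>. \<forall>\<mu>. prob_space \<mu> \<and> compatible_measure \<pi> \<T> \<mu> \<and> abs_cont_in_charts r A\<^sub>\<Omega> \<mu> \<longrightarrow>
    keplerian_shear \<mu> g}"
  (is "baire_generic X ?S")
  unfolding baire_generic_def
proof (intro conjI)
  show "?S \<subseteq> topspace X"
    by (auto simp: topspace_flow_topology)
  let ?I = "{i\<in>I. U i \<noteq> {}}"
  have "\<forall>i\<in>I. \<exists>P. countable P \<and> (\<forall>(p, \<rho>)\<in>P. 0 < \<rho> \<and> cball p \<rho> \<subseteq> \<phi> i ` U i) \<and>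
      \<phi> i ` U i \<subseteq> (\<Union>(p, \<rho>)\<in>P. cball p \<rho>)"
  proof
    fix i assume "i \<in> I"
    from countable_ball_cover[OF is_chartD(2)[OF cover_charts(5)[OF this]]]
    obtain P where "countable P" "\<And>p \<rho>. (p, \<rho>) \<in> P \<Longrightarrow> 0 < \<rho> \<and> cball p \<rho> \<subseteq> \<phi> i ` U i"
      "\<phi> i ` U i \<subseteq> (\<Union>(p, \<rho>)\<in>P. cball p \<rho>)" by blast
    then show "\<exists>P. countable P \<and> (\<forall>(p, \<rho>)\<in>P. 0 < \<rho> \<and> cball p \<rho> \<subseteq> \<phi> i ` U i) \<and>
      \<phi> i ` U i \<subseteq> (\<Union>(p, \<rho>)\<in>P. cball p \<rho>)" by blast
  qed
  then obtain P where P: "\<And>i. i \<in> I \<Longrightarrow> countable (P i)"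
    "\<And>i p \<rho>. i \<in> I \<Longrightarrow> (p, \<rho>) \<in> P i \<Longrightarrow> 0 < \<rho> \<and> cball p \<rho> \<subseteq> \<phi> i ` U i"
    "\<And>i. i \<in> I \<Longrightarrow> \<phi> i ` U i \<subseteq> (\<Union>(p, \<rho>)\<in>P i. cball p \<rho>)"
    by (metis (no_types, lifting) case_prodD)
  define \<O> where "\<O> = (\<Union>i\<in>?I. \<Union>(p, \<rho>)\<in>P i. \<Union>\<xi>\<in>int_vec - {0}. range (noncritical i p \<rho> \<xi>))"
  have "countable \<O>"
    unfolding \<O>_def case_prod_beta using P(1)
    by (intro countable_UN countable_nonempty_indices countable_Diff countable_int_vec) auto
  moreover have "\<forall>V\<in>\<O>. openin X V \<and> X closure_of V = topspace X"
    unfolding \<O>_def using openin_noncritical dense_noncritical P(2) by auto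
  moreover have "topspace X \<inter> \<Inter>\<O> \<subseteq> ?S"
  proof
    fix g assume g': "g \<in> topspace X \<inter> \<Inter>\<O>"
    then have g: "g \<in> \<F>" by (simp add: topspace_flow_topology)
    have "negligible {x\<in>\<phi> i ` K i. dvel i \<xi> g x = 0}"
      if i: "i \<in> I" "U i \<noteq> {}" and \<xi>: "\<xi> \<in> int_vec" "\<xi> \<noteq> 0" for i \<xi>
    proof -
      have piece: "negligible {x\<in>cball p \<rho> \<inter> \<phi> i ` K i. dvel i \<xi> g x = 0}" (is "negligible ?C")
        if p: "(p, \<rho>) \<in> P i" for p \<rho>
      proof -
        have "noncritical i p \<rho> \<xi> k \<in> \<O>" for k unfolding \<O>_def using i \<xi> p by blast
        then have "g \<in> noncritical i p \<rho> \<xi> k" for k using g' by blast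
        then have small: "emeasure lborel ?C < ennreal (1 / Suc k)" for k by (simp add: noncritical_def)
        have "emeasure lborel ?C \<le> ennreal 0"
        proof (rule LIMSEQ_le_const)
          show "(\<lambda>k. ennreal (1 / real (Suc k))) \<longlonglongrightarrow> ennreal 0"
            by (intro tendsto_ennrealI LIMSEQ_Suc[OF lim_1_over_n])
        qed (use small in \<open>auto intro: less_imp_le\<close>)
        moreover have "?C \<in> sets lborel"
        proof -
          have "closed ((cball p \<rho> \<inter> \<phi> i ` K i) \<inter> dvel i \<xi> g -` {0})"
            by (rule continuous_closed_preimage[OF continuous_on_subset[OF continuous_dvel[OF i(1) g]
                  piece_subset[OF i(1)]] closed_piece[OF i(1)] closed_singleton])
          also have "(cball p \<rho> \<inter> \<phi> i ` K i) \<inter> dvel i \<xi> g -` {0} = ?C" by auto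
          finally show ?thesis by (simp add: borel_closed)
        qed
        ultimately have "?C \<in> null_sets lborel" by (simp add: null_sets_def)
        then show ?thesis by (rule null_sets_lborel_imp_negligible)
      qed
      have "negligible (\<Union>(p, \<rho>)\<in>P i. {x\<in>cball p \<rho> \<inter> \<phi> i ` K i. dvel i \<xi> g x = 0})"
        using P(1)[OF i(1)] piece by (intro negligible_countable_Union) auto
      then show ?thesis
        by (rule negligible_subset) (use P(3)[OF i(1)] cover_charts(4)[OF i(1)] in fastforce)
    qed
    then show "g \<in> ?S"
      using keplerian_shear_of_negligible_critical_sets[OF g] g by blast
  qed
  ultimately show "\<exists>\<O>. countable \<O> \<and> (\<forall>V\<in>\<O>. openin X V \<and> X closure_of V = topspace X) \<and>
      topspace X \<inter> \<Inter>\<O> \<subseteq> ?S"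
    by blast
qed

end

theorem proposition2p4:
  fixes r :: enat
    and A\<^sub>M :: "('m::{t2_space, second_countable_topology}, real^'n) chart set"
    and A\<^sub>\<Omega> :: "('w::{t2_space, second_countable_topology}, (real^'n) \<times> (real^'d)) chart set"
    and \<pi> :: "'w \<Rightarrow> 'm"
    and \<T> :: "('m set \<times> ('w \<Rightarrow> 'm \<times> 'd torus)) set"
    and I :: "'i set"
    and U :: "'i \<Rightarrow> 'm set"
    and \<psi> :: "'i \<Rightarrow> 'w \<Rightarrow> 'm \<times> 'd torus"
    and \<phi> :: "'i \<Rightarrow> 'm \<Rightarrow> real^'n"
    and K :: "'i \<Rightarrow> 'm set"
  assumes "1 \<le> r"
    and "affine_tori_bundle r A\<^sub>M A\<^sub>\<Omega> \<pi> \<T>"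
    and "compact_chart_cover r A\<^sub>M \<T> I U \<psi> \<phi> K"
  shows "baire_generic (flow_topology r A\<^sub>M \<pi> \<T> I U \<psi> \<phi> K)
    {g \<in> compatible_flows r A\<^sub>M \<pi> \<T>.
      \<forall>\<mu>. prob_space \<mu> \<and> compatible_measure \<pi> \<T> \<mu> \<and> abs_cont_in_charts r A\<^sub>\<Omega> \<mu> \<longrightarrow>
        keplerian_shear \<mu> g}"
proof -
  interpret charted_bundle r A\<^sub>M A\<^sub>\<Omega> \<pi> \<T> I U \<psi> \<phi> K
    by standard (use assms in auto)
  show ?thesis by (rule generic_keplerian_shear)
qed

end
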